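(* Consider, for fixed $n\geq1$, the class of all equations $\Omega_F^n[y]=0$ with $F=F(x,y)$ an arbitrary function, and invertible point transformations $$x=\rho(z,w),\qquad y=\psi(z,w),\qquad \rho_z\psi_w-\rho_w\psi_z\neq0.$$ (a) For $n=1$, the equivalence transformations of this class are given by any such point transformation, and the parameter function $Q_1(z,w)$ of the transformed equation $\Omega_{Q_1}[w]=0$ is $$Q_1=\frac{F(\rho,\psi)\,\psi\,\rho_z+\psi_z}{w\left[F(\rho,\psi)\,\psi\,\rho_w+\psi_w\right]}.$$ (b) For $n\geq2$, the equivalence transformations of this class are exactly those with $$\rho=\frac{k_2z+k_1}{k_4z+k_3}\quad(k_4=0\text{ or }1),\qquad \psi=R\,w,$$ where $k_1,k_2,k_3$ are arbitrary constants with $k_2k_3-k_1k_4\ne0$ and $R=R(z)$ is an arbitrary nonzero function, and the parameter function $Q_n(z,w)$ of the transformed equation $\Omega_{Q_n}^n[w]=0$ is $$Q_n(z,w)=F(\rho,R\,w)\,\rho_z+\frac{R_z}{R}-\left(\frac{n-1}{2}\right)\frac{\rho_{zz}}{\rho_z}.$$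
   Context: For a scalar function $F=F(x,y)$, the operator $\Omega_F=\frac{d}{dx}+F(x,y)$ acts, for $y=y(x)$, by $\Omega_F[u]=\frac{du}{dx}+F(x,y(x))\,u$ (the coefficient $F$ always being evaluated at the original unknown $y$). In particular $\Omega_F[y]=y_x+F(x,y)y$, and $\Omega_F^n[y]$ denotes the $n$-fold iterate applied to $y$. $F$ is called the parameter function of the equation $\Omega_F^n[y]=0$. Similarly $\Omega_Q^n[w]$, with $w=w(z)$ and $Q=Q(z,w)$, uses $\Omega_Q=\frac{d}{dz}+Q(z,w)$. For fixed $n$, an equivalence transformation of the class of equations $\Omega_F^n[y]=0$ ($F$ arbitrary) is an invertible point transformation $x=\rho(z,w)$, $y=\psi(z,w)$ which transforms every equation $\Omega_F^n[y]=0$ of the class into an equation equivalent (up to a nonvanishing factor) to $\Omega_Q^n[w]=0$ for some function $Q=Q(z,w)$; $Q$ is the parameter function of the transformed equation. All functions are assumed sufficiently smooth and considered locally, where the expressions involved are defined (nonvanishing denominators). Subscripts denote derivatives. *)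

theory Defs
  imports "HOL-Analysis.Analysis"
begin

text \<open>
  Smoothness means \<open>C\<^sup>\<infinity>\<close>. It is meant for open sets \<open>S\<close>, on which the derivative is unique and
  membership depends only on the values of the function on \<open>S\<close>.
\<close>

primrec Ck_on :: "nat \<Rightarrow> 'a::euclidean_space set \<Rightarrow> ('a \<Rightarrow> 'b::real_normed_vector) \<Rightarrow> bool" where
  "Ck_on 0 S f \<longleftrightarrow> continuous_on S f"
| "Ck_on (Suc k) S f \<longleftrightarrow> (\<forall>x\<in>S. f differentiable (at x)) \<and>
     (\<forall>v. Ck_on k S (\<lambda>x. frechet_derivative f (at x) v))"

definition smooth_on :: "'a::euclidean_space set \<Rightarrow> ('a \<Rightarrow> 'b::real_normed_vector) \<Rightarrow> bool" where
  "smooth_on S f \<longleftrightarrow> (\<forall>k. Ck_on k S f)"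

definition partial1 :: "(real \<times> real \<Rightarrow> real) \<Rightarrow> real \<times> real \<Rightarrow> real" where
  "partial1 f p = deriv (\<lambda>t. f (t, snd p)) (fst p)"

definition partial2 :: "(real \<times> real \<Rightarrow> real) \<Rightarrow> real \<times> real \<Rightarrow> real" where
  "partial2 f p = deriv (\<lambda>t. f (fst p, t)) (snd p)"

definition Omega :: "(real \<times> real \<Rightarrow> real) \<Rightarrow> (real \<Rightarrow> real) \<Rightarrow> (real \<Rightarrow> real) \<Rightarrow> real \<Rightarrow> real" where
  "Omega F y u = (\<lambda>x. deriv u x + F (x, y x) * u x)"

definition Omega_iter :: "nat \<Rightarrow> (real \<times> real \<Rightarrow> real) \<Rightarrow> (real \<Rightarrow> real) \<Rightarrow> real \<Rightarrow> real" where
  "Omega_iter n F y = (Omega F y ^^ n) y"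

definition point_transformation ::
    "(real \<times> real) set \<Rightarrow> (real \<times> real \<Rightarrow> real) \<Rightarrow> (real \<times> real \<Rightarrow> real) \<Rightarrow> bool" where
  "point_transformation U \<rho> \<psi> \<longleftrightarrow>
     smooth_on U \<rho> \<and> smooth_on U \<psi> \<and> inj_on (\<lambda>p. (\<rho> p, \<psi> p)) U \<and>
     (\<forall>p\<in>U. partial1 \<rho> p * partial2 \<psi> p - partial2 \<rho> p * partial1 \<psi> p \<noteq> 0)"

text \<open>
  \<open>transformed_curve D \<rho> \<psi> I w y\<close>: the function \<open>w\<close> on the open interval \<open>I\<close> has its graph in \<open>D\<close>,
  and the transformation maps that graph to the graph of \<open>y\<close>. The condition on the derivative makes
  \<open>z \<mapsto> \<rho>(z, w(z))\<close> a diffeomorphism of \<open>I\<close> onto its image, so \<open>y\<close> exists and is determined on that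
  image (an open interval); its values elsewhere are irrelevant.
\<close>

definition transformed_curve ::
    "(real \<times> real) set \<Rightarrow> (real \<times> real \<Rightarrow> real) \<Rightarrow> (real \<times> real \<Rightarrow> real) \<Rightarrow>
     real set \<Rightarrow> (real \<Rightarrow> real) \<Rightarrow> (real \<Rightarrow> real) \<Rightarrow> bool" where
  "transformed_curve D \<rho> \<psi> I w y \<longleftrightarrow>
     open I \<and> is_interval I \<and> smooth_on I w \<and>
     (\<forall>z\<in>I. (z, w z) \<in> D \<and> deriv (\<lambda>t. \<rho> (t, w t)) z \<noteq> 0 \<and> y (\<rho> (z, w z)) = \<psi> (z, w z))"

text \<open>
  Jets are sequences: coordinate \<open>0\<close> is \<open>z\<close> and coordinate \<open>k + 1\<close> is the \<open>k\<close>-th derivative of \<open>w\<close>;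
  an \<open>n\<close>-jet is padded with zeros after coordinate \<open>n + 1\<close>.
\<close>

definition jet :: "nat \<Rightarrow> (real \<Rightarrow> real) \<Rightarrow> real \<Rightarrow> nat \<Rightarrow> real" where
  "jet n w z = (\<lambda>i. case i of 0 \<Rightarrow> z | Suc k \<Rightarrow> if k \<le> n then (deriv ^^ k) w z else 0)"

text \<open>The jets over \<open>D\<close> at which the total derivative \<open>\<rho>\<^sub>z + \<rho>\<^sub>w w\<^sub>z\<close> does not vanish.\<close>

definition jets_over :: "(real \<times> real) set \<Rightarrow> (real \<times> real \<Rightarrow> real) \<Rightarrow> (nat \<Rightarrow> real) set" where
  "jets_over D \<rho> =
     {j. (j 0, j 1) \<in> D \<and> partial1 \<rho> (j 0, j 1) + partial2 \<rho> (j 0, j 1) * j 2 \<noteq> 0}"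

text \<open>
  Smoothness in the first \<open>m\<close> coordinates: all iterated partial derivatives exist and are continuous.
  The sequence space carries no norm, so \<^const>\<open>smooth_on\<close> is not available here; continuity refers
  to the product topology.
\<close>

primrec jet_Ck_on :: "nat \<Rightarrow> nat \<Rightarrow> (nat \<Rightarrow> real) set \<Rightarrow> ((nat \<Rightarrow> real) \<Rightarrow> real) \<Rightarrow> bool" where
  "jet_Ck_on m 0 S f \<longleftrightarrow> continuous_on S f"
| "jet_Ck_on m (Suc k) S f \<longleftrightarrow> continuous_on S f \<and>
     (\<forall>i<m. (\<forall>j\<in>S. (\<lambda>t. f (j(i := t))) differentiable (at (j i))) \<and>
            jet_Ck_on m k S (\<lambda>j. deriv (\<lambda>t. f (j(i := t))) (j i)))"

definition jet_smooth_on :: "nat \<Rightarrow> (nat \<Rightarrow> real) set \<Rightarrow> ((nat \<Rightarrow> real) \<Rightarrow> real) \<Rightarrow> bool" where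
  "jet_smooth_on m S f \<longleftrightarrow> (\<forall>k. jet_Ck_on m k S f)"

text \<open>
  \<open>parameter_function n D \<rho> \<psi> F Q\<close>: on the domain \<open>D\<close> of the \<open>(z, w)\<close>-plane the transformation turns
  the equation with parameter function \<open>F\<close> into the one with parameter function \<open>Q\<close>. The factor
  \<open>\<mu>\<close> is a smooth function of \<open>z, w, w', \<dots>, w\<^sup>(\<^sup>n\<^sup>)\<close>.
\<close>

definition parameter_function ::
    "nat \<Rightarrow> (real \<times> real) set \<Rightarrow> (real \<times> real \<Rightarrow> real) \<Rightarrow> (real \<times> real \<Rightarrow> real) \<Rightarrow>
     (real \<times> real \<Rightarrow> real) \<Rightarrow> (real \<times> real \<Rightarrow> real) \<Rightarrow> bool" where
  "parameter_function n D \<rho> \<psi> F Q \<longleftrightarrow>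
     smooth_on D Q \<and>
     (\<exists>\<mu>. jet_smooth_on (n + 2) (jets_over D \<rho>) \<mu> \<and> (\<forall>j\<in>jets_over D \<rho>. \<mu> j \<noteq> 0) \<and>
        (\<forall>I w y. transformed_curve D \<rho> \<psi> I w y \<longrightarrow>
           (\<forall>z\<in>I. Omega_iter n F y (\<rho> (z, w z)) = \<mu> (jet n w z) * Omega_iter n Q w z)))"

text \<open>
  The transformed equation holds at \<open>p\<close> for at least one curve through \<open>p\<close>. For \<open>n \<ge> 2\<close> this is
  always so. For \<open>n = 1\<close> it fails exactly where \<open>F(\<rho>,\<psi>) \<psi> \<rho>\<^sub>w + \<psi>\<^sub>w = 0\<close>, i.e. where the transformed
  equation is no longer a differential equation for \<open>w\<close> (as for \<open>y' = 0\<close> under \<open>x = w, y = z\<close>).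
\<close>

definition solvable_at ::
    "nat \<Rightarrow> (real \<times> real) set \<Rightarrow> (real \<times> real \<Rightarrow> real) \<Rightarrow> (real \<times> real \<Rightarrow> real) \<Rightarrow>
     (real \<times> real \<Rightarrow> real) \<Rightarrow> real \<times> real \<Rightarrow> bool" where
  "solvable_at n D \<rho> \<psi> F p \<longleftrightarrow>
     (\<exists>I w y. transformed_curve D \<rho> \<psi> I w y \<and> fst p \<in> I \<and> w (fst p) = snd p \<and>
        Omega_iter n F y (\<rho> p) = 0)"

text \<open>
  Everything is local: \<open>F\<close> ranges over the smooth functions on any open set \<open>V\<close>, and a parameter
  function of the transformed equation is required near every point \<open>p\<close> of the \<open>(z, w)\<close>-domain lying
  over \<open>V\<close>. Two kinds of points are exempt as points where the expressions involved need not be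
  defined: those over which the transformed equation has no solution jet at all, and those with
  \<open>w = 0\<close> (\<open>w = 0\<close> solves every equation of the class whose parameter function is regular there,
  so in general the transformed parameter function is singular there).
\<close>

definition equivalence_transformation ::
    "nat \<Rightarrow> (real \<times> real) set \<Rightarrow> (real \<times> real \<Rightarrow> real) \<Rightarrow> (real \<times> real \<Rightarrow> real) \<Rightarrow> bool" where
  "equivalence_transformation n U \<rho> \<psi> \<longleftrightarrow>
     point_transformation U \<rho> \<psi> \<and>
     (\<forall>V F p. open V \<and> smooth_on V F \<and> p \<in> U \<and> (\<rho> p, \<psi> p) \<in> V \<and> snd p \<noteq> 0 \<and>
         solvable_at n U \<rho> \<psi> F p \<longrightarrow>
       (\<exists>D Q. open D \<and> p \<in> D \<and> D \<subseteq> U \<and> (\<lambda>q. (\<rho> q, \<psi> q)) ` D \<subseteq> V \<and>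
          parameter_function n D \<rho> \<psi> F Q))"

definition projective_form ::
    "(real \<times> real) set \<Rightarrow> (real \<times> real \<Rightarrow> real) \<Rightarrow> (real \<times> real \<Rightarrow> real) \<Rightarrow>
     real \<Rightarrow> real \<Rightarrow> real \<Rightarrow> real \<Rightarrow> (real \<Rightarrow> real) \<Rightarrow> bool" where
  "projective_form U \<rho> \<psi> k1 k2 k3 k4 R \<longleftrightarrow>
     (k4 = 0 \<or> k4 = 1) \<and> k2 * k3 - k1 * k4 \<noteq> 0 \<and> smooth_on (fst ` U) R \<and>
     (\<forall>(z, w)\<in>U. k4 * z + k3 \<noteq> 0 \<and> R z \<noteq> 0 \<and>
        \<rho> (z, w) = (k2 * z + k1) / (k4 * z + k3) \<and> \<psi> (z, w) = R z * w)"

end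

theory Submission
  imports Defs
begin

text \<open>
  For \<open>n = 1\<close> the transformed equation is linear in \<open>w'\<close>. Dividing by the coefficient of \<open>w'\<close>
  yields \<open>Q\<^sub>1\<close> (\<open>parameter_function_Q1\<close>), and \<open>Q\<^sub>1\<close> is unique because the slope of a solution through
  a point determines \<open>Q\<^sub>1\<close> there (\<open>Q1_unique\<close>). Where the coefficient of \<open>w'\<close> vanishes, the
  nonvanishing Jacobian rules out solutions.

  For \<open>n \<ge> 2\<close> the stated transformations work because, with \<open>S = d/dz + G\<close>, the powers of
  \<open>l\<^sup>2 S\<close> for an affine function \<open>l\<close> agree with the powers of \<open>S\<close> up to factors on both sides
  (\<open>fop_iter_projective\<close>), while multiplying \<open>w\<close> by a function only shifts the parameter function.

  For the converse it is enough to test parameter functions \<open>F = r'(x)/r(x)\<close>, for which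
  \<open>\<Omega>\<^sub>F\<^sup>n[y] = (r y)\<^sup>(\<^sup>n\<^sup>)/r\<close>. A parameter function \<open>Q\<close> enters through the fact that the original
  and the transformed equation hold for the same curves (\<open>parameter_function_zero_iff\<close>).

  Along curves that become vertical, the transformed equation degenerates to the vanishing of the
  \<open>n\<close>-th derivative of \<open>w\<close>, whatever \<open>Q\<close> is, so in the limit it yields conditions on
  the transformation alone (\<open>steep_limit\<close>). If \<open>\<rho>\<^sub>w \<noteq> 0\<close>, the image of a vertical line would satisfy
  every test equation that has a solution through the given point, and the comparison of two such
  equations would make the Jacobian vanish; so \<open>\<rho> = \<rho>\<^sub>0(z)\<close> (\<open>partial2_\<rho>\<close>). Then a second
  limit shows that \<open>\<psi>\<close> maps curves in a vertical line with vanishing \<open>n\<close>-th derivative to such curves,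
  hence \<open>\<psi> = R w + T\<close> (\<open>partial22_\<psi>\<close>).

  Now the original equation is linear in \<open>w\<close>. The coefficient of \<open>w\<^sup>(\<^sup>n\<^sup>-\<^sup>1\<^sup>)\<close> gives a linear
  differential equation for \<open>Q\<close> in \<open>w\<close>, with the solutions \<open>Q = q(z) + h(z) w\<^sup>-\<^sup>n\<close>, and constant \<open>w\<close>
  force \<open>h = 0\<close> and the absence of an inhomogeneous term (\<open>linear_parameter_function\<close>). Varying \<open>r\<close>
  yields \<open>T = 0\<close> (\<open>T_eq_0\<close>). Finally, for \<open>F = 0\<close>, polynomials of degree less than \<open>n\<close> in
  \<open>x = \<rho>\<^sub>0(z)\<close> become polynomials of degree less than \<open>n\<close> in \<open>z\<close>, up to a common factor \<open>f\<close>.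
  Comparing orders of vanishing, \<open>f (\<rho>\<^sub>0 - \<rho>\<^sub>0(a))\<^sup>n\<^sup>-\<^sup>1\<close> is a constant multiple of \<open>(z - a)\<^sup>n\<^sup>-\<^sup>1\<close> for each
  \<open>a\<close>. Two different \<open>a\<close> show that \<open>\<rho>\<^sub>0\<close> is projective (\<open>projective_of_power_quotients\<close>).
\<close>


section \<open>Smooth functions on open sets\<close>

lemma Ck_on_cong:
  assumes "open S" "\<And>x. x \<in> S \<Longrightarrow> f x = g x"
  shows "Ck_on k S f \<longleftrightarrow> Ck_on k S g"
  using assms(2)
proof (induction k arbitrary: f g)
  case 0
  then show ?case by (auto cong: continuous_on_cong)
next
  case (Suc k)
  have d: "f differentiable (at x) \<longleftrightarrow> g differentiable (at x)" if "x \<in> S" for x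
    using has_derivative_transform_within_open[OF _ assms(1) that] Suc.prems
    unfolding differentiable_def by metis
  have e: "frechet_derivative f (at x) v = frechet_derivative g (at x) v"
    if "x \<in> S" "f differentiable (at x)" for x v
    using frechet_derivative_transform_within_open[OF that(2) assms(1) that(1)] Suc.prems by metis
  show ?case
  proof (cases "\<forall>x\<in>S. f differentiable (at x)")
    case True
    then have "Ck_on k S (\<lambda>x. frechet_derivative f (at x) v) \<longleftrightarrow>
        Ck_on k S (\<lambda>x. frechet_derivative g (at x) v)" for v
      by (intro Suc.IH e) auto
    then show ?thesis using d by simp
  next
    case False
    then show ?thesis using d by auto
  qed
qed

lemma Ck_on_SucI:
  assumes "open S" "\<And>x. x \<in> S \<Longrightarrow> (f has_derivative f' x) (at x)"
    "\<And>v. Ck_on k S (\<lambda>x. f' x v)"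
  shows "Ck_on (Suc k) S f"
proof -
  have "frechet_derivative f (at x) v = f' x v" if "x \<in> S" for x v
    using frechet_derivative_at[OF assms(2)[OF that]] by simp
  then have "Ck_on k S (\<lambda>x. frechet_derivative f (at x) v)" for v
    using Ck_on_cong[OF assms(1), of "\<lambda>x. frechet_derivative f (at x) v" "\<lambda>x. f' x v"] assms(3)
    by simp
  then show ?thesis using assms(2) by (auto simp: differentiable_def)
qed

lemma Ck_on_Suc_has_derivative:
  "Ck_on (Suc k) S f \<Longrightarrow> x \<in> S \<Longrightarrow> (f has_derivative frechet_derivative f (at x)) (at x)"
  by (simp add: frechet_derivative_works[symmetric])

lemma Ck_on_Suc_frechet_derivative:
  "Ck_on (Suc k) S f \<Longrightarrow> Ck_on k S (\<lambda>x. frechet_derivative f (at x) v)"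
  by simp

lemma Ck_on_Suc_imp: "Ck_on (Suc k) S f \<Longrightarrow> Ck_on k S f"
proof (induction k arbitrary: f)
  case 0
  have "f differentiable_on S"
    unfolding differentiable_on_def using 0 by (metis Ck_on.simps(2) differentiable_at_withinI)
  then show ?case by (simp add: differentiable_imp_continuous_on)
next
  case (Suc k)
  have "\<forall>x\<in>S. f differentiable (at x)" using Suc.prems by (metis Ck_on.simps(2))
  moreover have "Ck_on k S (\<lambda>x. frechet_derivative f (at x) v)" for v
    by (rule Suc.IH[OF Ck_on_Suc_frechet_derivative[OF Suc.prems]])
  ultimately show ?case unfolding Ck_on.simps(2) by blast
qed

lemma Ck_on_subset: "Ck_on k S f \<Longrightarrow> T \<subseteq> S \<Longrightarrow> Ck_on k T f"
  by (induction k arbitrary: f) (auto intro: continuous_on_subset)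

lemma Ck_on_const: "open S \<Longrightarrow> Ck_on k S (\<lambda>x. c)"
proof (induction k arbitrary: c)
  case (Suc k)
  then show ?case by (auto intro: Ck_on_SucI[where f' = "\<lambda>x v. 0"] simp del: Ck_on.simps)
qed simp

lemma Ck_on_bounded_linear:
  assumes "bounded_linear L" "open S"
  shows "Ck_on k S f \<Longrightarrow> Ck_on k S (\<lambda>x. L (f x))"
proof (induction k arbitrary: f)
  case 0
  then show ?case using bounded_linear.continuous_on[OF assms(1)] by simp
next
  case (Suc k)
  show ?case
  proof (rule Ck_on_SucI[where f' = "\<lambda>x v. L (frechet_derivative f (at x) v)"])
    show "((\<lambda>x. L (f x)) has_derivative (\<lambda>v. L (frechet_derivative f (at x) v))) (at x)"
      if "x \<in> S" for x
      by (rule bounded_linear.has_derivative[OF assms(1) Ck_on_Suc_has_derivative[OF Suc.prems that]])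
  qed (use assms Suc.IH[OF Ck_on_Suc_frechet_derivative[OF Suc.prems]] in blast)+
qed

lemma Ck_on_ident: "open S \<Longrightarrow> Ck_on k S (\<lambda>x. x)"
proof (cases k)
  case (Suc k')
  moreover assume "open S"
  ultimately show ?thesis
    by (auto intro!: Ck_on_SucI[where f' = "\<lambda>x v. v"] Ck_on_const simp del: Ck_on.simps)
qed auto

lemma Ck_on_add:
  assumes "open S"
  shows "Ck_on k S f \<Longrightarrow> Ck_on k S g \<Longrightarrow> Ck_on k S (\<lambda>x. f x + g x)"
proof (induction k arbitrary: f g)
  case 0
  then show ?case by (simp add: continuous_on_add)
next
  case (Suc k)
  show ?case
  proof (rule Ck_on_SucI[where f' = "\<lambda>x v. frechet_derivative f (at x) v + frechet_derivative g (at x) v"])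
    show "Ck_on k S (\<lambda>x. frechet_derivative f (at x) v + frechet_derivative g (at x) v)" for v
      by (rule Suc.IH[OF Suc.prems[THEN Ck_on_Suc_frechet_derivative]])
    show "((\<lambda>x. f x + g x) has_derivative
        (\<lambda>v. frechet_derivative f (at x) v + frechet_derivative g (at x) v)) (at x)" if "x \<in> S" for x
      by (rule has_derivative_add[OF Ck_on_Suc_has_derivative[OF Suc.prems(1) that]
            Ck_on_Suc_has_derivative[OF Suc.prems(2) that]])
  qed (rule assms(1))
qed

lemma Ck_on_mult:
  fixes f g :: "'a::euclidean_space \<Rightarrow> real"
  assumes "open S"
  shows "Ck_on k S f \<Longrightarrow> Ck_on k S g \<Longrightarrow> Ck_on k S (\<lambda>x. f x * g x)"
proof (induction k arbitrary: f g)
  case 0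
  then show ?case by (simp add: continuous_on_mult)
next
  case (Suc k)
  show ?case
  proof (rule Ck_on_SucI[where f' = "\<lambda>x v. f x * frechet_derivative g (at x) v + frechet_derivative f (at x) v * g x"])
    show "((\<lambda>x. f x * g x) has_derivative
        (\<lambda>v. f x * frechet_derivative g (at x) v + frechet_derivative f (at x) v * g x)) (at x)"
      if "x \<in> S" for x
      by (rule has_derivative_mult[OF Ck_on_Suc_has_derivative[OF Suc.prems(1) that]
            Ck_on_Suc_has_derivative[OF Suc.prems(2) that]])
    show "Ck_on k S (\<lambda>x. f x * frechet_derivative g (at x) v + frechet_derivative f (at x) v * g x)" for v
      by (intro Ck_on_add[OF assms] Suc.IH Suc.prems[THEN Ck_on_Suc_imp]
          Suc.prems[THEN Ck_on_Suc_frechet_derivative])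
  qed (rule assms(1))
qed

lemma Ck_on_Pair:
  assumes "open S"
  shows "Ck_on k S f \<Longrightarrow> Ck_on k S g \<Longrightarrow> Ck_on k S (\<lambda>x. (f x, g x))"
proof (induction k arbitrary: f g)
  case 0
  then show ?case by (simp add: continuous_on_Pair)
next
  case (Suc k)
  show ?case
  proof (rule Ck_on_SucI[where f' = "\<lambda>x v. (frechet_derivative f (at x) v, frechet_derivative g (at x) v)"])
    show "Ck_on k S (\<lambda>x. (frechet_derivative f (at x) v, frechet_derivative g (at x) v))" for v
      by (rule Suc.IH[OF Suc.prems[THEN Ck_on_Suc_frechet_derivative]])
    show "((\<lambda>x. (f x, g x)) has_derivative
        (\<lambda>v. (frechet_derivative f (at x) v, frechet_derivative g (at x) v))) (at x)" if "x \<in> S" for x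
      by (rule has_derivative_Pair[OF Ck_on_Suc_has_derivative[OF Suc.prems(1) that]
            Ck_on_Suc_has_derivative[OF Suc.prems(2) that]])
  qed (rule assms(1))
qed

lemma Ck_on_inverse:
  fixes f :: "'a::euclidean_space \<Rightarrow> real"
  assumes "open S" "\<And>x. x \<in> S \<Longrightarrow> f x \<noteq> 0"
  shows "Ck_on k S f \<Longrightarrow> Ck_on k S (\<lambda>x. inverse (f x))"
proof (induction k)
  case 0
  then show ?case using assms(2) by (auto intro: continuous_on_inverse)
next
  case (Suc k)
  show ?case
  proof (rule Ck_on_SucI[where f' = "\<lambda>x v. (-1) * (inverse (f x) * frechet_derivative f (at x) v * inverse (f x))"])
    show "((\<lambda>x. inverse (f x)) has_derivative
        (\<lambda>v. (-1) * (inverse (f x) * frechet_derivative f (at x) v * inverse (f x)))) (at x)"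
      if "x \<in> S" for x
      using Deriv.has_derivative_inverse[OF assms(2)[OF that] Ck_on_Suc_has_derivative[OF Suc.prems that]] by simp
    have "Ck_on k S (\<lambda>x. inverse (f x))" by (rule Suc.IH[OF Ck_on_Suc_imp[OF Suc.prems]])
    then show "Ck_on k S (\<lambda>x. (-1) * (inverse (f x) * frechet_derivative f (at x) v * inverse (f x)))" for v
      by (intro Ck_on_mult Ck_on_const assms(1) Ck_on_Suc_frechet_derivative[OF Suc.prems])
  qed (rule assms(1))
qed

lemma Ck_on_sum:
  fixes f :: "'i \<Rightarrow> 'a::euclidean_space \<Rightarrow> 'b::real_normed_vector"
  assumes "open S" "\<And>i. i \<in> I \<Longrightarrow> Ck_on k S (f i)"
  shows "Ck_on k S (\<lambda>x. \<Sum>i\<in>I. f i x)"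
  using assms(2)
  by (induction I rule: infinite_finite_induct) (auto intro!: Ck_on_add Ck_on_const assms(1))

text \<open>
  The chain rule expresses the derivative of \<open>f \<circ> g\<close> through products of components of the derivative
  of \<open>g\<close> with functions of the same shape \<open>f\<^sub>b \<circ> g\<close>, which is what the induction needs.
\<close>

lemma Ck_on_compose:
  fixes f :: "'b::euclidean_space \<Rightarrow> real" and g :: "'a::euclidean_space \<Rightarrow> 'b"
  assumes "open S" "open T" "g ` S \<subseteq> T"
  shows "Ck_on k T f \<Longrightarrow> Ck_on k S g \<Longrightarrow> Ck_on k S (\<lambda>x. f (g x))"
proof (induction k arbitrary: f)
  case 0
  then show ?case using assms(3) continuous_on_compose2[of T f S g] by simp
next
  case (Suc k)
  let ?D = "\<lambda>x v. \<Sum>b\<in>Basis. (frechet_derivative g (at x) v \<bullet> b) * frechet_derivative f (at (g x)) b"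
  show ?case
  proof (rule Ck_on_SucI[where f' = ?D])
    fix x assume x: "x \<in> S"
    then have gx: "g x \<in> T" using assms(3) by auto
    have df: "(f has_derivative frechet_derivative f (at (g x))) (at (g x))"
      by (rule Ck_on_Suc_has_derivative[OF Suc.prems(1) gx])
    interpret f': linear "frechet_derivative f (at (g x))" using has_derivative_linear[OF df] .
    have D: "frechet_derivative f (at (g x)) u = (\<Sum>b\<in>Basis. (u \<bullet> b) * frechet_derivative f (at (g x)) b)" for u
    proof -
      have "frechet_derivative f (at (g x)) u
          = frechet_derivative f (at (g x)) (\<Sum>b\<in>Basis. (u \<bullet> b) *\<^sub>R b)"
        by (simp only: euclidean_representation)
      then show ?thesis by (simp only: f'.sum f'.scale real_scaleR_def)
    qed
    have "?D x = (\<lambda>v. frechet_derivative f (at (g x)) (frechet_derivative g (at x) v))"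
      by (rule ext) (rule D[symmetric])
    then show "((\<lambda>x. f (g x)) has_derivative ?D x) (at x)"
      using has_derivative_compose[OF Ck_on_Suc_has_derivative[OF Suc.prems(2) x] df] by (simp only:)
  next
    fix v
    have "Ck_on k S (\<lambda>x. frechet_derivative g (at x) v \<bullet> b)" for b
      by (rule Ck_on_bounded_linear[OF bounded_linear_inner_left assms(1)
            Ck_on_Suc_frechet_derivative[OF Suc.prems(2)]])
    moreover have "Ck_on k S (\<lambda>x. frechet_derivative f (at (g x)) b)" for b
      by (rule Suc.IH[OF Ck_on_Suc_frechet_derivative[OF Suc.prems(1)] Ck_on_Suc_imp[OF Suc.prems(2)]])
    ultimately show "Ck_on k S (\<lambda>x. ?D x v)"
      by (rule Ck_on_sum[OF assms(1) Ck_on_mult[OF assms(1)]])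
  qed (rule assms(1))
qed

lemma smooth_on_cong:
  "open S \<Longrightarrow> (\<And>x. x \<in> S \<Longrightarrow> f x = g x) \<Longrightarrow> smooth_on S f \<longleftrightarrow> smooth_on S g"
  unfolding smooth_on_def using Ck_on_cong by blast

lemma smooth_on_subset: "smooth_on S f \<Longrightarrow> T \<subseteq> S \<Longrightarrow> smooth_on T f"
  unfolding smooth_on_def using Ck_on_subset by blast

lemma smooth_on_has_derivative:
  "smooth_on S f \<Longrightarrow> x \<in> S \<Longrightarrow> (f has_derivative frechet_derivative f (at x)) (at x)"
  by (rule Ck_on_Suc_has_derivative[where k = 0]) (simp_all add: smooth_on_def del: Ck_on.simps)

lemma smooth_on_frechet_derivative: "smooth_on S f \<Longrightarrow> smooth_on S (\<lambda>x. frechet_derivative f (at x) v)"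
  unfolding smooth_on_def
proof
  fix k assume "\<forall>k. Ck_on k S f"
  then have "Ck_on (Suc k) S f" by blast
  then show "Ck_on k S (\<lambda>x. frechet_derivative f (at x) v)" by simp
qed

lemma smooth_on_continuous: "smooth_on S f \<Longrightarrow> continuous_on S f"
  unfolding smooth_on_def by (drule spec[where x = 0]) simp

lemma smooth_on_locally:
  assumes "open S" "\<And>x. x \<in> S \<Longrightarrow> \<exists>T. open T \<and> x \<in> T \<and> smooth_on T f"
  shows "smooth_on S f"
proof -
  have "Ck_on k S f" if "\<And>x. x \<in> S \<Longrightarrow> \<exists>T. open T \<and> x \<in> T \<and> Ck_on k T f" for k
    using that
  proof (induction k arbitrary: f)
    case 0
    have "isCont f x" if "x \<in> S" for x
      using 0[OF that] by (auto simp: continuous_on_eq_continuous_at)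
    then show ?case by (simp add: continuous_at_imp_continuous_on)
  next
    case (Suc k)
    have "f differentiable (at x)" if "x \<in> S" for x
      using Suc.prems[OF that] by auto
    moreover have "Ck_on k S (\<lambda>x. frechet_derivative f (at x) v)" for v
    proof (rule Suc.IH)
      fix x assume "x \<in> S"
      from Suc.prems[OF this] show "\<exists>T. open T \<and> x \<in> T \<and> Ck_on k T (\<lambda>x. frechet_derivative f (at x) v)"
        by auto
    qed
    ultimately show ?case by simp
  qed
  then show ?thesis using assms(2) unfolding smooth_on_def by metis
qed

lemma smooth_on_const: "open S \<Longrightarrow> smooth_on S (\<lambda>x. c)"
  and smooth_on_ident: "open S \<Longrightarrow> smooth_on S (\<lambda>x. x)"
  and smooth_on_add: "open S \<Longrightarrow> smooth_on S f \<Longrightarrow> smooth_on S g \<Longrightarrow> smooth_on S (\<lambda>x. f x + g x)"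
  and smooth_on_Pair: "open S \<Longrightarrow> smooth_on S f \<Longrightarrow> smooth_on S h \<Longrightarrow> smooth_on S (\<lambda>x. (f x, h x))"
  for f g :: "'a::euclidean_space \<Rightarrow> 'b::real_normed_vector" and h :: "'a \<Rightarrow> 'c::real_normed_vector"
  unfolding smooth_on_def
  by (auto intro: Ck_on_const Ck_on_ident Ck_on_add Ck_on_Pair)

lemma smooth_on_bounded_linear:
  "bounded_linear L \<Longrightarrow> open S \<Longrightarrow> smooth_on S f \<Longrightarrow> smooth_on S (\<lambda>x. L (f x))"
  unfolding smooth_on_def by (auto intro: Ck_on_bounded_linear)

lemma smooth_on_fst: "open S \<Longrightarrow> smooth_on S f \<Longrightarrow> smooth_on S (\<lambda>x. fst (f x))"
  and smooth_on_snd: "open S \<Longrightarrow> smooth_on S f \<Longrightarrow> smooth_on S (\<lambda>x. snd (f x))"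
  by (auto intro: smooth_on_bounded_linear bounded_linear_fst bounded_linear_snd)

context
  fixes S :: "'a::euclidean_space set" and f g :: "'a \<Rightarrow> real"
  assumes S: "open S" and f: "smooth_on S f" and g: "smooth_on S g"
begin

lemma smooth_on_mult: "smooth_on S (\<lambda>x. f x * g x)"
  using S f g unfolding smooth_on_def by (auto intro: Ck_on_mult)

lemma smooth_on_inverse: "(\<And>x. x \<in> S \<Longrightarrow> f x \<noteq> 0) \<Longrightarrow> smooth_on S (\<lambda>x. inverse (f x))"
  using S f unfolding smooth_on_def by (auto intro: Ck_on_inverse)

lemma smooth_on_minus: "smooth_on S (\<lambda>x. - f x)"
  by (rule smooth_on_bounded_linear[OF bounded_linear_minus[OF bounded_linear_ident] S f])

end

lemma smooth_on_diff:
  fixes f g :: "'a::euclidean_space \<Rightarrow> real"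
  shows "open S \<Longrightarrow> smooth_on S f \<Longrightarrow> smooth_on S g \<Longrightarrow> smooth_on S (\<lambda>x. f x - g x)"
  using smooth_on_add[of S f "\<lambda>x. - g x"] smooth_on_minus[of S g] by (simp only: diff_conv_add_uminus)

lemma smooth_on_divide:
  fixes f g :: "'a::euclidean_space \<Rightarrow> real"
  shows "open S \<Longrightarrow> smooth_on S f \<Longrightarrow> smooth_on S g \<Longrightarrow> (\<And>x. x \<in> S \<Longrightarrow> g x \<noteq> 0)
    \<Longrightarrow> smooth_on S (\<lambda>x. f x / g x)"
  using smooth_on_mult[of S f "\<lambda>x. inverse (g x)"] smooth_on_inverse[of S g]
  by (simp add: divide_inverse)

lemma smooth_on_power:
  fixes f :: "'a::euclidean_space \<Rightarrow> real"
  shows "open S \<Longrightarrow> smooth_on S f \<Longrightarrow> smooth_on S (\<lambda>x. f x ^ n)"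
  by (induction n) (auto intro: smooth_on_const smooth_on_mult)

lemma smooth_on_compose:
  fixes f :: "'b::euclidean_space \<Rightarrow> real" and g :: "'a::euclidean_space \<Rightarrow> 'b"
  assumes "smooth_on T f" "open S" "open T" "smooth_on S g" "\<And>x. x \<in> S \<Longrightarrow> g x \<in> T"
  shows "smooth_on S (\<lambda>x. f (g x))"
  using assms Ck_on_compose[OF assms(2,3), of g] unfolding smooth_on_def by blast

lemmas smooth_on_intros = smooth_on_const smooth_on_ident smooth_on_add smooth_on_diff
  smooth_on_minus smooth_on_mult smooth_on_divide smooth_on_power smooth_on_Pair
  smooth_on_fst smooth_on_snd

subsection \<open>One real variable\<close>

lemma smooth_on_deriv_has_derivative:
  fixes f :: "real \<Rightarrow> real"
  assumes "smooth_on S f" "x \<in> S"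
  shows "(f has_real_derivative deriv f x) (at x)"
proof -
  have "f differentiable (at x)" using smooth_on_has_derivative[OF assms] by (rule differentiableI)
  then show ?thesis
    by (simp add: real_differentiable_def DERIV_deriv_iff_real_differentiable)
qed

lemma smooth_on_deriv:
  fixes f :: "real \<Rightarrow> real"
  assumes "open S" "smooth_on S f"
  shows "smooth_on S (deriv f)"
proof -
  have "frechet_derivative f (at x) 1 = deriv f x" if "x \<in> S" for x
    using frechet_derivative_at[OF smooth_on_deriv_has_derivative[OF assms(2) that, unfolded has_field_derivative_def]]
    by (metis mult.right_neutral)
  then show ?thesis
    using smooth_on_frechet_derivative[OF assms(2), of 1] 
      smooth_on_cong[OF assms(1), of "\<lambda>x. frechet_derivative f (at x) 1" "deriv f"] by simp
qed

lemma smooth_on_deriv_iter: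
  fixes f :: "real \<Rightarrow> real"
  shows "open S \<Longrightarrow> smooth_on S f \<Longrightarrow> smooth_on S ((deriv ^^ n) f)"
  by (induction n) (auto intro: smooth_on_deriv)

lemma deriv_cong_on_open:
  fixes f g :: "real \<Rightarrow> real"
  assumes "open S" "x \<in> S" "\<And>t. t \<in> S \<Longrightarrow> f t = g t"
  shows "deriv f x = deriv g x"
  by (rule deriv_cong_ev) (use assms eventually_nhds in blast, simp)

subsection \<open>Partial derivatives\<close>

context
  fixes U :: "(real \<times> real) set" and f :: "real \<times> real \<Rightarrow> real"
  assumes U: "open U" and f: "smooth_on U f"
begin

lemma has_real_derivative_along:
  assumes "(a, b) \<in> U" "(A has_real_derivative a') (at t)" "(B has_real_derivative b') (at t)"
    "A t = a" "B t = b"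
  shows "((\<lambda>t. f (A t, B t)) has_real_derivative
      a' * frechet_derivative f (at (a, b)) (1, 0) + b' * frechet_derivative f (at (a, b)) (0, 1)) (at t)"
proof -
  let ?F = "frechet_derivative f (at (a, b))"
  have dF: "(f has_derivative ?F) (at (A t, B t))" using smooth_on_has_derivative[OF f assms(1)] assms by simp
  interpret linear ?F using has_derivative_linear[OF dF] .
  have "((\<lambda>t. (A t, B t)) has_derivative (\<lambda>h. (a' * h, b' * h))) (at t)"
    using assms(2,3) by (intro has_derivative_Pair) (auto simp: has_field_derivative_def)
  from has_derivative_compose[OF this dF]
  have "((\<lambda>t. f (A t, B t)) has_derivative (\<lambda>h. ?F (a' * h, b' * h))) (at t)" .
  moreover have "?F (a' * h, b' * h) = (a' * ?F (1, 0) + b' * ?F (0, 1)) * h" for h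
  proof -
    have "(a' * h, b' * h) = (a' * h) *\<^sub>R (1, 0) + (b' * h) *\<^sub>R (0::real, 1::real)" by simp
    then show ?thesis by (simp add: add scale algebra_simps del: scaleR_Pair)
  qed
  ultimately show ?thesis by (simp add: has_field_derivative_def)
qed

lemma partial1_eq_frechet: "p \<in> U \<Longrightarrow> partial1 f p = frechet_derivative f (at p) (1, 0)"
  using has_real_derivative_along[of "fst p" "snd p" "\<lambda>t. t" 1 "fst p" "\<lambda>t. snd p" 0]
  unfolding partial1_def by (auto intro: DERIV_imp_deriv)

lemma partial2_eq_frechet: "p \<in> U \<Longrightarrow> partial2 f p = frechet_derivative f (at p) (0, 1)"
  using has_real_derivative_along[of "fst p" "snd p" "\<lambda>t. fst p" 0 "snd p" "\<lambda>t. t" 1]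
  unfolding partial2_def by (auto intro: DERIV_imp_deriv)

lemma has_real_derivative_along_partial:
  assumes "(A has_real_derivative a') (at t)" "(B has_real_derivative b') (at t)" "(A t, B t) \<in> U"
  shows "((\<lambda>t. f (A t, B t)) has_real_derivative
      a' * partial1 f (A t, B t) + b' * partial2 f (A t, B t)) (at t)"
  using has_real_derivative_along[OF assms(3,1,2)] partial1_eq_frechet[OF assms(3)]
    partial2_eq_frechet[OF assms(3)] by simp

lemma smooth_on_partial1: "smooth_on U (partial1 f)"
  using smooth_on_frechet_derivative[OF f, of "(1,0)"] 
    smooth_on_cong[OF U, of "partial1 f" "\<lambda>p. frechet_derivative f (at p) (1, 0)"]
    by (simp add: partial1_eq_frechet)

lemma smooth_on_partial2: "smooth_on U (partial2 f)"
  using smooth_on_frechet_derivative[OF f, of "(0,1)"] 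
    smooth_on_cong[OF U, of "partial2 f" "\<lambda>p. frechet_derivative f (at p) (0, 1)"]
    by (simp add: partial2_eq_frechet)

end

section \<open>First-order operators and their iterates\<close>

text \<open>
  The operator \<open>A d/dt + B\<close>. Both \<open>\<Omega>\<close> and its expression in terms of another parameter of the curve
  have this form, so that every computation below takes place in one variable.
\<close>

definition fop :: "(real \<Rightarrow> real) \<Rightarrow> (real \<Rightarrow> real) \<Rightarrow> (real \<Rightarrow> real) \<Rightarrow> real \<Rightarrow> real" where
  "fop A B u = (\<lambda>t. A t * deriv u t + B t * u t)"

lemma fop_iter_Suc:
  "(fop A B ^^ Suc k) u t = A t * deriv ((fop A B ^^ k) u) t + B t * (fop A B ^^ k) u t"
  by (simp add: fop_def)

lemma Omega_eq_fop: "Omega F y = fop (\<lambda>x. 1) (\<lambda>x. F (x, y x))"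
  unfolding Omega_def fop_def by auto

lemma Omega_iter_eq_fop: "Omega_iter n F y = (fop (\<lambda>x. 1) (\<lambda>x. F (x, y x)) ^^ n) y"
  unfolding Omega_iter_def Omega_eq_fop ..

lemma deriv_iter_eq_fop: "(deriv ^^ n) u = (fop (\<lambda>x. 1) (\<lambda>x. 0) ^^ n) u"
proof -
  have "fop (\<lambda>x. 1) (\<lambda>x. 0) = deriv" by (auto simp: fop_def)
  then show ?thesis by simp
qed

lemma fop_iter_cong:
  assumes "open S" "\<And>t. t \<in> S \<Longrightarrow> A t = A' t" "\<And>t. t \<in> S \<Longrightarrow> B t = B' t" "\<And>t. t \<in> S \<Longrightarrow> u t = u' t" "t \<in> S"
  shows "(fop A B ^^ k) u t = (fop A' B' ^^ k) u' t"
  using assms(5)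
proof (induction k arbitrary: t)
  case (Suc k)
  then have "deriv ((fop A B ^^ k) u) t = deriv ((fop A' B' ^^ k) u') t"
    by (intro deriv_cong_on_open[OF assms(1)])
  then show ?case using Suc assms(2,3) by (simp add: fop_iter_Suc del: funpow.simps)
qed (use assms(4) in simp)

context
  fixes S :: "real set" and A B :: "real \<Rightarrow> real"
  assumes S: "open S" and A: "smooth_on S A" and B: "smooth_on S B"
begin

lemma smooth_on_fop: "smooth_on S u \<Longrightarrow> smooth_on S (fop A B u)"
  unfolding fop_def by (intro smooth_on_add smooth_on_mult smooth_on_deriv S A B)

lemma smooth_on_fop_iter: "smooth_on S u \<Longrightarrow> smooth_on S ((fop A B ^^ k) u)"
  by (induction k) (auto intro: smooth_on_fop)

lemma fop_iter_has_derivative: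
  "smooth_on S u \<Longrightarrow> t \<in> S \<Longrightarrow> ((fop A B ^^ k) u has_real_derivative deriv ((fop A B ^^ k) u) t) (at t)"
  by (rule smooth_on_deriv_has_derivative[OF smooth_on_fop_iter])

lemma fop_iter_linear:
  assumes u: "smooth_on S u" and v: "smooth_on S v" and t: "t \<in> S"
  shows "(fop A B ^^ k) (\<lambda>t. a * u t + b * v t) t = a * (fop A B ^^ k) u t + b * (fop A B ^^ k) v t"
  using t
proof (induction k arbitrary: t)
  case (Suc k)
  let ?u = "(fop A B ^^ k) u" and ?v = "(fop A B ^^ k) v"
  have "deriv ((fop A B ^^ k) (\<lambda>t. a * u t + b * v t)) t = deriv (\<lambda>t. a * ?u t + b * ?v t) t"
    using Suc by (intro deriv_cong_on_open[OF S]) auto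
  also have "\<dots> = a * deriv ?u t + b * deriv ?v t"
    by (rule DERIV_imp_deriv) (auto intro!: derivative_eq_intros fop_iter_has_derivative[OF u Suc.prems]
        fop_iter_has_derivative[OF v Suc.prems])
  finally show ?case using Suc by (simp add: fop_iter_Suc algebra_simps del: funpow.simps)
qed simp

end

text \<open>Conjugation by a nonvanishing function \<open>h\<close> only shifts the zeroth-order coefficient.\<close>

lemma fop_iter_gauge:
  assumes S: "open S" and A: "smooth_on S A" and B: "smooth_on S B"
    and h: "smooth_on S h" "\<And>t. t \<in> S \<Longrightarrow> h t \<noteq> 0" and u: "smooth_on S u" and t: "t \<in> S"
  shows "(fop A B ^^ k) (\<lambda>t. h t * u t) t
    = h t * (fop A (\<lambda>t. B t + A t * deriv h t / h t) ^^ k) u t"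
  using t
proof (induction k arbitrary: t)
  case (Suc k)
  let ?B = "\<lambda>t. B t + A t * deriv h t / h t"
  let ?v = "(fop A ?B ^^ k) u"
  have B': "smooth_on S ?B"
    by (intro smooth_on_add smooth_on_divide smooth_on_mult smooth_on_deriv S A B h) auto
  have "deriv ((fop A B ^^ k) (\<lambda>t. h t * u t)) t = deriv (\<lambda>t. h t * ?v t) t"
    using Suc by (intro deriv_cong_on_open[OF S]) auto
  also have "\<dots> = deriv h t * ?v t + h t * deriv ?v t"
    by (rule DERIV_imp_deriv)
      (auto intro!: derivative_eq_intros smooth_on_deriv_has_derivative[OF h(1) Suc.prems]
        fop_iter_has_derivative[OF S A B' u Suc.prems])
  finally show ?case using Suc h(2)[OF Suc.prems] by (simp add: fop_iter_Suc field_simps del: funpow.simps)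
qed simp

lemma fop_iter_scale:
  assumes S: "open S" and A: "smooth_on S A" and B: "smooth_on S B" and u: "smooth_on S u" and t: "t \<in> S"
  shows "(fop (\<lambda>t. c * A t) (\<lambda>t. c * B t) ^^ k) u t = c ^ k * (fop A B ^^ k) u t"
  using t
proof (induction k arbitrary: t)
  case (Suc k)
  have "deriv ((fop (\<lambda>t. c * A t) (\<lambda>t. c * B t) ^^ k) u) t = deriv (\<lambda>t. c ^ k * (fop A B ^^ k) u t) t"
    using Suc by (intro deriv_cong_on_open[OF S]) auto
  also have "\<dots> = c ^ k * deriv ((fop A B ^^ k) u) t"
    by (rule DERIV_imp_deriv)
      (auto intro!: derivative_eq_intros fop_iter_has_derivative[OF S A B u Suc.prems])
  finally show ?case using Suc by (simp add: fop_iter_Suc algebra_simps del: funpow.simps)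
qed simp

lemma fop_iter_rescale:
  assumes S: "open S" and A: "smooth_on S A" and B: "smooth_on S B" and u: "smooth_on S u"
    and e: "e \<noteq> 0" and t: "(t - t0) / e \<in> S"
  shows "(fop (\<lambda>t. e * A ((t - t0) / e)) (\<lambda>t. B ((t - t0) / e)) ^^ k) (\<lambda>t. u ((t - t0) / e)) t
    = (fop A B ^^ k) u ((t - t0) / e)"
  using t
proof (induction k arbitrary: t)
  case (Suc k)
  let ?v = "(fop A B ^^ k) u"
  have "open ((\<lambda>t. (t - t0) / e) -` S)"
    by (intro open_vimage S continuous_intros) (use e in auto)
  then have "deriv ((fop (\<lambda>t. e * A ((t - t0) / e)) (\<lambda>t. B ((t - t0) / e)) ^^ k) (\<lambda>t. u ((t - t0) / e))) t
      = deriv (\<lambda>t. ?v ((t - t0) / e)) t"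
    using Suc by (intro deriv_cong_on_open) auto
  also have "\<dots> = deriv ?v ((t - t0) / e) / e"
  proof (rule DERIV_imp_deriv)
    have "((\<lambda>t. (t - t0) / e) has_real_derivative 1 / e) (at t)"
      using e by (auto intro!: derivative_eq_intros)
    from DERIV_chain2[of ?v _ "\<lambda>t. (t - t0) / e", OF fop_iter_has_derivative[OF S A B u Suc.prems] this]
    show "((\<lambda>t. ?v ((t - t0) / e)) has_real_derivative deriv ?v ((t - t0) / e) / e) (at t)" by simp
  qed
  finally show ?case using Suc e by (simp add: fop_iter_Suc del: funpow.simps)
qed simp

text \<open>
  If \<open>A \<xi>' = c\<close> is constant then \<open>\<xi>\<close> is, up to scale, a coordinate for the derivation \<open>A d/dt\<close>, and
  commuting \<open>\<xi>\<close> past the \<open>k\<close>-th power of the operator costs \<open>k c\<close> times its \<open>(k - 1)\<close>-st power.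
\<close>

lemma fop_iter_coordinate_mult:
  assumes S: "open S" and A: "smooth_on S A" and B: "smooth_on S B" and u: "smooth_on S u"
    and x: "smooth_on S x" "\<And>t. t \<in> S \<Longrightarrow> A t * deriv x t = c" and t: "t \<in> S"
  shows "(fop A B ^^ k) (\<lambda>t. x t * u t) t
    = x t * (fop A B ^^ k) u t + of_nat k * c * (fop A B ^^ (k - 1)) u t"
  using t
proof (induction k arbitrary: t)
  case (Suc k)
  let ?v = "(fop A B ^^ k) u" and ?w = "(fop A B ^^ (k - 1)) u"
  have "deriv ((fop A B ^^ k) (\<lambda>t. x t * u t)) t = deriv (\<lambda>t. x t * ?v t + of_nat k * c * ?w t) t"
    using Suc by (intro deriv_cong_on_open[OF S]) auto
  also have "\<dots> = deriv x t * ?v t + x t * deriv ?v t + of_nat k * c * deriv ?w t"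
    by (rule DERIV_imp_deriv)
      (auto intro!: derivative_eq_intros smooth_on_deriv_has_derivative[OF x(1) Suc.prems]
        fop_iter_has_derivative[OF S A B u Suc.prems])
  finally have d: "deriv ((fop A B ^^ k) (\<lambda>t. x t * u t)) t
      = deriv x t * ?v t + x t * deriv ?v t + of_nat k * c * deriv ?w t" .
  have "(fop A B ^^ Suc k) (\<lambda>t. x t * u t) t
      = A t * (deriv x t * ?v t + x t * deriv ?v t + of_nat k * c * deriv ?w t)
        + B t * (x t * ?v t + of_nat k * c * ?w t)"
    using d Suc by (simp add: fop_iter_Suc del: funpow.simps)
  also have "\<dots> = (A t * deriv x t) * ?v t + x t * fop A B ?v t + c * (of_nat k * fop A B ?w t)"
    by (simp add: fop_def algebra_simps)
  also have "of_nat k * fop A B ?w t = of_nat k * ?v t" by (cases k) auto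
  finally show ?case using x(2)[OF Suc.prems] by (simp add: algebra_simps)
qed simp

text \<open>
  At a zero of the coordinate \<open>\<xi>\<close>, each factor \<open>\<xi>\<close> has to absorb one application of the operator.
\<close>

lemma fop_iter_coordinate_power:
  assumes S: "open S" and A: "smooth_on S A" and B: "smooth_on S B" and u: "smooth_on S u"
    and x: "smooth_on S x" "\<And>t. t \<in> S \<Longrightarrow> A t * deriv x t = 1" and t: "t \<in> S" "x t = 0"
  shows "(fop A B ^^ k) (\<lambda>t. x t ^ m * u t) t
    = (if m \<le> k then fact k / fact (k - m) * (fop A B ^^ (k - m)) u t else 0)"
proof (induction m arbitrary: k)
  case (Suc m)
  have "smooth_on S (\<lambda>t. x t ^ m * u t)" by (intro smooth_on_mult smooth_on_power S u x)
  then have "(fop A B ^^ k) (\<lambda>t. x t * (x t ^ m * u t)) t = of_nat k * (fop A B ^^ (k - 1)) (\<lambda>t. x t ^ m * u t) t"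
    using fop_iter_coordinate_mult[OF S A B _ x t(1)] t(2) by simp
  then show ?case unfolding Suc.IH by (cases k) (auto simp: mult.assoc)
qed simp

section \<open>Equations along transformed curves\<close>

lemma inj_on_deriv_nonzero:
  fixes X :: "real \<Rightarrow> real"
  assumes "is_interval I" "\<And>t. t \<in> I \<Longrightarrow> (X has_real_derivative X' t) (at t)" "\<And>t. t \<in> I \<Longrightarrow> X' t \<noteq> 0"
  shows "inj_on X I"
proof -
  have False if "a \<in> I" "b \<in> I" "a < b" "X a = X b" for a b
  proof -
    have I: "{a..b} \<subseteq> I" using mem_is_interval_1_I[OF assms(1) that(1,2)] by auto
    have "continuous_on {a..b} X"
      using I assms(2) by (meson DERIV_isCont continuous_at_imp_continuous_on subsetD)
    moreover have "X differentiable (at t)" if "a < t" "t < b" for t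
    proof -
      have "t \<in> I" using I that by auto
      then show ?thesis using assms(2) real_differentiable_def by blast
    qed
    ultimately obtain z where z: "a < z" "z < b" "(X has_real_derivative 0) (at z)"
      using Rolle[OF \<open>a < b\<close> \<open>X a = X b\<close>] by blast
    then have "z \<in> I" using I by auto
    then show False using assms(2,3) z(3) DERIV_unique by blast
  qed
  then show ?thesis unfolding inj_on_def by (metis linorder_neqE_linordered_idom)
qed

text \<open>
  In terms of a parameter \<open>s\<close> of the curve \<open>(X, Y)\<close> that is the graph of \<open>y\<close>, the derivation
  \<open>d/dx\<close> is \<open>(1 / X') d/ds\<close>.
\<close>

lemma Omega_iter_along:
  assumes I: "open I" "is_interval I" and X: "smooth_on I X" "\<And>s. s \<in> I \<Longrightarrow> deriv X s \<noteq> 0"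
    and Y: "smooth_on I Y" "\<And>s. s \<in> I \<Longrightarrow> y (X s) = Y s"
    and F: "smooth_on I (\<lambda>s. F (X s, Y s))" and s: "s \<in> I"
  shows "Omega_iter n F y (X s) = (fop (\<lambda>s. 1 / deriv X s) (\<lambda>s. F (X s, Y s)) ^^ n) Y s"
  using s
proof (induction n arbitrary: s)
  case 0
  then show ?case using Y by (simp add: Omega_iter_def)
next
  case (Suc n)
  let ?A = "\<lambda>s. 1 / deriv X s" and ?B = "\<lambda>s. F (X s, Y s)"
  let ?v = "(fop ?A ?B ^^ n) Y" and ?V = "Omega_iter n F y"
  have A: "smooth_on I ?A" by (intro smooth_on_divide smooth_on_const smooth_on_deriv I X) (use X in auto)
  have dX: "(X has_real_derivative deriv X t) (at t)" if "t \<in> I" for t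
    by (rule smooth_on_deriv_has_derivative[OF X(1) that])
  have inj: "inj_on X I" by (rule inj_on_deriv_nonzero[OF I(2) dX X(2)])
  let ?g = "inv_into I X"
  have cont: "continuous_on I X" using X(1) by (rule smooth_on_continuous)
  have g: "(?g has_real_derivative inverse (deriv X s)) (at (X s))"
    unfolding has_field_derivative_def
    by (rule has_derivative_inverse_strong[OF I(1) Suc.prems cont _
          dX[OF Suc.prems, unfolded has_field_derivative_def]])
      (use inj X(2)[OF Suc.prems] in auto)
  have opn: "open (X ` I)" by (rule invariance_of_domain[OF cont I(1) inj])
  have "(?v has_real_derivative deriv ?v s) (at (?g (X s)))"
    using fop_iter_has_derivative[OF I(1) A F Y(1) Suc.prems] inj Suc.prems by simp
  from DERIV_chain2[OF this g]
  have "((\<lambda>x. ?v (?g x)) has_real_derivative deriv ?v s * inverse (deriv X s)) (at (X s))" .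
  moreover have "?v (?g x) = ?V x" if "x \<in> X ` I" for x
    using that Suc.IH inj by auto
  ultimately have "(?V has_real_derivative deriv ?v s * inverse (deriv X s)) (at (X s))"
    using has_field_derivative_transform_within_open[OF _ opn] Suc.prems by blast
  then have "deriv ?V (X s) = deriv ?v s * inverse (deriv X s)" by (rule DERIV_imp_deriv)
  moreover have "Omega_iter (Suc n) F y (X s) = deriv ?V (X s) + F (X s, y (X s)) * ?V (X s)"
    by (simp add: Omega_iter_def Omega_def)
  ultimately show ?case using Suc Y(2) by (simp add: fop_iter_Suc divide_inverse del: funpow.simps)
qed

text \<open>
  The left-hand side \<open>\<Omega>\<^sub>F\<^sup>n[y]\<close> along the image of the graph of \<open>w\<close>, as a function of \<open>z\<close>.
\<close>

definition pullback ::
    "nat \<Rightarrow> (real \<times> real \<Rightarrow> real) \<Rightarrow> (real \<times> real \<Rightarrow> real) \<Rightarrow> (real \<times> real \<Rightarrow> real) \<Rightarrow> (real \<Rightarrow> real) \<Rightarrow> real \<Rightarrow> real" where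
  "pullback n F \<rho> \<psi> w = (fop (\<lambda>t. 1 / deriv (\<lambda>t. \<rho> (t, w t)) t) (\<lambda>t. F (\<rho> (t, w t), \<psi> (t, w t))) ^^ n) (\<lambda>t. \<psi> (t, w t))"

locale smooth_map =
  fixes U :: "(real \<times> real) set" and \<rho> \<psi> :: "real \<times> real \<Rightarrow> real"
  assumes open_U: "open U" and smooth_\<rho>: "smooth_on U \<rho>" and smooth_\<psi>: "smooth_on U \<psi>"
begin

lemma smooth_along:
  assumes "smooth_on U f" "open I" "smooth_on I w" "\<And>z. z \<in> I \<Longrightarrow> (z, w z) \<in> U"
  shows "smooth_on I (\<lambda>z. (f (z, w z) :: real))"
  by (rule smooth_on_compose[OF assms(1,2) open_U]) (auto intro!: smooth_on_intros assms)

lemma transformed_curve_Omega_iter: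
  assumes "transformed_curve D \<rho> \<psi> I w y" "D \<subseteq> U" "open V" "smooth_on V F"
    "(\<lambda>q. (\<rho> q, \<psi> q)) ` D \<subseteq> V" "z \<in> I"
  shows "Omega_iter n F y (\<rho> (z, w z)) = pullback n F \<rho> \<psi> w z"
proof -
  note c = assms(1)[unfolded transformed_curve_def]
  have wU: "(z, w z) \<in> U" "(\<rho> (z, w z), \<psi> (z, w z)) \<in> V" if "z \<in> I" for z
    using c assms(2,5) that by auto
  have X: "smooth_on I (\<lambda>t. \<rho> (t, w t))" and Y: "smooth_on I (\<lambda>t. \<psi> (t, w t))"
    using c wU by (auto intro!: smooth_along smooth_\<rho> smooth_\<psi>)
  have F: "smooth_on I (\<lambda>t. F (\<rho> (t, w t), \<psi> (t, w t)))"
    using c by (intro smooth_on_compose[OF assms(4) _ assms(3)] smooth_on_Pair X Y wU) auto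
  show ?thesis
    unfolding pullback_def
    by (rule Omega_iter_along[where X = "\<lambda>t. \<rho> (t, w t)"]) (use c X Y F assms(6) in auto)
qed

lemma ex_transformed_curve:
  assumes D: "open D" "D \<subseteq> U" and w: "open I0" "smooth_on I0 w" "z0 \<in> I0" "(z0, w z0) \<in> D"
    and X': "deriv (\<lambda>t. \<rho> (t, w t)) z0 \<noteq> 0"
  obtains I y where "transformed_curve D \<rho> \<psi> I w y" "z0 \<in> I" "I \<subseteq> I0"
proof -
  let ?X = "\<lambda>t. \<rho> (t, w t)"
  define J where "J = {z \<in> I0. (z, w z) \<in> D}"
  have "continuous_on I0 (\<lambda>z. (z, w z))" by (intro continuous_intros smooth_on_continuous w)
  then have "open (I0 \<inter> (\<lambda>z. (z, w z)) -` D)" by (rule continuous_open_preimage) (use w D in auto)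
  then have J: "open J" unfolding J_def by (simp add: Int_def vimage_def)
  have X: "smooth_on J ?X"
    by (rule smooth_along[OF smooth_\<rho> J])
      (use D w smooth_on_subset[of I0 w J] in \<open>auto simp: J_def\<close>)
  have "continuous_on J (deriv ?X)" by (intro smooth_on_continuous smooth_on_deriv J X)
  then have "open (J \<inter> deriv ?X -` (- {0}))" by (rule continuous_open_preimage) (use J in auto)
  moreover have "z0 \<in> J \<inter> deriv ?X -` (- {0})" using w X' by (auto simp: J_def)
  ultimately obtain e where e: "e > 0" "ball z0 e \<subseteq> J \<inter> deriv ?X -` (- {0})"
    using open_contains_ball by metis
  define I where "I = ball z0 e"
  have I: "open I" "is_interval I" "z0 \<in> I" "I \<subseteq> J" "\<And>z. z \<in> I \<Longrightarrow> deriv ?X z \<noteq> 0"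
    using e by (auto simp: I_def is_interval_ball_real)
  have inj: "inj_on ?X I"
    by (rule inj_on_deriv_nonzero[OF I(2) smooth_on_deriv_has_derivative[OF X]]) (use I in auto)
  \<comment> \<open>The image of the graph is parametrised by \<open>x\<close>, through the inverse of \<open>z \<mapsto> \<rho>(z, w(z))\<close>.\<close>
  have "transformed_curve D \<rho> \<psi> I w (\<lambda>x. \<psi> (inv_into I ?X x, w (inv_into I ?X x)))"
    unfolding transformed_curve_def
    using I inv_into_f_f[OF inj] smooth_on_subset[OF w(2), of I] by (auto simp: J_def)
  then show ?thesis using that I by (auto simp: J_def)
qed

text \<open>
  As the factor \<open>\<mu>\<close> does not vanish, the two equations have the same zeros along every curve over which
  \<open>x\<close> is a coordinate.
\<close>

lemma parameter_function_zero_iff: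
  assumes pf: "parameter_function n D \<rho> \<psi> F Q" "n \<ge> 1" and D: "open D" "D \<subseteq> U"
    and F: "open V" "smooth_on V F" "(\<lambda>q. (\<rho> q, \<psi> q)) ` D \<subseteq> V"
    and w: "open I0" "smooth_on I0 w" "z0 \<in> I0" "(z0, w z0) \<in> D"
    and X': "deriv (\<lambda>t. \<rho> (t, w t)) z0 \<noteq> 0"
  shows "pullback n F \<rho> \<psi> w z0 = 0 \<longleftrightarrow> Omega_iter n Q w z0 = 0"
proof -
  obtain I y where c: "transformed_curve D \<rho> \<psi> I w y" "z0 \<in> I"
    using ex_transformed_curve[OF D w X'] by blast
  obtain \<mu> where \<mu>: "\<And>j. j \<in> jets_over D \<rho> \<Longrightarrow> \<mu> j \<noteq> 0"
    "Omega_iter n F y (\<rho> (z0, w z0)) = \<mu> (jet n w z0) * Omega_iter n Q w z0"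
    using pf(1) c unfolding parameter_function_def by blast
  have "(z0, w z0) \<in> U" using w D by auto
  from has_real_derivative_along_partial[OF open_U smooth_\<rho> DERIV_ident
      smooth_on_deriv_has_derivative[OF w(2,3)] this]
  have "deriv (\<lambda>t. \<rho> (t, w t)) z0 = partial1 \<rho> (z0, w z0) + partial2 \<rho> (z0, w z0) * deriv w z0"
    by (simp add: DERIV_imp_deriv mult.commute)
  then have "jet n w z0 \<in> jets_over D \<rho>"
    using X' w(4) pf(2) by (simp add: jets_over_def jet_def numeral_2_eq_2)
  then show ?thesis
    using \<mu> transformed_curve_Omega_iter[OF c(1) D(2) F c(2)] by auto
qed

lemma solvable_atI:
  assumes F: "open V" "smooth_on V F" "(\<rho> (z0, w z0), \<psi> (z0, w z0)) \<in> V"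
    and w: "open I0" "smooth_on I0 w" "z0 \<in> I0" "(z0, w z0) \<in> U"
    and X': "deriv (\<lambda>t. \<rho> (t, w t)) z0 \<noteq> 0" and z: "pullback n F \<rho> \<psi> w z0 = 0"
  shows "solvable_at n U \<rho> \<psi> F (z0, w z0)"
proof -
  \<comment> \<open>The curve is first constructed over \<open>V\<close>, since only there \<open>F\<close> is known to be smooth.\<close>
  let ?D = "U \<inter> (\<lambda>q. (\<rho> q, \<psi> q)) -` V"
  have "continuous_on U (\<lambda>q. (\<rho> q, \<psi> q))"
    by (intro continuous_intros smooth_on_continuous smooth_\<rho> smooth_\<psi>)
  then have D: "open ?D" by (rule continuous_open_preimage) (use open_U F in auto)
  obtain I y where c: "transformed_curve ?D \<rho> \<psi> I w y" "z0 \<in> I"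
    by (rule ex_transformed_curve[OF D _ w(1-3) _ X']) (use w F in auto)
  have "Omega_iter n F y (\<rho> (z0, w z0)) = pullback n F \<rho> \<psi> w z0"
    by (rule transformed_curve_Omega_iter[OF c(1) _ F(1,2) _ c(2)]) auto
  moreover have "transformed_curve U \<rho> \<psi> I w y" using c(1) by (auto simp: transformed_curve_def)
  ultimately show ?thesis using c(2) z unfolding solvable_at_def by auto
qed

end

section \<open>Factors depending on first-order jets\<close>

lemma has_real_derivative_line:
  fixes f :: "'a::euclidean_space \<Rightarrow> real"
  assumes "smooth_on S f" "x \<in> S" "L t0 = x" "\<And>t. L t = x + (t - t0) *\<^sub>R e"
  shows "((\<lambda>t. f (L t)) has_real_derivative frechet_derivative f (at x) e) (at t0)"
proof -
  let ?F = "frechet_derivative f (at x)"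
  have L: "L = (\<lambda>t. x + (t - t0) *\<^sub>R e)" using assms(4) by auto
  have dF: "(f has_derivative ?F) (at (L t0))" using smooth_on_has_derivative[OF assms(1,2)] assms(3) by simp
  have "(L has_derivative (\<lambda>h. h *\<^sub>R e)) (at t0)" unfolding L by (auto intro!: derivative_eq_intros)
  from has_derivative_compose[OF this dF]
  have "((\<lambda>t. f (L t)) has_derivative (\<lambda>h. ?F (h *\<^sub>R e))) (at t0)" .
  moreover have "?F (h *\<^sub>R e) = ?F e * h" for h
    using linear_scale[OF has_derivative_linear[OF dF]] by simp
  ultimately show ?thesis by (simp add: has_field_derivative_def)
qed

text \<open>
  A partial derivative of \<open>j \<mapsto> G (j 0, j 1, j 2)\<close> is a function of the same shape. The partial
  derivatives of \<open>G\<close> are taken as limits of difference quotients at every point, so that this identity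
  holds for all jets and not only for those in \<open>S\<close>, which need not be open in the product topology.
\<close>

lemma jet_smooth_on_first_order:
  fixes G :: "real \<times> real \<times> real \<Rightarrow> real"
  assumes "open T" "smooth_on T G" "\<And>j. j \<in> S \<Longrightarrow> (j 0, j 1, j 2) \<in> T"
  shows "jet_smooth_on m S (\<lambda>j. G (j 0, j 1, j 2))"
proof -
  have coords: "continuous_on S (\<lambda>j::nat \<Rightarrow> real. (j 0, j 1, j 2))"
    by (intro continuous_on_Pair continuous_on_subset[OF continuous_on_product_coordinates] subset_UNIV)
  have "jet_Ck_on m k S (\<lambda>j. G (j 0, j 1, j 2))" for k
    using assms(2)
  proof (induction k arbitrary: G)
    case 0
    show ?case
      using continuous_on_compose2[OF smooth_on_continuous[OF 0] coords] assms(3) by auto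
  next
    case (Suc k)
    have cont: "continuous_on S (\<lambda>j. G (j 0, j 1, j 2))"
      using continuous_on_compose2[OF smooth_on_continuous[OF Suc.prems] coords] assms(3) by auto
    define G0 where "G0 = (\<lambda>x. deriv (\<lambda>t. G (t, fst (snd x), snd (snd x))) (fst x))"
    define G1 where "G1 = (\<lambda>x. deriv (\<lambda>t. G (fst x, t, snd (snd x))) (fst (snd x)))"
    define G2 where "G2 = (\<lambda>x. deriv (\<lambda>t. G (fst x, fst (snd x), t)) (snd (snd x)))"
    have d: "((\<lambda>t. G (t, b, c)) has_real_derivative frechet_derivative G (at (a, b, c)) (1, 0, 0)) (at a)"
        "((\<lambda>t. G (a, t, c)) has_real_derivative frechet_derivative G (at (a, b, c)) (0, 1, 0)) (at b)"
        "((\<lambda>t. G (a, b, t)) has_real_derivative frechet_derivative G (at (a, b, c)) (0, 0, 1)) (at c)"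
      if "(a, b, c) \<in> T" for a b c
      by (intro has_real_derivative_line[OF Suc.prems that]; simp)+
    have diff: "(\<lambda>t. G (t, b, c)) differentiable (at a)" "(\<lambda>t. G (a, t, c)) differentiable (at b)"
        "(\<lambda>t. G (a, b, t)) differentiable (at c)" if "(a, b, c) \<in> T" for a b c
      using d[OF that] real_differentiable_def by blast+
    have "G0 x = frechet_derivative G (at x) (1, 0, 0)"
      "G1 x = frechet_derivative G (at x) (0, 1, 0)"
      "G2 x = frechet_derivative G (at x) (0, 0, 1)" if "x \<in> T" for x
      using d[of "fst x" "fst (snd x)" "snd (snd x)"] that
      by (auto simp: G0_def G1_def G2_def intro: DERIV_imp_deriv)
    then have sm: "smooth_on T G0" "smooth_on T G1" "smooth_on T G2"
      using smooth_on_frechet_derivative[OF Suc.prems] smooth_on_cong[OF assms(1)]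
      by (auto cong: smooth_on_cong[OF assms(1)])
    have "(\<forall>j\<in>S. (\<lambda>t. G ((j(i := t)) 0, (j(i := t)) 1, (j(i := t)) 2)) differentiable (at (j i))) \<and>
        jet_Ck_on m k S (\<lambda>j. deriv (\<lambda>t. G ((j(i := t)) 0, (j(i := t)) 1, (j(i := t)) 2)) (j i))" for i
    proof -
      consider "i = 0" | "i = 1" | "i = 2" | "i \<noteq> 0" "i \<noteq> 1" "i \<noteq> 2" by blast
      then show ?thesis
      proof cases
        case 1
        then show ?thesis using diff(1) assms(3) Suc.IH[OF sm(1)]
          by (auto simp: G0_def)
      next
        case 2
        then show ?thesis using diff(2) assms(3) Suc.IH[OF sm(2)]
          by (auto simp: G1_def)
      next
        case 3
        then show ?thesis using diff(3) assms(3) Suc.IH[OF sm(3)]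
          by (auto simp: G2_def)
      next
        case 4
        then show ?thesis using Suc.IH[OF smooth_on_const[OF assms(1)], of 0] by simp
      qed
    qed
    with cont show ?case by simp
  qed
  then show ?thesis by (simp add: jet_smooth_on_def)
qed

section \<open>Equations of first order\<close>

context smooth_map
begin

lemma has_derivative_along:
  assumes "smooth_on U f" "(w has_real_derivative w') (at z)" "(z, w z) \<in> U"
  shows "((\<lambda>t. f (t, w t)) has_real_derivative partial1 f (z, w z) + partial2 f (z, w z) * w') (at z)"
  using has_real_derivative_along_partial[OF open_U assms(1) DERIV_ident assms(2,3)]
  by (simp add: mult.commute)

lemma deriv_along:
  assumes "smooth_on U f" "(w has_real_derivative w') (at z)" "(z, w z) \<in> U"
  shows "deriv (\<lambda>t. f (t, w t)) z = partial1 f (z, w z) + partial2 f (z, w z) * w'"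
  using has_derivative_along[OF assms] by (rule DERIV_imp_deriv)

lemma open_preimage_map: "open V \<Longrightarrow> open {p \<in> U. (\<rho> p, \<psi> p) \<in> V}"
proof -
  assume "open V"
  have "continuous_on U (\<lambda>q. (\<rho> q, \<psi> q))"
    by (intro continuous_intros smooth_on_continuous smooth_\<rho> smooth_\<psi>)
  from continuous_open_preimage[OF this open_U \<open>open V\<close>]
  show ?thesis by (simp add: Int_def vimage_def)
qed

lemma smooth_on_map_compose:
  "open V \<Longrightarrow> smooth_on V F \<Longrightarrow> smooth_on {p \<in> U. (\<rho> p, \<psi> p) \<in> V} (\<lambda>p. (F (\<rho> p, \<psi> p) :: real))"
  by (rule smooth_on_compose[OF _ open_preimage_map])
    (auto intro!: smooth_on_Pair open_preimage_map
      intro: smooth_on_subset[OF smooth_\<rho>] smooth_on_subset[OF smooth_\<psi>])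

lemma pullback_1:
  assumes w: "(w has_real_derivative w') (at z)" "(z, w z) \<in> U"
    and X': "partial1 \<rho> (z, w z) + partial2 \<rho> (z, w z) * w' \<noteq> 0"
  shows "pullback 1 F \<rho> \<psi> w z =
    ((F (\<rho> (z, w z), \<psi> (z, w z)) * \<psi> (z, w z) * partial2 \<rho> (z, w z) + partial2 \<psi> (z, w z)) * w'
      + (F (\<rho> (z, w z), \<psi> (z, w z)) * \<psi> (z, w z) * partial1 \<rho> (z, w z) + partial1 \<psi> (z, w z)))
    / (partial1 \<rho> (z, w z) + partial2 \<rho> (z, w z) * w')"
  using X' by (simp add: pullback_def fop_def deriv_along[OF smooth_\<rho> w] deriv_along[OF smooth_\<psi> w] field_simps)

end

text \<open>
  Multiplied by \<open>dx/dz\<close>, the equation \<open>\<Omega>\<^sub>F[y] = 0\<close> turns into a linear equation for \<open>w'\<close>; the two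
  functions below are the coefficient of \<open>w'\<close> and the remaining term.
\<close>

definition Q1_denominator ::
    "(real \<times> real \<Rightarrow> real) \<Rightarrow> (real \<times> real \<Rightarrow> real) \<Rightarrow> (real \<times> real \<Rightarrow> real) \<Rightarrow> real \<times> real \<Rightarrow> real" where
  "Q1_denominator \<rho> \<psi> F p = F (\<rho> p, \<psi> p) * \<psi> p * partial2 \<rho> p + partial2 \<psi> p"

definition Q1_numerator ::
    "(real \<times> real \<Rightarrow> real) \<Rightarrow> (real \<times> real \<Rightarrow> real) \<Rightarrow> (real \<times> real \<Rightarrow> real) \<Rightarrow> real \<times> real \<Rightarrow> real" where
  "Q1_numerator \<rho> \<psi> F p = F (\<rho> p, \<psi> p) * \<psi> p * partial1 \<rho> p + partial1 \<psi> p"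

definition Q1_domain ::
    "(real \<times> real) set \<Rightarrow> (real \<times> real \<Rightarrow> real) \<Rightarrow> (real \<times> real \<Rightarrow> real) \<Rightarrow> (real \<times> real) set \<Rightarrow>
      (real \<times> real \<Rightarrow> real) \<Rightarrow> (real \<times> real) set" where
  "Q1_domain U \<rho> \<psi> V F = {p \<in> U. (\<rho> p, \<psi> p) \<in> V \<and> snd p * Q1_denominator \<rho> \<psi> F p \<noteq> 0}"

locale point_transf = smooth_map +
  assumes jacobian: "p \<in> U \<Longrightarrow> partial1 \<rho> p * partial2 \<psi> p - partial2 \<rho> p * partial1 \<psi> p \<noteq> 0"
begin

context
  fixes V :: "(real \<times> real) set" and F :: "real \<times> real \<Rightarrow> real"
  assumes V: "open V" and F: "smooth_on V F"
begin

lemma smooth_Q1_parts: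
  "smooth_on {p \<in> U. (\<rho> p, \<psi> p) \<in> V} (Q1_denominator \<rho> \<psi> F)"
  "smooth_on {p \<in> U. (\<rho> p, \<psi> p) \<in> V} (Q1_numerator \<rho> \<psi> F)"
proof -
  let ?P = "{p \<in> U. (\<rho> p, \<psi> p) \<in> V}"
  have P: "open ?P" by (rule open_preimage_map[OF V])
  have s: "smooth_on ?P f" if "smooth_on U f" for f :: "real \<times> real \<Rightarrow> real"
    by (rule smooth_on_subset[OF that]) auto
  show "smooth_on ?P (Q1_denominator \<rho> \<psi> F)" "smooth_on ?P (Q1_numerator \<rho> \<psi> F)"
    unfolding Q1_denominator_def[abs_def] Q1_numerator_def[abs_def]
    by (intro smooth_on_add smooth_on_mult P s smooth_on_map_compose[OF V F] smooth_\<rho> smooth_\<psi>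
        smooth_on_partial1[OF open_U] smooth_on_partial2[OF open_U])+
qed

lemma open_Q1_domain: "open (Q1_domain U \<rho> \<psi> V F)"
proof -
  let ?P = "{p \<in> U. (\<rho> p, \<psi> p) \<in> V}"
  have "continuous_on ?P (\<lambda>p. snd p * Q1_denominator \<rho> \<psi> F p)"
    by (intro continuous_intros smooth_on_continuous smooth_Q1_parts)
  from continuous_open_preimage[OF this open_preimage_map[OF V], of "- {0}"]
  have "open ({p \<in> U. (\<rho> p, \<psi> p) \<in> V} \<inter> (\<lambda>p. snd p * Q1_denominator \<rho> \<psi> F p) -` (- {0}))"
    by (simp add: open_Compl)
  moreover have "Q1_domain U \<rho> \<psi> V F
      = {p \<in> U. (\<rho> p, \<psi> p) \<in> V} \<inter> (\<lambda>p. snd p * Q1_denominator \<rho> \<psi> F p) -` (- {0})"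
    by (auto simp: Q1_domain_def)
  ultimately show ?thesis by simp
qed

text \<open>
  Division by the coefficient of \<open>w'\<close> leaves \<open>w' + Q\<^sub>1 w\<close>, so the factor is that coefficient divided by
  the total derivative of \<open>\<rho>\<close>, a function of the first-order jet.
\<close>

lemma parameter_function_Q1:
  defines "D \<equiv> Q1_domain U \<rho> \<psi> V F"
  shows "parameter_function 1 D \<rho> \<psi> F (\<lambda>p. Q1_numerator \<rho> \<psi> F p / (snd p * Q1_denominator \<rho> \<psi> F p))"
proof -
  let ?N = "Q1_numerator \<rho> \<psi> F" and ?M = "Q1_denominator \<rho> \<psi> F"
  let ?Q = "\<lambda>p. ?N p / (snd p * ?M p)"
  have D: "open D" unfolding D_def by (rule open_Q1_domain)
  have DU: "D \<subseteq> U" "D \<subseteq> {p \<in> U. (\<rho> p, \<psi> p) \<in> V}" and Dn0: "\<And>p. p \<in> D \<Longrightarrow> snd p * ?M p \<noteq> 0"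
    by (auto simp: D_def Q1_domain_def)
  note sm = smooth_Q1_parts[THEN smooth_on_subset[OF _ DU(2)]]
  note smU = smooth_on_subset[OF smooth_on_partial1[OF open_U smooth_\<rho>] DU(1)]
    smooth_on_subset[OF smooth_on_partial2[OF open_U smooth_\<rho>] DU(1)]
  have "smooth_on D ?Q"
    by (intro smooth_on_divide smooth_on_mult D sm Dn0 smooth_on_snd smooth_on_ident)
  moreover have "jet_smooth_on 3 (jets_over D \<rho>)
      (\<lambda>j. ?M (j 0, j 1) / (partial1 \<rho> (j 0, j 1) + partial2 \<rho> (j 0, j 1) * j 2))"
  proof -
    let ?f = "\<lambda>x. partial1 \<rho> (fst x, fst (snd x)) + partial2 \<rho> (fst x, fst (snd x)) * snd (snd x)"
    define T0 where "T0 = (\<lambda>x::real\<times>real\<times>real. (fst x, fst (snd x))) -` D"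
    have T0: "open T0" unfolding T0_def by (intro open_vimage D continuous_intros)
    have c: "smooth_on T0 (\<lambda>x. f (fst x, fst (snd x)))" if "smooth_on D f" for f :: "real \<times> real \<Rightarrow> real"
      by (rule smooth_on_compose[OF that T0 D])
        (auto simp: T0_def intro!: smooth_on_intros T0[unfolded T0_def])
    have f: "smooth_on T0 ?f" by (intro smooth_on_add smooth_on_mult c smU T0 smooth_on_snd smooth_on_ident)
    define T where "T = T0 \<inter> ?f -` (- {0})"
    have T: "open T"
      unfolding T_def by (rule continuous_open_preimage[OF smooth_on_continuous[OF f] T0]) auto
    have TT0: "T \<subseteq> T0" by (auto simp: T_def)
    have "smooth_on T (\<lambda>x. ?M (fst x, fst (snd x)) / ?f x)"
      by (intro smooth_on_divide T smooth_on_subset[OF f TT0] smooth_on_subset[OF c[OF sm(1)] TT0])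
        (auto simp: T_def)
    from jet_smooth_on_first_order[OF T this, of "jets_over D \<rho>" 3]
    show ?thesis by (auto simp: jets_over_def T_def T0_def)
  qed
  moreover have "?M (j 0, j 1) / (partial1 \<rho> (j 0, j 1) + partial2 \<rho> (j 0, j 1) * j 2) \<noteq> 0"
    if "j \<in> jets_over D \<rho>" for j
    using that Dn0 by (auto simp: jets_over_def)
  moreover have "Omega_iter 1 F y (\<rho> (z, w z)) =
      ?M (z, w z) / (partial1 \<rho> (z, w z) + partial2 \<rho> (z, w z) * deriv w z) * Omega_iter 1 ?Q w z"
    if c: "transformed_curve D \<rho> \<psi> I w y" and z: "z \<in> I" for I w y z
  proof -
    have t: "open I" "smooth_on I w" "(z, w z) \<in> D" "deriv (\<lambda>t. \<rho> (t, w t)) z \<noteq> 0"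
      using c z by (auto simp: transformed_curve_def)
    have wz: "(z, w z) \<in> U" using t DU by auto
    have w': "(w has_real_derivative deriv w z) (at z)" by (rule smooth_on_deriv_has_derivative[OF t(2) z])
    have X': "partial1 \<rho> (z, w z) + partial2 \<rho> (z, w z) * deriv w z \<noteq> 0"
      using t(4) deriv_along[OF smooth_\<rho> w' wz] by simp
    have "Omega_iter 1 F y (\<rho> (z, w z)) = pullback 1 F \<rho> \<psi> w z"
      by (rule transformed_curve_Omega_iter[OF c DU(1) V F _ z]) (use DU in auto)
    also have "\<dots> = (?M (z, w z) * deriv w z + ?N (z, w z)) / (partial1 \<rho> (z, w z) + partial2 \<rho> (z, w z) * deriv w z)"
      using pullback_1[OF w' wz X'] by (simp add: Q1_denominator_def Q1_numerator_def)
    also have "?M (z, w z) * deriv w z + ?N (z, w z) = ?M (z, w z) * Omega_iter 1 ?Q w z"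
      using Dn0[OF t(3)] by (simp add: Omega_iter_def Omega_def field_simps)
    finally show ?thesis by simp
  qed
  ultimately show ?thesis
    unfolding parameter_function_def
    by (intro conjI exI[of _ "\<lambda>j. ?M (j 0, j 1) / (partial1 \<rho> (j 0, j 1) + partial2 \<rho> (j 0, j 1) * j 2)"])
      (auto simp: jet_def numeral_2_eq_2 numeral_3_eq_3)
qed

text \<open>
  At a point of the domain the first-order equation prescribes the slope of \<open>w\<close>. This slope is
  realised by a curve over which \<open>x\<close> is a coordinate, for otherwise the Jacobian would vanish.
\<close>

lemma Q1_unique:
  assumes D': "open D'" "D' \<subseteq> Q1_domain U \<rho> \<psi> V F" and pf: "parameter_function 1 D' \<rho> \<psi> F Q" and p: "p \<in> D'"
  shows "Q p = Q1_numerator \<rho> \<psi> F p / (snd p * Q1_denominator \<rho> \<psi> F p)"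
proof -
  let ?N = "Q1_numerator \<rho> \<psi> F p" and ?M = "Q1_denominator \<rho> \<psi> F p"
  have pU: "p \<in> U" "D' \<subseteq> U" and M: "?M \<noteq> 0" "snd p \<noteq> 0"
    using D'(2) p by (auto simp: Q1_domain_def)
  define m where "m = - ?N / ?M"
  define w where "w t = snd p + m * (t - fst p)" for t
  have w0: "(fst p, w (fst p)) = p" by (simp add: w_def)
  have w': "(w has_real_derivative m) (at (fst p))" unfolding w_def by (auto intro!: derivative_eq_intros)
  have eq: "?M * m + ?N = 0" using M by (simp add: m_def)
  have X': "partial1 \<rho> p + partial2 \<rho> p * m \<noteq> 0"
  proof
    assume z: "partial1 \<rho> p + partial2 \<rho> p * m = 0"
    have "?M * m + ?N = F (\<rho> p, \<psi> p) * \<psi> p * (partial1 \<rho> p + partial2 \<rho> p * m) + (partial1 \<psi> p + partial2 \<psi> p * m)"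
      by (simp add: Q1_numerator_def Q1_denominator_def algebra_simps)
    then have "partial1 \<psi> p = - (partial2 \<psi> p * m)" using eq z by simp
    moreover have "partial1 \<rho> p = - (partial2 \<rho> p * m)" using z by simp
    ultimately show False using jacobian[OF pU(1)] by simp
  qed
  have "pullback 1 F \<rho> \<psi> w (fst p) = (?M * m + ?N) / (partial1 \<rho> p + partial2 \<rho> p * m)"
    using pullback_1[OF w', of F] w0 pU X' by (simp add: Q1_numerator_def Q1_denominator_def)
  then have "pullback 1 F \<rho> \<psi> w (fst p) = 0" using eq by simp
  moreover have "pullback 1 F \<rho> \<psi> w (fst p) = 0 \<longleftrightarrow> Omega_iter 1 Q w (fst p) = 0"
  proof (rule parameter_function_zero_iff[OF pf _ D'(1) pU(2) V F, of UNIV])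
    show "smooth_on UNIV w" unfolding w_def[abs_def] by (intro smooth_on_intros) auto
    show "deriv (\<lambda>t. \<rho> (t, w t)) (fst p) \<noteq> 0" using deriv_along[OF smooth_\<rho> w'] w0 pU X' by simp
  qed (use p w0 D'(2) in \<open>auto simp: Q1_domain_def\<close>)
  ultimately have "m + Q p * snd p = 0"
    using w0 DERIV_imp_deriv[OF w'] by (simp add: Omega_iter_def Omega_def w_def)
  then show ?thesis using M by (simp add: m_def field_simps)
qed

text \<open>
  If the coefficient of \<open>w'\<close> vanishes at a point where the transformed equation has a solution, then
  the remaining term vanishes as well. Both gradients of the transformation are then proportional, with
  the factor \<open>- F \<psi>\<close>, against the nonvanishing of the Jacobian.
\<close>

lemma solvable_at_1_imp_Q1_domain:
  assumes "p \<in> U" "(\<rho> p, \<psi> p) \<in> V" "snd p \<noteq> 0" "solvable_at 1 U \<rho> \<psi> F p"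
  shows "p \<in> Q1_domain U \<rho> \<psi> V F"
proof -
  let ?N = "Q1_numerator \<rho> \<psi> F p" and ?M = "Q1_denominator \<rho> \<psi> F p"
  obtain I w y where c: "transformed_curve U \<rho> \<psi> I w y" "fst p \<in> I" "w (fst p) = snd p"
      "Omega_iter 1 F y (\<rho> p) = 0"
    using assms(4) unfolding solvable_at_def by blast
  have t: "open I" "smooth_on I w" "deriv (\<lambda>t. \<rho> (t, w t)) (fst p) \<noteq> 0" "\<And>z. z \<in> I \<Longrightarrow> y (\<rho> (z, w z)) = \<psi> (z, w z)"
    "\<And>z. z \<in> I \<Longrightarrow> (z, w z) \<in> U"
    using c by (auto simp: transformed_curve_def)
  have w': "(w has_real_derivative deriv w (fst p)) (at (fst p))"
    by (rule smooth_on_deriv_has_derivative[OF t(2) c(2)])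
  have wp: "(fst p, w (fst p)) = p" using c by simp
  have X': "partial1 \<rho> p + partial2 \<rho> p * deriv w (fst p) \<noteq> 0"
    using t(3) deriv_along[OF smooth_\<rho> w'] wp assms(1) by simp
  \<comment> \<open>In first order only the value of \<open>F\<close> at the point matters, and the constant with this value is
    smooth along the whole curve.\<close>
  have "Omega_iter 1 (\<lambda>q. F (\<rho> p, \<psi> p)) y (\<rho> (fst p, w (fst p))) = pullback 1 (\<lambda>q. F (\<rho> p, \<psi> p)) \<rho> \<psi> w (fst p)"
    by (rule transformed_curve_Omega_iter[OF c(1) _ open_UNIV smooth_on_const[OF open_UNIV] _ c(2)]) auto
  moreover have "Omega_iter 1 (\<lambda>q. F (\<rho> p, \<psi> p)) y (\<rho> p) = Omega_iter 1 F y (\<rho> p)"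
    using t(4)[OF c(2)] wp by (simp add: Omega_iter_def Omega_def)
  ultimately have "(?M * deriv w (fst p) + ?N) / (partial1 \<rho> p + partial2 \<rho> p * deriv w (fst p)) = 0"
    using pullback_1[OF w', of "\<lambda>q. F (\<rho> p, \<psi> p)"] wp assms(1) X' c(4)
    by (simp add: Q1_numerator_def Q1_denominator_def)
  then have eq: "?M * deriv w (fst p) + ?N = 0" using X' by simp
  have "?M \<noteq> 0"
  proof
    assume M: "?M = 0"
    then have "?N = 0" using eq by simp
    then have "partial1 \<psi> p = - (F (\<rho> p, \<psi> p) * \<psi> p * partial1 \<rho> p)"
      "partial2 \<psi> p = - (F (\<rho> p, \<psi> p) * \<psi> p * partial2 \<rho> p)"
      using M by (auto simp: Q1_numerator_def Q1_denominator_def)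
    then show False using jacobian[OF assms(1)] by simp
  qed
  then show ?thesis using assms by (simp add: Q1_domain_def)
qed

end

lemma equivalence_transformation_1:
  assumes "point_transformation U \<rho> \<psi>"
  shows "equivalence_transformation 1 U \<rho> \<psi>"
  unfolding equivalence_transformation_def
proof (intro conjI allI impI assms)
  fix V F p
  assume a: "open V \<and> smooth_on V F \<and> p \<in> U \<and> (\<rho> p, \<psi> p) \<in> V \<and> snd p \<noteq> 0 \<and> solvable_at 1 U \<rho> \<psi> F p"
  let ?D = "Q1_domain U \<rho> \<psi> V F"
  have "p \<in> ?D" by (rule solvable_at_1_imp_Q1_domain) (use a in auto)
  moreover have "?D \<subseteq> U" "(\<lambda>q. (\<rho> q, \<psi> q)) ` ?D \<subseteq> V" by (auto simp: Q1_domain_def)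
  ultimately show "\<exists>D Q. open D \<and> p \<in> D \<and> D \<subseteq> U \<and> (\<lambda>q. (\<rho> q, \<psi> q)) ` D \<subseteq> V \<and> parameter_function 1 D \<rho> \<psi> F Q"
    using open_Q1_domain[of V F] parameter_function_Q1[of V F] a by (intro exI[of _ ?D] exI) auto
qed

end

section \<open>Projective transformations of the independent variable\<close>

text \<open>
  If \<open>x\<close> is a projective function of \<open>z\<close> with denominator \<open>l\<close>, then \<open>d/dx = c l\<^sup>2 d/dz\<close>. The powers of
  \<open>c l\<^sup>2 S\<close> with \<open>S = d/dz + G\<close> agree with those of \<open>S\<close> up to factors on both sides because \<open>l\<close> is affine:
  \<open>S\<^sup>k\<^sup>+\<^sup>1 l = l S\<^sup>k\<^sup>+\<^sup>1 + (k + 1) l' S\<^sup>k\<close> without a term in \<open>S\<^sup>k\<^sup>-\<^sup>1\<close>.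
\<close>

lemma fop_iter_projective:
  assumes S: "open S" and G: "smooth_on S G" and f: "smooth_on S f" and l: "l = (\<lambda>t. k4 * t + k3)" and t: "t \<in> S"
  shows "(fop (\<lambda>t. c * (l t)\<^sup>2) (\<lambda>t. c * (l t)\<^sup>2 * G t) ^^ k) (\<lambda>t. l t * f t) t
    = c ^ k * l t ^ (k + 1) * (fop (\<lambda>t. 1) G ^^ k) (\<lambda>t. l t ^ k * f t) t"
  using t
proof (induction k arbitrary: t)
  case (Suc k)
  let ?A = "\<lambda>t. c * (l t)\<^sup>2" and ?B = "\<lambda>t. c * (l t)\<^sup>2 * G t"
  let ?U = "(fop (\<lambda>t. 1) G ^^ k) (\<lambda>t. l t ^ k * f t)"
  have dl: "(l has_real_derivative k4) (at t)" for t unfolding l by (auto intro!: derivative_eq_intros)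
  have sl: "smooth_on S l" unfolding l by (intro smooth_on_intros S)
  have su: "smooth_on S (\<lambda>t. l t ^ k * f t)" by (intro smooth_on_intros S sl f)
  have dU: "(?U has_real_derivative deriv ?U t) (at t)"
    by (rule fop_iter_has_derivative[OF S smooth_on_const[OF S] G su Suc.prems])
  have "deriv ((fop ?A ?B ^^ k) (\<lambda>t. l t * f t)) t = deriv (\<lambda>t. c ^ k * l t ^ (k + 1) * ?U t) t"
    using Suc by (intro deriv_cong_on_open[OF S]) auto
  also have "\<dots> = c ^ k * (of_nat (k + 1) * l t ^ k * k4 * ?U t + l t ^ (k + 1) * deriv ?U t)"
  proof (rule DERIV_imp_deriv)
    have "((\<lambda>t. c ^ k * l t ^ (k + 1) * u t) has_real_derivative
        c ^ k * (of_nat (k + 1) * l t ^ k * k4 * u t + l t ^ (k + 1) * u')) (at t)"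
      if "(u has_real_derivative u') (at t)" for u u'
      by (rule derivative_eq_intros dl that refl)+ (simp add: algebra_simps)
    then show "((\<lambda>t. c ^ k * l t ^ (k + 1) * ?U t) has_real_derivative
        c ^ k * (of_nat (k + 1) * l t ^ k * k4 * ?U t + l t ^ (k + 1) * deriv ?U t)) (at t)"
      using dU by blast
  qed
  finally have "(fop ?A ?B ^^ Suc k) (\<lambda>t. l t * f t) t
      = c ^ Suc k * l t ^ (k + 2) * (l t * (deriv ?U t + G t * ?U t) + of_nat (k + 1) * k4 * ?U t)"
    unfolding fop_iter_Suc Suc.IH[OF Suc.prems] by (simp add: algebra_simps power2_eq_square)
  also have "l t * (deriv ?U t + G t * ?U t) + of_nat (k + 1) * k4 * ?U t
      = (fop (\<lambda>t. 1) G ^^ Suc k) (\<lambda>t. l t * (l t ^ k * f t)) t"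
    using fop_iter_coordinate_mult[OF S smooth_on_const[OF S] G su sl _ Suc.prems, of 1 k4 "Suc k"]
      DERIV_imp_deriv[OF dl] by (simp add: fop_iter_Suc del: funpow.simps)
  finally show ?case by (simp add: mult.assoc del: funpow.simps)
qed (simp add: power2_eq_square)

locale projective =
  fixes U :: "(real \<times> real) set" and \<rho> \<psi> k1 k2 k3 k4 R
  assumes open_U: "open U" and proj: "projective_form U \<rho> \<psi> k1 k2 k3 k4 R"
begin

definition "l z = k4 * z + k3"
definition "\<Delta> = k2 * k3 - k1 * k4"

lemma \<Delta>: "\<Delta> \<noteq> 0"
  and R: "smooth_on (fst ` U) R"
  and on_U: "(z, w) \<in> U \<Longrightarrow> l z \<noteq> 0" "(z, w) \<in> U \<Longrightarrow> R z \<noteq> 0"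
    "(z, w) \<in> U \<Longrightarrow> \<rho> (z, w) = (k2 * z + k1) / l z" "(z, w) \<in> U \<Longrightarrow> \<psi> (z, w) = R z * w"
  using proj by (auto simp: projective_form_def \<Delta>_def l_def)

lemma open_K: "open (fst ` U)"
  by (rule open_image_fst[OF open_U])

lemma smooth_on_base:
  assumes "smooth_on (fst ` U) f" shows "smooth_on U (\<lambda>p. f (fst p) :: real)"
  by (rule smooth_on_compose[OF assms open_U open_K smooth_on_fst[OF open_U smooth_on_ident[OF open_U]]]) auto

lemma smooth_l: "open S \<Longrightarrow> smooth_on S l"
  unfolding l_def[abs_def] by (intro smooth_on_intros)

sublocale smooth_map U \<rho> \<psi>
proof
  have "smooth_on U (\<lambda>p. (k2 * fst p + k1) / l (fst p))"
    using on_U(1) unfolding l_def by (intro smooth_on_intros open_U) auto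
  then show "smooth_on U \<rho>"
    using smooth_on_cong[OF open_U, of \<rho> "\<lambda>p. (k2 * fst p + k1) / l (fst p)"] on_U(3) by auto
  have "smooth_on U (\<lambda>p. R (fst p) * snd p)"
    by (rule smooth_on_mult[OF open_U smooth_on_base[OF R] smooth_on_snd[OF open_U smooth_on_ident[OF open_U]]])
  then show "smooth_on U \<psi>"
    using smooth_on_cong[OF open_U, of \<psi> "\<lambda>p. R (fst p) * snd p"] on_U(4) by auto
qed (rule open_U)

lemma ev_U:
  assumes "(z, w) \<in> U"
  shows "eventually (\<lambda>t. (t, w) \<in> U) (nhds z)" "eventually (\<lambda>t. (z, t) \<in> U) (nhds w)"
proof -
  have "open ((\<lambda>t. (t, w)) -` U)" "open ((\<lambda>t. (z, t)) -` U)"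
    by (intro open_vimage open_U continuous_intros)+
  then show "eventually (\<lambda>t. (t, w) \<in> U) (nhds z)" "eventually (\<lambda>t. (z, t) \<in> U) (nhds w)"
    using assms eventually_nhds_in_open[of "(\<lambda>t. (t, w)) -` U" z]
      eventually_nhds_in_open[of "(\<lambda>t. (z, t)) -` U" w] by auto
qed

lemma partials:
  assumes "(z, w) \<in> U"
  shows "partial1 \<rho> (z, w) = \<Delta> / (l z)\<^sup>2" "partial2 \<rho> (z, w) = 0"
    "partial1 \<psi> (z, w) = deriv R z * w" "partial2 \<psi> (z, w) = R z"
    "partial1 (partial1 \<rho>) (z, w) = - 2 * k4 * \<Delta> / (l z) ^ 3"
proof -
  have p1: "partial1 \<rho> (z, w) = \<Delta> / (l z)\<^sup>2" if "(z, w) \<in> U" for z w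
  proof -
    have "deriv (\<lambda>t. \<rho> (t, w)) z = deriv (\<lambda>t. (k2 * t + k1) / l t) z"
      by (rule deriv_cong_ev) (use ev_U(1)[OF that] on_U(3) in \<open>auto elim: eventually_mono\<close>)
    also have "\<dots> = \<Delta> / (l z)\<^sup>2"
      using on_U(1)[OF that] unfolding l_def \<Delta>_def
      by (intro DERIV_imp_deriv)
        (auto intro!: derivative_eq_intros simp: power2_eq_square divide_simps; simp add: algebra_simps)
    finally show ?thesis by (simp add: partial1_def)
  qed
  show "partial1 \<rho> (z, w) = \<Delta> / (l z)\<^sup>2" by (rule p1[OF assms])
  have "deriv (\<lambda>t. partial1 \<rho> (t, w)) z = deriv (\<lambda>t. \<Delta> / (l t)\<^sup>2) z"
    by (rule deriv_cong_ev) (use ev_U(1)[OF assms] p1 in \<open>auto elim: eventually_mono\<close>)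
  also have "\<dots> = - 2 * k4 * \<Delta> / (l z) ^ 3"
    using on_U(1)[OF assms] unfolding l_def
    by (intro DERIV_imp_deriv)
      (auto intro!: derivative_eq_intros simp: power2_eq_square power3_eq_cube divide_simps; simp add: algebra_simps)
  finally show "partial1 (partial1 \<rho>) (z, w) = - 2 * k4 * \<Delta> / (l z) ^ 3" by (simp add: partial1_def)
  have "deriv (\<lambda>t. \<rho> (z, t)) w = deriv (\<lambda>t. (k2 * z + k1) / l z) w"
    by (rule deriv_cong_ev) (use ev_U(2)[OF assms] on_U(3) in \<open>auto elim: eventually_mono\<close>)
  then show "partial2 \<rho> (z, w) = 0" by (simp add: partial2_def)
  have "deriv (\<lambda>t. \<psi> (z, t)) w = deriv (\<lambda>t. R z * t) w"
    by (rule deriv_cong_ev) (use ev_U(2)[OF assms] on_U(4) in \<open>auto elim: eventually_mono\<close>)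
  then show "partial2 \<psi> (z, w) = R z" by (simp add: partial2_def)
  have "deriv (\<lambda>t. \<psi> (t, w)) z = deriv (\<lambda>t. R t * w) z"
    by (rule deriv_cong_ev) (use ev_U(1)[OF assms] on_U(4) in \<open>auto elim: eventually_mono\<close>)
  moreover have "z \<in> fst ` U" using assms by force
  then have "deriv (\<lambda>t. R t * w) z = deriv R z * w"
    by (intro DERIV_imp_deriv) (auto intro!: derivative_eq_intros smooth_on_deriv_has_derivative[OF R])
  ultimately show "partial1 \<psi> (z, w) = deriv R z * w" by (simp add: partial1_def)
qed

lemma point_transformation: "point_transformation U \<rho> \<psi>"
  unfolding point_transformation_def
proof (intro conjI ballI smooth_\<rho> smooth_\<psi>)
  show "inj_on (\<lambda>p. (\<rho> p, \<psi> p)) U"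
  proof (rule inj_onI)
    fix p q assume p: "p \<in> U" and q: "q \<in> U" and eq: "(\<rho> p, \<psi> p) = (\<rho> q, \<psi> q)"
    obtain z w z' w' where zw: "p = (z, w)" "q = (z', w')" by (metis surj_pair)
    have "(k2 * z + k1) * l z' = (k2 * z' + k1) * l z"
    proof -
      have "k2 * z + k1 = \<rho> p * l z" "k2 * z' + k1 = \<rho> q * l z'"
        using on_U(1,3)[of z w] on_U(1,3)[of z' w'] p q zw by auto
      then show ?thesis using eq by simp
    qed
    then have "\<Delta> * (z - z') = 0" by (simp add: l_def \<Delta>_def algebra_simps)
    then have "z = z'" using \<Delta> by simp
    moreover from this have "w = w'" using eq on_U(2,4) p q zw by auto
    ultimately show "p = q" using zw by simp
  qed
  show "partial1 \<rho> p * partial2 \<psi> p - partial2 \<rho> p * partial1 \<psi> p \<noteq> 0" if "p \<in> U" for p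
    using that partials on_U \<Delta> by (cases p) auto
qed

definition Qn :: "nat \<Rightarrow> (real \<times> real \<Rightarrow> real) \<Rightarrow> real \<times> real \<Rightarrow> real" where
  "Qn n F = (\<lambda>(z, w). F (\<rho> (z, w), R z * w) * partial1 \<rho> (z, w) + deriv R z / R z
                 - ((real n - 1) / 2) * (partial1 (partial1 \<rho>) (z, w) / partial1 \<rho> (z, w)))"

context
  fixes V :: "(real \<times> real) set" and F :: "real \<times> real \<Rightarrow> real"
  assumes V: "open V" and F: "smooth_on V F"
begin

abbreviation "P \<equiv> {p \<in> U. (\<rho> p, \<psi> p) \<in> V}"

lemma smooth_Qn: "smooth_on P (Qn n F)"
proof -
  have P: "open P" by (rule open_preimage_map[OF V])
  have s: "smooth_on P f" if "smooth_on U f" for f :: "real \<times> real \<Rightarrow> real"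
    by (rule smooth_on_subset[OF that]) auto
  have "smooth_on P (\<lambda>p. F (\<rho> p, \<psi> p) * partial1 \<rho> p + deriv R (fst p) / R (fst p)
      - ((real n - 1) / 2) * (partial1 (partial1 \<rho>) p / partial1 \<rho> p))"
    using on_U(1,2) partials(1) \<Delta>
    by (intro smooth_on_diff smooth_on_add smooth_on_mult smooth_on_divide smooth_on_const P
        smooth_on_map_compose[OF V F] s smooth_on_partial1[OF open_U] smooth_\<rho>
        smooth_on_base[OF smooth_on_deriv[OF open_K R]] smooth_on_base[OF R]) auto
  then show ?thesis
    by (subst smooth_on_cong[OF P]) (auto simp: Qn_def on_U(4))
qed

text \<open>
  The factors \<open>l\<^sup>n\<^sup>-\<^sup>1\<close> and \<open>R\<close> in front of \<open>w\<close> are moved to the left of the operator as a gauge. Their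
  logarithmic derivatives are the terms \<open>- (n - 1)/2 \<rho>\<^sub>z\<^sub>z/\<rho>\<^sub>z\<close> and \<open>R\<^sub>z/R\<close> of the parameter function.
\<close>

lemma pullback_projective:
  assumes n: "n \<ge> 1" and I: "open I" "smooth_on I w" "\<And>z. z \<in> I \<Longrightarrow> (z, w z) \<in> P" and z: "z \<in> I"
  shows "pullback n F \<rho> \<psi> w z = R z * l z ^ (2 * n) / \<Delta> ^ n * Omega_iter n (Qn n F) w z"
proof -
  have IU: "(z, w z) \<in> U" if "z \<in> I" for z using I(3)[OF that] by simp
  have IK: "I \<subseteq> fst ` U" using IU by force
  have sP: "smooth_on I (\<lambda>t. f (t, w t))" if "smooth_on P f" for f :: "real \<times> real \<Rightarrow> real"
    by (rule smooth_on_compose[OF that I(1) open_preimage_map[OF V]])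
      (use I in \<open>auto intro!: smooth_on_Pair smooth_on_ident\<close>)
  let ?F = "\<lambda>t. F (\<rho> (t, w t), \<psi> (t, w t))"
  let ?G = "\<lambda>t. \<Delta> * ?F t / (l t)\<^sup>2"
  let ?h = "\<lambda>t. l t ^ (n - 1) * R t"
  have sl: "smooth_on I l" by (rule smooth_l[OF I(1)])
  have sR: "smooth_on I R" by (rule smooth_on_subset[OF R IK])
  have l0: "l t \<noteq> 0" "R t \<noteq> 0" if "t \<in> I" for t using on_U(1,2) IU[OF that] by auto
  have G: "smooth_on I ?G"
    using l0 by (intro smooth_on_intros I sl sP smooth_on_map_compose[OF V F]) auto
  have X': "deriv (\<lambda>t. \<rho> (t, w t)) t = \<Delta> / (l t)\<^sup>2" if "t \<in> I" for t
    using deriv_along[OF smooth_\<rho> smooth_on_deriv_has_derivative[OF I(2) that] IU[OF that]]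
      partials[OF IU[OF that]] by simp
  have f: "smooth_on I (\<lambda>t. R t * w t / l t)" using l0 by (intro smooth_on_intros I sl sR) auto
  have h: "smooth_on I ?h" by (intro smooth_on_intros I sl sR)
  have dl: "(l has_real_derivative k4) (at t)" for t
    unfolding l_def[abs_def] by (auto intro!: derivative_eq_intros)
  have "pullback n F \<rho> \<psi> w z
      = (fop (\<lambda>t. (1 / \<Delta>) * (l t)\<^sup>2) (\<lambda>t. (1 / \<Delta>) * (l t)\<^sup>2 * ?G t) ^^ n) (\<lambda>t. l t * (R t * w t / l t)) z"
    unfolding pullback_def
    by (rule fop_iter_cong[OF I(1) _ _ _ z]) (use l0 X' \<Delta> on_U(4)[OF IU] in auto)
  also have "\<dots> = (1 / \<Delta>) ^ n * l z ^ (n + 1) * (fop (\<lambda>t. 1) ?G ^^ n) (\<lambda>t. l t ^ n * (R t * w t / l t)) z"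
    by (rule fop_iter_projective[OF I(1) G f _ z]) (auto simp: l_def)
  also have "(fop (\<lambda>t. 1) ?G ^^ n) (\<lambda>t. l t ^ n * (R t * w t / l t)) z
      = (fop (\<lambda>t. 1) ?G ^^ n) (\<lambda>t. ?h t * w t) z"
    using n l0 by (intro fop_iter_cong[OF I(1) _ _ _ z]) (auto simp: power_eq_if)
  also have "\<dots> = ?h z * (fop (\<lambda>t. 1) (\<lambda>t. ?G t + 1 * deriv ?h t / ?h t) ^^ n) w z"
    by (rule fop_iter_gauge[OF I(1) smooth_on_const[OF I(1)] G h _ I(2) z]) (use l0 in auto)
  also have "(fop (\<lambda>t. 1) (\<lambda>t. ?G t + 1 * deriv ?h t / ?h t) ^^ n) w z
      = (fop (\<lambda>t. 1) (\<lambda>t. Qn n F (t, w t)) ^^ n) w z"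
  proof (rule fop_iter_cong[OF I(1) _ _ _ z])
    fix t assume t: "t \<in> I"
    have "deriv ?h t = of_nat (n - 1) * l t ^ (n - 1 - 1) * k4 * R t + l t ^ (n - 1) * deriv R t"
      by (rule DERIV_imp_deriv)
        (auto intro!: derivative_eq_intros dl smooth_on_deriv_has_derivative[OF sR t])
    moreover obtain m where "n = Suc m" using n by (cases n) auto
    ultimately have e1: "deriv ?h t / ?h t = (real n - 1) * k4 / l t + deriv R t / R t"
      using l0[OF t] by (cases m) (auto simp: field_simps)
    have e2: "((real n - 1) / 2) * (partial1 (partial1 \<rho>) (t, w t) / partial1 \<rho> (t, w t)) = - (real n - 1) * k4 / l t"
      unfolding partials(1,5)[OF IU[OF t]]
      using l0[OF t] \<Delta> by (simp add: field_simps power2_eq_square power3_eq_cube)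
    have e3: "Qn n F (t, w t) = F (\<rho> (t, w t), R t * w t) * partial1 \<rho> (t, w t) + deriv R t / R t
        - (- (real n - 1) * k4 / l t)"
      by (simp only: Qn_def prod.case e2)
    show "?G t + 1 * deriv ?h t / ?h t = Qn n F (t, w t)"
      unfolding e3 mult_1 e1 partials(1)[OF IU[OF t]] on_U(4)[OF IU[OF t]]
      by (simp add: divide_inverse algebra_simps)
  qed auto
  also have "(1 / \<Delta>) ^ n * l z ^ (n + 1) * (?h z * (fop (\<lambda>t. 1) (\<lambda>t. Qn n F (t, w t)) ^^ n) w z)
      = R z * l z ^ (2 * n) / \<Delta> ^ n * Omega_iter n (Qn n F) w z"
  proof -
    have "l z ^ (n + 1) * l z ^ (n - 1) = l z ^ (2 * n)"
      unfolding power_add[symmetric] using n by (simp add: mult_2)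
    moreover have "(1 / \<Delta>) ^ n * l z ^ (n + 1) * (?h z * x)
        = R z * (l z ^ (n + 1) * l z ^ (n - 1)) / \<Delta> ^ n * x" for x
      by (simp add: power_one_over field_simps)
    ultimately show ?thesis by (simp only: Omega_iter_eq_fop)
  qed
  finally show ?thesis .
qed

lemma parameter_function_projective:
  assumes n: "n \<ge> 1"
  shows "parameter_function n P \<rho> \<psi> F (Qn n F)"
proof -
  let ?\<mu> = "\<lambda>j::nat \<Rightarrow> real. R (j 0) * l (j 0) ^ (2 * n) / \<Delta> ^ n"
  have "jet_smooth_on (n + 2) (jets_over P \<rho>) ?\<mu>"
  proof -
    define T where "T = (fst :: real \<times> real \<times> real \<Rightarrow> real) -` (fst ` U)"
    have T: "open T" unfolding T_def by (intro open_vimage open_K continuous_intros)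
    have "smooth_on T (\<lambda>x. R (fst x))"
      by (rule smooth_on_compose[OF R T open_K]) (auto simp: T_def intro!: smooth_on_fst smooth_on_ident T[unfolded T_def])
    then have "smooth_on T (\<lambda>x. R (fst x) * l (fst x) ^ (2 * n) / \<Delta> ^ n)"
      unfolding l_def using \<Delta> by (intro smooth_on_intros T) auto
    from jet_smooth_on_first_order[OF T this, of "jets_over P \<rho>" "n + 2"]
    show ?thesis by (force simp: jets_over_def T_def)
  qed
  moreover have "?\<mu> j \<noteq> 0" if "j \<in> jets_over P \<rho>" for j
    using that on_U(1,2) \<Delta> by (auto simp: jets_over_def)
  moreover have "Omega_iter n F y (\<rho> (z, w z)) = ?\<mu> (jet n w z) * Omega_iter n (Qn n F) w z"
    if c: "transformed_curve P \<rho> \<psi> I w y" and z: "z \<in> I" for I w y z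
  proof -
    have "Omega_iter n F y (\<rho> (z, w z)) = pullback n F \<rho> \<psi> w z"
      by (rule transformed_curve_Omega_iter[OF c _ V F _ z]) auto
    also have "\<dots> = R z * l z ^ (2 * n) / \<Delta> ^ n * Omega_iter n (Qn n F) w z"
      by (rule pullback_projective[OF n _ _ _ z]) (use c in \<open>auto simp: transformed_curve_def\<close>)
    finally show ?thesis by (simp add: jet_def)
  qed
  ultimately show ?thesis
    unfolding parameter_function_def by (intro conjI smooth_Qn exI[of _ ?\<mu>]) blast+
qed

end

lemma equivalence_transformation:
  assumes "n \<ge> 1" shows "equivalence_transformation n U \<rho> \<psi>"
  unfolding equivalence_transformation_def
proof (intro conjI allI impI point_transformation)
  fix V F p
  assume a: "open V \<and> smooth_on V F \<and> p \<in> U \<and> (\<rho> p, \<psi> p) \<in> V \<and> snd p \<noteq> 0 \<and> solvable_at n U \<rho> \<psi> F p"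
  let ?D = "{p \<in> U. (\<rho> p, \<psi> p) \<in> V}"
  have "open ?D" "parameter_function n ?D \<rho> \<psi> F (Qn n F)"
    using open_preimage_map[of V] parameter_function_projective[of V F n] a assms by auto
  then show "\<exists>D Q. open D \<and> p \<in> D \<and> D \<subseteq> U \<and> (\<lambda>q. (\<rho> q, \<psi> q)) ` D \<subseteq> V \<and> parameter_function n D \<rho> \<psi> F Q"
    using a by (intro exI[of _ ?D] exI[of _ "Qn n F"]) auto
qed

end

section \<open>Families of steep curves\<close>

text \<open>
  The analogue of \<^const>\<open>fop\<close> for functions of \<open>(\<epsilon>, \<kappa>, s)\<close>, where \<open>\<epsilon>\<close> and \<open>\<kappa>\<close> are parameters of a
  family of curves and \<open>s\<close> is the variable of differentiation. Its iterates depend continuously on the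
  parameters.
\<close>

definition pop :: "(real \<times> real \<times> real \<Rightarrow> real) \<Rightarrow> (real \<times> real \<times> real \<Rightarrow> real) \<Rightarrow> (real \<times> real \<times> real \<Rightarrow> real) \<Rightarrow>
    real \<times> real \<times> real \<Rightarrow> real" where
  "pop A B u = (\<lambda>x. A x * frechet_derivative u (at x) (0, 0, 1) + B x * u x)"

lemma pop_iter_Suc:
  "(pop A B ^^ Suc k) u x = A x * frechet_derivative ((pop A B ^^ k) u) (at x) (0, 0, 1) + B x * (pop A B ^^ k) u x"
  by (simp add: pop_def)

lemma smooth_on_pop_iter:
  assumes "open S" "smooth_on S A" "smooth_on S B" "smooth_on S u"
  shows "smooth_on S ((pop A B ^^ k) u)"
  by (induction k)
    (auto simp: pop_def intro!: smooth_on_add smooth_on_mult smooth_on_frechet_derivative assms)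

lemma open_line: "open T \<Longrightarrow> open {s. (e, k, s) \<in> T}" for T :: "(real \<times> real \<times> real) set"
  using open_vimage[of T "\<lambda>s. (e, k, s)"] by (simp add: vimage_def continuous_intros)

lemma smooth_on_line:
  fixes T :: "(real \<times> real \<times> real) set"
  assumes "open T" "smooth_on T u"
  shows "smooth_on {s. (e, k, s) \<in> T} (\<lambda>s. u (e, k, s) :: real)"
  using smooth_on_compose[OF assms(2) open_line[OF assms(1)] assms(1), where g = "\<lambda>s. (e, k, s)"]
  by (simp add: smooth_on_intros open_line assms(1))

lemma pop_iter_eq_fop:
  assumes T: "open T" "smooth_on T A" "smooth_on T B" "smooth_on T u" and s: "(e, k, s) \<in> T"
  shows "(pop A B ^^ n) u (e, k, s) = (fop (\<lambda>s. A (e, k, s)) (\<lambda>s. B (e, k, s)) ^^ n) (\<lambda>s. u (e, k, s)) s"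
  using s
proof (induction n arbitrary: s)
  case (Suc n)
  let ?v = "(pop A B ^^ n) u" and ?f = "(fop (\<lambda>s. A (e, k, s)) (\<lambda>s. B (e, k, s)) ^^ n) (\<lambda>s. u (e, k, s))"
  have "((\<lambda>s. ?v (e, k, s)) has_real_derivative frechet_derivative ?v (at (e, k, s)) (0, 0, 1)) (at s)"
    by (rule has_real_derivative_line[OF smooth_on_pop_iter[OF T] Suc.prems]) auto
  then have "frechet_derivative ?v (at (e, k, s)) (0, 0, 1) = deriv (\<lambda>s. ?v (e, k, s)) s"
    by (rule DERIV_imp_deriv[symmetric])
  also have "\<dots> = deriv ?f s"
    using Suc by (intro deriv_cong_on_open[OF open_line[OF T(1)]]) auto
  finally show ?case using Suc by (simp add: pop_iter_Suc fop_iter_Suc del: funpow.simps)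
qed simp

lemma fop_iter_rescale_scale:
  assumes S: "open S" and A: "smooth_on S A" and B: "smooth_on S B" and u: "smooth_on S u"
    and e: "e \<noteq> 0" and c: "c \<noteq> 0" and S0: "0 \<in> S"
  shows "(fop (\<lambda>t. e * (A ((t - t0) / e) / c)) (\<lambda>t. B ((t - t0) / e)) ^^ n) (\<lambda>t. u ((t - t0) / e)) t0
    = (1 / c) ^ n * (fop A (\<lambda>s. c * B s) ^^ n) u 0"
proof -
  have "(fop (\<lambda>t. e * (A ((t - t0) / e) / c)) (\<lambda>t. B ((t - t0) / e)) ^^ n) (\<lambda>t. u ((t - t0) / e)) t0
      = (fop (\<lambda>s. A s / c) B ^^ n) u ((t0 - t0) / e)"
    by (rule fop_iter_rescale[OF S _ B u e]) (use S0 c in \<open>auto intro!: smooth_on_intros S A\<close>)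
  also have "\<dots> = (fop (\<lambda>s. 1 / c * A s) (\<lambda>s. 1 / c * (c * B s)) ^^ n) u 0"
    using c by simp
  also have "\<dots> = (1 / c) ^ n * (fop A (\<lambda>s. c * B s) ^^ n) u 0"
    by (rule fop_iter_scale[OF S A _ u S0]) (intro smooth_on_intros S B)
  finally show ?thesis .
qed

context smooth_map
begin

text \<open>
  The curves \<open>w = b((z - z\<^sub>0)/\<epsilon>) + \<kappa> ((z - z\<^sub>0)/\<epsilon>)\<^sup>n\<close> become vertical as \<open>\<epsilon>\<close> tends to \<open>0\<close>. After
  multiplication by \<open>\<epsilon>\<^sup>n\<close> the transformed equation tends to the vanishing of the \<open>n\<close>-th derivative of
  \<open>b + \<kappa> s\<^sup>n\<close>, which does not involve \<open>Q\<close> any more. Hence \<open>\<kappa>\<close> can be chosen as a function of \<open>\<epsilon>\<close>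
  tending to \<open>0\<close> such that the transformed equation holds exactly, by the intermediate value theorem,
  and the limit of the original equation along these curves is a condition on the transformation
  that is free of \<open>Q\<close>. The function \<open>A\<close> is the reciprocal of \<open>dx/ds\<close> up to a power of \<open>\<epsilon>\<close>.
\<close>

lemma steep_limit:
  fixes A :: "real \<times> real \<times> real \<Rightarrow> real" and b :: "real \<Rightarrow> real" and z0 :: real and n a :: nat
  defines "Z \<equiv> \<lambda>x::real\<times>real\<times>real. z0 + fst x * snd (snd x)"
  assumes n: "n \<ge> 1" and V: "open V" "smooth_on V F"
    and D: "open D" "D \<subseteq> U" "(\<lambda>q. (\<rho> q, \<psi> q)) ` D \<subseteq> V" and pf: "parameter_function n D \<rho> \<psi> F Q"
    and b: "smooth_on UNIV b" "(deriv ^^ n) b 0 = 0"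
  defines "W \<equiv> \<lambda>x::real\<times>real\<times>real. b (snd (snd x)) + fst (snd x) * snd (snd x) ^ n"
  assumes T: "open T" "(0, 0, 0) \<in> T" "\<And>x. x \<in> T \<Longrightarrow> (Z x, W x) \<in> D"
    and A: "smooth_on T A" "\<And>x. x \<in> T \<Longrightarrow> A x * (fst x * partial1 \<rho> (Z x, W x)
      + (deriv b (snd (snd x)) + fst (snd x) * (of_nat n * snd (snd x) ^ (n - 1))) * partial2 \<rho> (Z x, W x)) = fst x ^ a"
  shows "(fop (\<lambda>s. A (0, 0, s)) (\<lambda>s. 0 ^ a * F (\<rho> (z0, b s), \<psi> (z0, b s))) ^^ n) (\<lambda>s. \<psi> (z0, b s)) 0 = 0"
proof -
  have Q: "smooth_on D Q" using pf by (simp add: parameter_function_def)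
  have sZW: "smooth_on T (\<lambda>x. (Z x, W x))"
  proof -
    have i: "smooth_on T (\<lambda>x. x)" by (rule smooth_on_ident[OF T(1)])
    have s: "smooth_on T (\<lambda>x. snd (snd x))" "smooth_on T (\<lambda>x. fst x)" "smooth_on T (\<lambda>x. fst (snd x))"
      by (intro smooth_on_snd smooth_on_fst i T(1))+
    have "smooth_on T (\<lambda>x. b (snd (snd x)))"
      by (rule smooth_on_compose[OF b(1) T(1) open_UNIV s(1)]) auto
    then show ?thesis
      unfolding Z_def W_def
      by (intro smooth_on_Pair smooth_on_add smooth_on_mult smooth_on_power smooth_on_const T(1) s)
  qed
  have sD: "smooth_on T (\<lambda>x. f (Z x, W x))" if "smooth_on D f" for f :: "real \<times> real \<Rightarrow> real"
    by (rule smooth_on_compose[OF that T(1) D(1) sZW T(3)])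
  have sF: "smooth_on T (\<lambda>x. F (\<rho> (Z x, W x), \<psi> (Z x, W x)))"
  proof (rule sD)
    show "smooth_on D (\<lambda>q. F (\<rho> q, \<psi> q))"
      by (rule smooth_on_compose[OF V(2) D(1) V(1)])
        (use D in \<open>auto intro!: smooth_on_Pair smooth_on_subset[OF smooth_\<rho>] smooth_on_subset[OF smooth_\<psi>]\<close>)
  qed
  have s\<psi>: "smooth_on T (\<lambda>x. \<psi> (Z x, W x))" by (rule sD[OF smooth_on_subset[OF smooth_\<psi> D(2)]])
  have sW: "smooth_on T W" using smooth_on_snd[OF T(1) sZW] by simp
  have se: "smooth_on T (\<lambda>x. fst x ^ m)" for m
    by (intro smooth_on_power smooth_on_fst smooth_on_ident T(1))
  define BH where "BH = (\<lambda>x. fst x ^ a * F (\<rho> (Z x, W x), \<psi> (Z x, W x)))"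
  define BG where "BG = (\<lambda>x. fst x ^ 1 * Q (Z x, W x))"
  have sBH: "smooth_on T BH" unfolding BH_def by (intro smooth_on_mult T(1) se sF)
  have sBG: "smooth_on T BG" unfolding BG_def by (intro smooth_on_mult T(1) se sD Q)
  have s1: "smooth_on T (\<lambda>x. 1 :: real)" by (rule smooth_on_const[OF T(1)])
  define H where "H = (pop A BH ^^ n) (\<lambda>x. \<psi> (Z x, W x))"
  define G where "G = (pop (\<lambda>x. 1) BG ^^ n) W"
  have sH: "smooth_on T H" unfolding H_def by (rule smooth_on_pop_iter[OF T(1) A(1) sBH s\<psi>])
  have sG: "smooth_on T G" unfolding G_def by (rule smooth_on_pop_iter[OF T(1) s1 sBG sW])

  \<comment> \<open>\<open>H\<close> and \<open>G\<close> are the original and the transformed equation along the curves, rescaled so that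
    they extend to \<open>\<epsilon> = 0\<close>.\<close>
  have G0: "G (0, k, 0) = k * fact n" if "(0, k, 0) \<in> T" for k
  proof -
    have "G (0, k, 0) = (fop (\<lambda>s. 1) (\<lambda>s. BG (0, k, s)) ^^ n) (\<lambda>s. W (0, k, s)) 0"
      unfolding G_def by (rule pop_iter_eq_fop[OF T(1) s1 sBG sW that])
    also have "\<dots> = (fop (\<lambda>s. 1) (\<lambda>s. 0) ^^ n) (\<lambda>s. 1 * b s + k * (s ^ n * 1)) 0"
      by (simp add: BG_def W_def)
    also have "\<dots> = 1 * (fop (\<lambda>s. 1) (\<lambda>s. 0) ^^ n) b 0 + k * (fop (\<lambda>s. 1) (\<lambda>s. 0) ^^ n) (\<lambda>s. s ^ n * 1) 0"
      by (rule fop_iter_linear[OF open_UNIV]) (auto intro!: smooth_on_intros b)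
    also have "(fop (\<lambda>s. 1) (\<lambda>s. 0) ^^ n) (\<lambda>s. s ^ n * 1) (0::real) = fact n"
      by (subst fop_iter_coordinate_power[OF open_UNIV]) (auto intro!: smooth_on_intros)
    finally show ?thesis using b(2) by (simp add: deriv_iter_eq_fop)
  qed

  have iff: "H (e, k, 0) = 0 \<longleftrightarrow> G (e, k, 0) = 0" if e: "e \<noteq> 0" and x: "(e, k, 0) \<in> T" for e k
  proof -
    let ?S = "{s. (e, k, s) \<in> T}"
    let ?\<tau> = "\<lambda>t. (t - z0) / e"
    have S: "open ?S" "0 \<in> ?S" using open_line[OF T(1)] x by auto
    define w where "w t = W (e, k, ?\<tau> t)" for t
    have ZW: "Z (e, k, ?\<tau> t) = t" for t using e by (simp add: Z_def)
    define w' where "w' s = deriv b s + k * (of_nat n * s ^ (n - 1))" for s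
    have dw: "(w has_real_derivative w' (?\<tau> t) / e) (at t)" for t
    proof -
      have 1: "((\<lambda>s. b s + k * s ^ n) has_real_derivative w' s) (at s)" for s
        unfolding w'_def
        by (auto intro!: derivative_eq_intros smooth_on_deriv_has_derivative[OF b(1)])
      have 2: "(?\<tau> has_real_derivative 1 / e) (at t)" using e by (auto intro!: derivative_eq_intros)
      from DERIV_chain2[where f = "\<lambda>s. b s + k * s ^ n" and g = ?\<tau>, OF 1 2]
      show ?thesis by (simp add: w_def[abs_def] W_def)
    qed
    have sw: "smooth_on UNIV w"
      unfolding w_def[abs_def] W_def fst_conv snd_conv
      by (intro smooth_on_add smooth_on_mult smooth_on_power smooth_on_const open_UNIV
          smooth_on_compose[OF b(1) open_UNIV open_UNIV]) (use e in \<open>auto intro!: smooth_on_intros\<close>)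
    have wD: "(t, w t) \<in> D" if "?\<tau> t \<in> ?S" for t
      using T(3)[of "(e, k, ?\<tau> t)"] that ZW by (simp add: w_def)
    have z0D: "(z0, w z0) \<in> D" using wD[of z0] x by simp
    have X': "e * (A (e, k, ?\<tau> t) / e ^ a) = 1 / deriv (\<lambda>t. \<rho> (t, w t)) t"
      "deriv (\<lambda>t. \<rho> (t, w t)) t \<noteq> 0" if "?\<tau> t \<in> ?S" for t
    proof -
      have "(t, w t) \<in> U" using wD[OF that] D by auto
      from deriv_along[OF smooth_\<rho> dw this]
      have d: "deriv (\<lambda>t. \<rho> (t, w t)) t * e = e * partial1 \<rho> (t, w t) + w' (?\<tau> t) * partial2 \<rho> (t, w t)"
        using e by (simp add: field_simps)
      have "A (e, k, ?\<tau> t) * (e * partial1 \<rho> (t, w t) + w' (?\<tau> t) * partial2 \<rho> (t, w t)) = e ^ a"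
        using A(2)[of "(e, k, ?\<tau> t)"] that ZW by (simp add: w_def w'_def)
      then have eq: "A (e, k, ?\<tau> t) * (deriv (\<lambda>t. \<rho> (t, w t)) t * e) = e ^ a" by (simp only: d)
      then show "deriv (\<lambda>t. \<rho> (t, w t)) t \<noteq> 0" using e by auto
      then show "e * (A (e, k, ?\<tau> t) / e ^ a) = 1 / deriv (\<lambda>t. \<rho> (t, w t)) t"
        using eq e by (simp add: field_simps)
    qed
    have "continuous_on UNIV ?\<tau>" by (intro continuous_intros) (use e in auto)
    then have S': "open {t. ?\<tau> t \<in> ?S}" "z0 \<in> {t. ?\<tau> t \<in> ?S}"
      using open_vimage[OF S(1), of ?\<tau>] S(2) by (auto simp: vimage_def)
    note line = smooth_on_line[OF T(1)]
    have "pullback n F \<rho> \<psi> w z0 =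
       (fop (\<lambda>t. e * (A (e, k, ?\<tau> t) / e ^ a)) (\<lambda>t. F (\<rho> (Z (e, k, ?\<tau> t), W (e, k, ?\<tau> t)), \<psi> (Z (e, k, ?\<tau> t), W (e, k, ?\<tau> t)))) ^^ n)
         (\<lambda>t. \<psi> (Z (e, k, ?\<tau> t), W (e, k, ?\<tau> t))) z0"
      unfolding pullback_def
      by (rule fop_iter_cong[OF S'(1) _ _ _ S'(2)]) (use X' ZW in \<open>simp_all add: w_def\<close>)
    also have "\<dots> = (1 / e ^ a) ^ n * (fop (\<lambda>s. A (e, k, s)) (\<lambda>s. e ^ a * F (\<rho> (Z (e, k, s), W (e, k, s)), \<psi> (Z (e, k, s), W (e, k, s)))) ^^ n)
         (\<lambda>s. \<psi> (Z (e, k, s), W (e, k, s))) 0"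
      by (rule fop_iter_rescale_scale[OF S(1) line[OF A(1)] line[OF sF] line[OF s\<psi>] e _ S(2)]) (use e in simp)
    also have "(fop (\<lambda>s. A (e, k, s)) (\<lambda>s. e ^ a * F (\<rho> (Z (e, k, s), W (e, k, s)), \<psi> (Z (e, k, s), W (e, k, s)))) ^^ n)
         (\<lambda>s. \<psi> (Z (e, k, s), W (e, k, s))) 0 = H (e, k, 0)"
      unfolding H_def by (subst pop_iter_eq_fop[OF T(1) A(1) sBH s\<psi> x]) (simp add: BH_def)
    finally have H: "pullback n F \<rho> \<psi> w z0 = (1 / e ^ a) ^ n * H (e, k, 0)" .
    have "Omega_iter n Q w z0 =
       (fop (\<lambda>t. e * (1 / e)) (\<lambda>t. Q (Z (e, k, ?\<tau> t), W (e, k, ?\<tau> t))) ^^ n) (\<lambda>t. W (e, k, ?\<tau> t)) z0"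
      unfolding Omega_iter_eq_fop
      by (rule fop_iter_cong[OF S'(1) _ _ _ S'(2)]) (use ZW e in \<open>simp_all add: w_def\<close>)
    also have "\<dots> = (1 / e) ^ n * (fop (\<lambda>s. 1) (\<lambda>s. e * Q (Z (e, k, s), W (e, k, s))) ^^ n) (\<lambda>s. W (e, k, s)) 0"
      by (rule fop_iter_rescale_scale[OF S(1) smooth_on_const[OF S(1)] line[OF sD[OF Q]] line[OF sW] e e S(2)])
    also have "(fop (\<lambda>s. 1) (\<lambda>s. e * Q (Z (e, k, s), W (e, k, s))) ^^ n) (\<lambda>s. W (e, k, s)) 0 = G (e, k, 0)"
      unfolding G_def by (subst pop_iter_eq_fop[OF T(1) s1 sBG sW x]) (simp add: BG_def)
    finally have G: "Omega_iter n Q w z0 = (1 / e) ^ n * G (e, k, 0)" .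
    have "pullback n F \<rho> \<psi> w z0 = 0 \<longleftrightarrow> Omega_iter n Q w z0 = 0"
      by (rule parameter_function_zero_iff[OF pf n D(1,2) V D(3) open_UNIV sw _ z0D X'(2)]) (use S in auto)
    then show ?thesis using H G e by simp
  qed

  have "H (0, 0, 0) = 0"
  proof (rule ccontr)
    assume H0: "H (0, 0, 0) \<noteq> 0"
    have "open (T \<inter> H -` (- {0}))"
      by (rule continuous_open_preimage[OF smooth_on_continuous[OF sH] T(1)]) auto
    moreover have "(0, 0, 0) \<in> T \<inter> H -` (- {0})" using H0 T(2) by simp
    ultimately obtain r where r: "r > 0" "ball (0, 0, 0) r \<subseteq> T \<inter> H -` (- {0})"
      using open_contains_ball by metis
    have box: "(e, k, 0) \<in> T" "H (e, k, 0) \<noteq> 0" if "\<bar>e\<bar> \<le> r / 3" "\<bar>k\<bar> \<le> r / 3" for e k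
    proof -
      have "norm (e, k, 0::real) \<le> norm e + norm (k, 0::real)" by (rule norm_Pair_le)
      also have "norm (k, 0::real) \<le> norm k + norm (0::real)" by (rule norm_Pair_le)
      finally have "dist (0, 0, 0) (e, k, 0::real) < r"
        using that r(1) by (subst dist_commute) (simp add: dist_norm)
      then show "(e, k, 0) \<in> T" "H (e, k, 0) \<noteq> 0" using r(2) by auto
    qed
    \<comment> \<open>\<open>G\<close> changes its sign between \<open>\<kappa> = - \<eta>\<close> and \<open>\<kappa> = \<eta>\<close> at \<open>\<epsilon> = 0\<close>, hence also for small \<open>\<epsilon> > 0\<close>.\<close>
    define \<eta> where "\<eta> = r / 3"
    have \<eta>: "\<eta> > 0" using r by (simp add: \<eta>_def)
    have cont: "continuous_on {-\<eta>..\<eta>} (\<lambda>e. G (e, k, 0))" "continuous_on {-\<eta>..\<eta>} (\<lambda>e. G (k, e, 0))"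
      if "\<bar>k\<bar> \<le> \<eta>" for k
      using that box unfolding \<eta>_def
      by (intro continuous_on_compose2[OF smooth_on_continuous[OF sG]] continuous_intros; auto)+
    have "isCont (\<lambda>e. G (e, \<eta>, 0)) 0" "isCont (\<lambda>e. G (e, -\<eta>, 0)) 0"
      using cont(1)[of \<eta>] cont(1)[of "-\<eta>"] \<eta>
      by (auto intro!: continuous_on_interior[of "{-\<eta>..\<eta>}"])
    moreover have "G (0, \<eta>, 0) > 0" "G (0, -\<eta>, 0) < 0"
      using \<eta> box[of 0 \<eta>] box[of 0 "-\<eta>"] by (auto simp: G0 \<eta>_def)
    ultimately have "eventually (\<lambda>e. G (e, \<eta>, 0) > 0) (at_right 0)" "eventually (\<lambda>e. G (e, -\<eta>, 0) < 0) (at_right 0)"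
      by (auto simp: isCont_def intro!: order_tendstoD[OF tendsto_within_subset])
    moreover have "eventually (\<lambda>e::real. e < \<eta>) (at_right 0)" "eventually (\<lambda>e::real. 0 < e) (at_right 0)"
      using \<eta> by (auto simp: eventually_at_right_field intro: exI[of _ \<eta>])
    ultimately have "eventually (\<lambda>e. G (e, \<eta>, 0) > 0 \<and> G (e, -\<eta>, 0) < 0 \<and> e < \<eta> \<and> 0 < e) (at_right 0)"
      by eventually_elim auto
    then obtain e where e: "G (e, \<eta>, 0) > 0" "G (e, -\<eta>, 0) < 0" "e < \<eta>" "0 < e"
      using eventually_happens'[OF trivial_limit_at_right_real] by blast
    obtain k where k: "-\<eta> \<le> k" "k \<le> \<eta>" "G (e, k, 0) = 0"
      using IVT'[of "\<lambda>k. G (e, k, 0)" "-\<eta>" 0 \<eta>] e \<eta> cont(2)[of e] by auto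
    have "\<bar>e\<bar> \<le> r / 3" "\<bar>k\<bar> \<le> r / 3" using k(1,2) e(3,4) by (simp_all add: \<eta>_def abs_le_iff)
    from box[OF this] show False using iff[of e k] k(3) e(4) by simp
  qed
  moreover have "H (0, 0, 0) = (fop (\<lambda>s. A (0, 0, s)) (\<lambda>s. 0 ^ a * F (\<rho> (z0, b s), \<psi> (z0, b s))) ^^ n) (\<lambda>s. \<psi> (z0, b s)) 0"
    unfolding H_def by (subst pop_iter_eq_fop[OF T(1) A(1) sBH s\<psi> T(2)]) (simp add: BH_def Z_def W_def)
  ultimately show ?thesis by simp
qed

end

section \<open>Polynomial gauges\<close>

text \<open>
  A function \<open>r\<close> with \<open>r(x\<^sub>0) = 1\<close> and prescribed Taylor coefficients of order \<open>n - 1\<close> and \<open>n\<close>. The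
  parameter functions \<open>r'/r\<close> suffice as test equations.
\<close>

definition gauge_poly :: "nat \<Rightarrow> real \<Rightarrow> real \<Rightarrow> real \<Rightarrow> real \<Rightarrow> real" where
  "gauge_poly n x0 c l x = 1 + c * (x - x0) ^ (n - 1) + l * (x - x0) ^ n"

definition gauge_F :: "nat \<Rightarrow> real \<Rightarrow> real \<Rightarrow> real \<Rightarrow> real \<times> real \<Rightarrow> real" where
  "gauge_F n x0 c l = (\<lambda>p. deriv (gauge_poly n x0 c l) (fst p) / gauge_poly n x0 c l (fst p))"

definition gauge_V :: "nat \<Rightarrow> real \<Rightarrow> real \<Rightarrow> real \<Rightarrow> (real \<times> real) set" where
  "gauge_V n x0 c l = {p. gauge_poly n x0 c l (fst p) \<noteq> 0}"

lemma smooth_gauge_poly: "open S \<Longrightarrow> smooth_on S (gauge_poly n x0 c l)"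
  unfolding gauge_poly_def[abs_def] by (intro smooth_on_intros)

lemma gauge_poly_base: "n \<ge> 2 \<Longrightarrow> gauge_poly n x0 c l x0 = 1"
  by (simp add: gauge_poly_def power_0_left)

lemma open_gauge_V: "open (gauge_V n x0 c l)"
proof -
  have "continuous_on UNIV (\<lambda>p::real\<times>real. gauge_poly n x0 c l (fst p))"
    unfolding gauge_poly_def by (intro continuous_intros)
  from open_vimage[OF _ this, of "- {0}"]
  show ?thesis by (simp add: gauge_V_def vimage_def open_Compl Compl_eq[symmetric])
qed

lemma smooth_gauge_F: "smooth_on (gauge_V n x0 c l) (gauge_F n x0 c l)"
proof -
  let ?V = "gauge_V n x0 c l" and ?r = "gauge_poly n x0 c l"
  have c: "smooth_on ?V (\<lambda>p. f (fst p))" if "smooth_on UNIV f" for f :: "real \<Rightarrow> real"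
    by (rule smooth_on_compose[OF that open_gauge_V open_UNIV
        smooth_on_fst[OF open_gauge_V smooth_on_ident[OF open_gauge_V]]]) simp
  show ?thesis
    unfolding gauge_F_def
    by (rule smooth_on_divide[OF open_gauge_V c[OF smooth_on_deriv[OF open_UNIV smooth_gauge_poly[OF open_UNIV]]]
          c[OF smooth_gauge_poly[OF open_UNIV]]]) (simp add: gauge_V_def)
qed

text \<open>For \<open>F = r'(x)/r(x)\<close> one has \<open>\<Omega>\<^sub>F\<^sup>n[y] = (r y)\<^sup>(\<^sup>n\<^sup>)/r\<close>.\<close>

lemma fop_iter_gauge_F:
  assumes S: "open S" and A: "smooth_on S A" and X: "smooth_on S X" "\<And>t. t \<in> S \<Longrightarrow> A t * deriv X t = 1"
    and u: "smooth_on S u" and t: "t \<in> S" and V: "\<And>t. t \<in> S \<Longrightarrow> (X t, Y t) \<in> gauge_V n x0 c l"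
  shows "(fop A (\<lambda>t. 0) ^^ k) (\<lambda>t. gauge_poly n x0 c l (X t) * u t) t
    = gauge_poly n x0 c l (X t) * (fop A (\<lambda>t. gauge_F n x0 c l (X t, Y t)) ^^ k) u t"
proof -
  let ?r = "gauge_poly n x0 c l"
  let ?B = "\<lambda>t. 0::real"
  have B: "smooth_on S ?B" by (rule smooth_on_const[OF S])
  have rX: "smooth_on S (\<lambda>t. ?r (X t))"
    by (rule smooth_on_compose[OF smooth_gauge_poly[OF open_UNIV] S open_UNIV X(1)]) auto
  have d: "deriv (\<lambda>t. ?r (X t)) t = deriv ?r (X t) * deriv X t" if "t \<in> S" for t
    by (intro DERIV_imp_deriv DERIV_chain2[where f = ?r]
        smooth_on_deriv_has_derivative[OF smooth_gauge_poly[OF open_UNIV] UNIV_I]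
        smooth_on_deriv_has_derivative[OF X(1) that])
  have r0: "?r (X t) \<noteq> 0" if "t \<in> S" for t using V[OF that] by (simp add: gauge_V_def)
  have "(fop A ?B ^^ k) (\<lambda>t. ?r (X t) * u t) t
      = ?r (X t) * (fop A (\<lambda>t. ?B t + A t * deriv (\<lambda>t. ?r (X t)) t / ?r (X t)) ^^ k) u t"
    by (rule fop_iter_gauge[OF S A B rX r0 u t])
  also have "(fop A (\<lambda>t. ?B t + A t * deriv (\<lambda>t. ?r (X t)) t / ?r (X t)) ^^ k) u t
      = (fop A (\<lambda>t. gauge_F n x0 c l (X t, Y t)) ^^ k) u t"
  proof (rule fop_iter_cong[OF S _ _ _ t])
    fix t assume "t \<in> S"
    then have "A t * deriv (\<lambda>t. ?r (X t)) t = deriv ?r (X t)" using d X(2) by (simp add: mult.left_commute)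
    then show "?B t + A t * deriv (\<lambda>t. ?r (X t)) t / ?r (X t) = gauge_F n x0 c l (X t, Y t)"
      by (simp add: gauge_F_def)
  qed auto
  finally show ?thesis .
qed

text \<open>
  The two highest Taylor coefficients of \<open>r\<close> contribute multiples of \<open>y'\<close> and of \<open>y\<close> at the base point.
\<close>

lemma fop_iter_gauge_F_base:
  assumes S: "open S" and A: "smooth_on S A" and X: "smooth_on S X" "\<And>t. t \<in> S \<Longrightarrow> A t * deriv X t = 1"
    and u: "smooth_on S u" and t: "t0 \<in> S" and n: "n \<ge> 2"
    and V: "\<And>t. t \<in> S \<Longrightarrow> (X t, Y t) \<in> gauge_V n (X t0) c l"
  shows "(fop A (\<lambda>t. gauge_F n (X t0) c l (X t, Y t)) ^^ n) u t0
    = (fop A (\<lambda>t. 0) ^^ n) u t0 + c * fact n * (A t0 * deriv u t0) + l * fact n * u t0"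
proof -
  let ?r = "gauge_poly n (X t0) c l"
  let ?B = "\<lambda>t. 0::real"
  have B: "smooth_on S ?B" by (rule smooth_on_const[OF S])
  have p1: "(fop A ?B ^^ n) (\<lambda>t. (X t - X t0) ^ (n - 1) * u t) t0 = fact n * (A t0 * deriv u t0)"
    and p2: "(fop A ?B ^^ n) (\<lambda>t. (X t - X t0) ^ n * u t) t0 = fact n * u t0"
  proof -
    have x: "smooth_on S (\<lambda>t. X t - X t0)" by (intro smooth_on_intros S X)
    have x': "A t * deriv (\<lambda>t. X t - X t0) t = 1" if "t \<in> S" for t
    proof -
      have "((\<lambda>t. X t - X t0) has_real_derivative deriv X t) (at t)"
        by (auto intro!: derivative_eq_intros smooth_on_deriv_has_derivative[OF X(1) that])
      then show ?thesis using X(2)[OF that] by (simp add: DERIV_imp_deriv)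
    qed
    have "n - (n - 1) = 1" using n by simp
    then show "(fop A ?B ^^ n) (\<lambda>t. (X t - X t0) ^ (n - 1) * u t) t0 = fact n * (A t0 * deriv u t0)"
      using fop_iter_coordinate_power[OF S A B u x x' t, of n "n - 1"] by (simp add: fop_def)
    show "(fop A ?B ^^ n) (\<lambda>t. (X t - X t0) ^ n * u t) t0 = fact n * u t0"
      using fop_iter_coordinate_power[OF S A B u x x' t, of n n] by simp
  qed
  have "(fop A (\<lambda>t. gauge_F n (X t0) c l (X t, Y t)) ^^ n) u t0 = (fop A ?B ^^ n) (\<lambda>t. ?r (X t) * u t) t0"
    using fop_iter_gauge_F[OF S A X u t V, of n] gauge_poly_base[OF n] by simp
  also have "(\<lambda>t. ?r (X t) * u t) = (\<lambda>t. 1 * (1 * u t + c * ((X t - X t0) ^ (n - 1) * u t)) + l * ((X t - X t0) ^ n * u t))"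
    by (auto simp: gauge_poly_def algebra_simps)
  also have "(fop A ?B ^^ n) \<dots> t0 = (fop A ?B ^^ n) u t0
      + c * (fop A ?B ^^ n) (\<lambda>t. (X t - X t0) ^ (n - 1) * u t) t0 + l * (fop A ?B ^^ n) (\<lambda>t. (X t - X t0) ^ n * u t) t0"
    by (subst fop_iter_linear[OF S A B _ _ t], intro smooth_on_intros S u X, intro smooth_on_intros S u X,
        subst fop_iter_linear[OF S A B u _ t], intro smooth_on_intros S u X) simp
  finally show ?thesis unfolding p1 p2 by simp
qed

subsection \<open>Iterated derivatives at the origin\<close>

lemma deriv_iter_const: "(deriv ^^ k) (\<lambda>t. c :: real) = (\<lambda>t. if k = 0 then c else 0)"
  by (induction k) simp_all

lemma deriv_iter_Suc_right: "(deriv ^^ Suc k) f = (deriv ^^ k) (deriv f)"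
  by (simp only: funpow_Suc_right o_apply)

lemma deriv_iter_linear:
  fixes u v :: "real \<Rightarrow> real"
  shows "open S \<Longrightarrow> smooth_on S u \<Longrightarrow> smooth_on S v \<Longrightarrow> t \<in> S \<Longrightarrow>
    (deriv ^^ k) (\<lambda>t. a * u t + b * v t) t = a * (deriv ^^ k) u t + b * (deriv ^^ k) v t"
  unfolding deriv_iter_eq_fop by (rule fop_iter_linear) (auto intro: smooth_on_const)

lemma deriv_iter_power_mult:
  fixes u :: "real \<Rightarrow> real"
  assumes S: "open S" "smooth_on S u" "t0 \<in> S"
  shows "(deriv ^^ k) (\<lambda>s. (s - t0) ^ m * u s) t0 = (if m \<le> k then fact k / fact (k - m) * (deriv ^^ (k - m)) u t0 else 0)"
proof -
  have "deriv (\<lambda>s. s - t0) t = 1" for t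
    by (rule DERIV_imp_deriv) (auto intro!: derivative_eq_intros)
  then show ?thesis
    unfolding deriv_iter_eq_fop
    using fop_iter_coordinate_power[OF S(1) smooth_on_const[OF S(1)] smooth_on_const[OF S(1)] S(2),
        where x = "\<lambda>s. s - t0" and t = t0 and k = k and m = m] S
    by (simp add: smooth_on_diff smooth_on_ident smooth_on_const)
qed

text \<open>
  These curves have a vanishing \<open>n\<close>-th derivative, as required of \<open>b\<close> in \<open>steep_limit\<close>, and are
  otherwise free in orders \<open>1\<close> and \<open>n - 1\<close>.
\<close>

lemma deriv_iter_probe:
  assumes "n \<ge> 2"
  shows "(deriv ^^ n) (\<lambda>s::real. w0 + (s + c * s ^ (n - 1))) 0 = 0"
proof -
  have eq: "(\<lambda>s::real. w0 + (s + c * s ^ (n - 1))) = (\<lambda>s. w0 * 1 + 1 * (1 * ((s - 0) ^ 1 * 1) + c * ((s - 0) ^ (n - 1) * 1)))"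
    by auto
  show ?thesis
    unfolding eq using assms
    by (subst deriv_iter_linear[OF open_UNIV], (intro smooth_on_intros open_UNIV UNIV_I)+,
        subst deriv_iter_linear[OF open_UNIV], (intro smooth_on_intros open_UNIV UNIV_I)+,
        subst (1 2) deriv_iter_power_mult[OF open_UNIV], (intro smooth_on_intros open_UNIV UNIV_I)+)
      (simp add: deriv_iter_const)
qed

section \<open>Equivalence transformations preserve vertical lines\<close>

locale equiv_transf = point_transf +
  fixes n :: nat
  assumes n: "n \<ge> 2" and conv: "convex U" and equiv: "equivalence_transformation n U \<rho> \<psi>"
begin

lemma ex_parameter_function:
  assumes "open V" "smooth_on V F" "p \<in> U" "(\<rho> p, \<psi> p) \<in> V" "snd p \<noteq> 0" "solvable_at n U \<rho> \<psi> F p"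
  obtains D Q where "open D" "p \<in> D" "D \<subseteq> U" "(\<lambda>q. (\<rho> q, \<psi> q)) ` D \<subseteq> V" "parameter_function n D \<rho> \<psi> F Q"
  using equiv assms unfolding equivalence_transformation_def by meson

lemma partials_of_zero:
  assumes "open N" "p \<in> N" "\<And>q. q \<in> N \<Longrightarrow> f q = 0"
  shows "partial1 f p = 0" "partial2 f p = 0"
proof -
  have N: "open ((\<lambda>t. (t, snd p)) -` N)" "open ((\<lambda>t. (fst p, t)) -` N)"
    by (intro open_vimage assms continuous_intros)+
  have "deriv (\<lambda>t. f (t, snd p)) (fst p) = deriv (\<lambda>t. 0) (fst p)"
    by (rule deriv_cong_on_open[OF N(1)]) (use assms in auto)
  moreover have "deriv (\<lambda>t. f (fst p, t)) (snd p) = deriv (\<lambda>t. 0) (snd p)"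
    by (rule deriv_cong_on_open[OF N(2)]) (use assms in auto)
  ultimately show "partial1 f p = 0" "partial2 f p = 0" by (simp_all add: partial1_def partial2_def)
qed

text \<open>
  The line \<open>w = 0\<close> is nowhere dense, and so is the zero set of \<open>\<psi>\<close>, as the gradient of \<open>\<psi>\<close> does not
  vanish. An identity between continuous functions therefore only has to be shown away from both.
\<close>

lemma ex_generic_point:
  assumes "open N" "N \<subseteq> U" "N \<noteq> {}"
  obtains p where "p \<in> N" "snd p \<noteq> 0" "\<psi> p \<noteq> 0"
proof -
  define N' where "N' = N \<inter> snd -` (- {0})"
  have N': "open N'" unfolding N'_def by (intro open_Int assms open_vimage continuous_intros open_Compl closed_singleton)
  have "N' \<noteq> {}"
  proof
    assume "N' = {}"
    then have z: "\<And>q. q \<in> N \<Longrightarrow> snd q = 0" by (auto simp: N'_def)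
    obtain q where "q \<in> N" using assms by auto
    from partials_of_zero(2)[OF assms(1) this, of snd] z have "partial2 snd q = 0" by blast
    then show False by (simp add: partial2_def)
  qed
  then obtain q where q: "q \<in> N'" by auto
  have "\<exists>p\<in>N'. \<psi> p \<noteq> 0"
  proof (rule ccontr)
    assume "\<not> ?thesis"
    then have "partial1 \<psi> q = 0" "partial2 \<psi> q = 0" using partials_of_zero[OF N' q, of \<psi>] by auto
    then show False using jacobian[of q] q assms(2) by (auto simp: N'_def)
  qed
  then show ?thesis using that by (auto simp: N'_def)
qed

text \<open>
  The highest coefficient of the gauge can be adjusted so that a given curve solves the equation with
  parameter function \<open>r'/r\<close> at a given point.
\<close>

lemma solvable_gauge:
  assumes w: "smooth_on UNIV w" "(z0, w z0) \<in> U" and X': "deriv (\<lambda>t. \<rho> (t, w t)) z0 \<noteq> 0"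
    and \<psi>0: "\<psi> (z0, w z0) \<noteq> 0"
  obtains l where "solvable_at n U \<rho> \<psi> (gauge_F n (\<rho> (z0, w z0)) c l) (z0, w z0)"
    "(fop (\<lambda>t. 1 / deriv (\<lambda>t. \<rho> (t, w t)) t) (\<lambda>t. 0) ^^ n) (\<lambda>t. \<psi> (t, w t)) z0
      + c * fact n * (deriv (\<lambda>t. \<psi> (t, w t)) z0 / deriv (\<lambda>t. \<rho> (t, w t)) z0)
      + l * fact n * \<psi> (z0, w z0) = 0"
proof -
  let ?X = "\<lambda>t. \<rho> (t, w t)" and ?Y = "\<lambda>t. \<psi> (t, w t)"
  let ?A = "\<lambda>t. 1 / deriv ?X t"
  define d where "d = (fop ?A (\<lambda>t. 0) ^^ n) ?Y z0 + c * fact n * (deriv ?Y z0 / deriv ?X z0)"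
  define l where "l = - d / (fact n * \<psi> (z0, w z0))"
  let ?V = "gauge_V n (?X z0) c l" and ?F = "gauge_F n (?X z0) c l"
  have eq: "d + l * fact n * \<psi> (z0, w z0) = 0" using \<psi>0 by (simp add: l_def)
  define S0 where "S0 = {t. (t, w t) \<in> U}"
  have "continuous_on UNIV (\<lambda>t. (t, w t))" by (intro continuous_intros smooth_on_continuous w)
  from open_vimage[OF open_U this] have S0: "open S0" by (simp add: S0_def vimage_def)
  have wS0: "smooth_on S0 w" by (rule smooth_on_subset[OF w(1)]) auto
  have X: "smooth_on S0 ?X" and Y: "smooth_on S0 ?Y"
    by (rule smooth_along[OF _ S0 wS0]; auto simp: S0_def smooth_\<rho> smooth_\<psi>)+
  have "open (S0 \<inter> deriv ?X -` (- {0}))"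
    by (rule continuous_open_preimage[OF smooth_on_continuous[OF smooth_on_deriv[OF S0 X]] S0]) auto
  moreover have "open (S0 \<inter> (\<lambda>t. (?X t, ?Y t)) -` ?V)"
    by (rule continuous_open_preimage[OF smooth_on_continuous[OF smooth_on_Pair[OF S0 X Y]] S0 open_gauge_V])
  ultimately have "open ((S0 \<inter> deriv ?X -` (- {0})) \<inter> (S0 \<inter> (\<lambda>t. (?X t, ?Y t)) -` ?V))"
    by (rule open_Int)
  then obtain S where S: "open S" "S = (S0 \<inter> deriv ?X -` (- {0})) \<inter> (S0 \<inter> (\<lambda>t. (?X t, ?Y t)) -` ?V)" by blast
  have z0V: "(?X z0, ?Y z0) \<in> ?V" using gauge_poly_base[OF n] by (simp add: gauge_V_def)
  have z0: "z0 \<in> S" using w(2) X' z0V by (simp add: S(2) S0_def)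
  have SS0: "S \<subseteq> S0" by (auto simp: S(2))
  have sA: "smooth_on S ?A"
    by (rule smooth_on_divide[OF S(1) smooth_on_const[OF S(1)] smooth_on_subset[OF smooth_on_deriv[OF S0 X] SS0]])
      (auto simp: S(2))
  have "pullback n ?F \<rho> \<psi> w z0 = (fop ?A (\<lambda>t. 0) ^^ n) ?Y z0
      + c * fact n * (?A z0 * deriv ?Y z0) + l * fact n * ?Y z0"
    unfolding pullback_def
    by (rule fop_iter_gauge_F_base[OF S(1) sA smooth_on_subset[OF X SS0] _ smooth_on_subset[OF Y SS0] z0 n])
      (auto simp: S(2))
  then have "pullback n ?F \<rho> \<psi> w z0 = 0" using eq by (simp add: d_def)
  from solvable_atI[OF open_gauge_V smooth_gauge_F z0V open_UNIV w(1) UNIV_I w(2) X' this]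
  have "solvable_at n U \<rho> \<psi> ?F (z0, w z0)" .
  then show ?thesis using that eq unfolding d_def by blast
qed

text \<open>
  If \<open>\<rho>\<^sub>w \<noteq> 0\<close> then vertical lines are mapped to graphs, and by the limit of steep curves the image of
  such a line satisfies the equation for every \<open>F\<close> that admits a solution through the given point.
  For a suitable gauge this determines the slope of all solution curves to be that of the image of
  the vertical line, which contradicts the nonvanishing of the Jacobian.
\<close>

lemma partial2_\<rho>_generic:
  assumes p: "p \<in> U" "snd p \<noteq> 0" "\<psi> p \<noteq> 0"
  shows "partial2 \<rho> p = 0"
proof (rule ccontr)
  assume r2: "partial2 \<rho> p \<noteq> 0"
  obtain z0 w0 where p_def: "p = (z0, w0)" by (cases p)
  \<comment> \<open>The slope of a line along which \<open>x\<close> is a coordinate.\<close>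
  define \<alpha> :: real where "\<alpha> = (if partial1 \<rho> p = 0 then 1 else 0)"
  define w where "w t = w0 + \<alpha> * (t - z0)" for t
  have w0: "w z0 = w0" by (simp add: w_def)
  have sw: "smooth_on UNIV w" unfolding w_def[abs_def] by (intro smooth_on_intros) auto
  have w': "(w has_real_derivative \<alpha>) (at z0)" unfolding w_def[abs_def] by (auto intro!: derivative_eq_intros)
  have U: "(z0, w z0) \<in> U" using p w0 by (simp add: p_def)
  have X': "deriv (\<lambda>t. \<rho> (t, w t)) z0 = partial1 \<rho> p + partial2 \<rho> p * \<alpha>"
    and Y': "deriv (\<lambda>t. \<psi> (t, w t)) z0 = partial1 \<psi> p + partial2 \<psi> p * \<alpha>"
    using deriv_along[OF smooth_\<rho> w' U] deriv_along[OF smooth_\<psi> w' U] w0 by (auto simp: p_def)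
  have X'0: "deriv (\<lambda>t. \<rho> (t, w t)) z0 \<noteq> 0" unfolding X' using r2 by (auto simp: \<alpha>_def)
  define b :: "real \<Rightarrow> real" where "b s = w0 + (s + 0 * s ^ (n - 1))" for s
  have b': "b = (\<lambda>s. w0 + s)" by (auto simp: b_def)
  have db: "(b has_real_derivative 1) (at s)" for s unfolding b' by (auto intro!: derivative_eq_intros)
  have b: "smooth_on UNIV b" "(deriv ^^ n) b 0 = 0"
    using deriv_iter_probe[OF n, of w0 0] unfolding b_def[abs_def] by (auto intro!: smooth_on_intros)
  let ?X = "\<lambda>s. \<rho> (z0, b s)" and ?Y = "\<lambda>s. \<psi> (z0, b s)"
  define e where "e = (fop (\<lambda>s. 1 / partial2 \<rho> (z0, b s)) (\<lambda>t. 0) ^^ n) ?Y 0"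
  have lim: "\<exists>l. (fop (\<lambda>t. 1 / deriv (\<lambda>t. \<rho> (t, w t)) t) (\<lambda>t. 0) ^^ n) (\<lambda>t. \<psi> (t, w t)) z0
      + c * fact n * (deriv (\<lambda>t. \<psi> (t, w t)) z0 / deriv (\<lambda>t. \<rho> (t, w t)) z0) + l * fact n * \<psi> p = 0
      \<and> e + c * fact n * (partial2 \<psi> p / partial2 \<rho> p) + l * fact n * \<psi> p = 0" for c
  proof -
    have \<psi>0: "\<psi> (z0, w z0) \<noteq> 0" using p w0 by (simp add: p_def)
    obtain l where l: "solvable_at n U \<rho> \<psi> (gauge_F n (\<rho> p) c l) p"
      "(fop (\<lambda>t. 1 / deriv (\<lambda>t. \<rho> (t, w t)) t) (\<lambda>t. 0) ^^ n) (\<lambda>t. \<psi> (t, w t)) z0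
      + c * fact n * (deriv (\<lambda>t. \<psi> (t, w t)) z0 / deriv (\<lambda>t. \<rho> (t, w t)) z0) + l * fact n * \<psi> p = 0"
      by (rule solvable_gauge[OF sw U X'0 \<psi>0, of c, unfolded w0, folded p_def])
    let ?V = "gauge_V n (\<rho> p) c l" and ?F = "gauge_F n (\<rho> p) c l"
    have pV: "(\<rho> p, \<psi> p) \<in> ?V" using gauge_poly_base[OF n] by (simp add: gauge_V_def)
    obtain D Q where D: "open D" "p \<in> D" "D \<subseteq> U" "(\<lambda>q. (\<rho> q, \<psi> q)) ` D \<subseteq> ?V" "parameter_function n D \<rho> \<psi> ?F Q"
      by (rule ex_parameter_function[OF open_gauge_V smooth_gauge_F p(1) pV p(2) l(1)])
    let ?Z = "\<lambda>x::real\<times>real\<times>real. z0 + fst x * snd (snd x)"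
    let ?W = "\<lambda>x::real\<times>real\<times>real. b (snd (snd x)) + fst (snd x) * snd (snd x) ^ n"
    let ?Xs = "\<lambda>x::real\<times>real\<times>real. fst x * partial1 \<rho> (?Z x, ?W x)
      + (deriv b (snd (snd x)) + fst (snd x) * (of_nat n * snd (snd x) ^ (n - 1))) * partial2 \<rho> (?Z x, ?W x)"
    define T0 where "T0 = (\<lambda>x. (?Z x, ?W x)) -` D"
    have "continuous_on UNIV (\<lambda>x. (?Z x, ?W x))"
      unfolding b' by (intro continuous_intros)
    then have T0: "open T0" unfolding T0_def by (rule open_vimage[OF D(1)])
    have sm: "smooth_on T0 (\<lambda>x. x)" by (rule smooth_on_ident[OF T0])
    have s: "smooth_on T0 (\<lambda>x. snd (snd x))" "smooth_on T0 (\<lambda>x. fst x)" "smooth_on T0 (\<lambda>x. fst (snd x))"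
      by (intro smooth_on_snd smooth_on_fst sm T0)+
    have sD: "smooth_on T0 (\<lambda>x. f (?Z x, ?W x))" if "smooth_on U f" for f :: "real \<times> real \<Rightarrow> real"
      by (rule smooth_on_compose[OF smooth_on_subset[OF that D(3)] T0 D(1)], unfold b',
          intro smooth_on_Pair smooth_on_add smooth_on_mult smooth_on_power smooth_on_const T0 s)
        (simp add: T0_def b')
    have dbs: "deriv b s = 1" for s by (rule DERIV_imp_deriv[OF db])
    have sXs: "smooth_on T0 ?Xs"
      unfolding dbs
      by (intro smooth_on_add smooth_on_mult smooth_on_power smooth_on_const T0 s sD
          smooth_on_partial1[OF open_U smooth_\<rho>] smooth_on_partial2[OF open_U smooth_\<rho>])
    define T where "T = T0 \<inter> ?Xs -` (- {0})"
    have T: "open T" unfolding T_def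
      by (rule continuous_open_preimage[OF smooth_on_continuous[OF sXs] T0]) auto
    have TT0: "T \<subseteq> T0" by (auto simp: T_def)
    have T000: "(0, 0, 0) \<in> T"
      using D(2) r2 by (simp add: T_def T0_def b' p_def dbs[unfolded b'])
    have sA: "smooth_on T (\<lambda>x. 1 / ?Xs x)"
      by (rule smooth_on_divide[OF T smooth_on_const[OF T] smooth_on_subset[OF sXs TT0]]) (auto simp: T_def)
    have z: "(fop (\<lambda>s. 1 / ?Xs (0, 0, s)) (\<lambda>s. 0 ^ 0 * ?F (\<rho> (z0, b s), \<psi> (z0, b s))) ^^ n) (\<lambda>s. \<psi> (z0, b s)) 0 = 0"
      by (rule steep_limit[OF _ open_gauge_V smooth_gauge_F D(1,3,4,5) b T T000 _ sA])
        (use n in \<open>auto simp: T_def T0_def\<close>)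
    let ?S = "{s. (0, 0, s) \<in> T}"
    have S: "open ?S" "0 \<in> ?S" using open_line[OF T] T000 by auto
    have SD: "(z0, b s) \<in> D" "partial2 \<rho> (z0, b s) \<noteq> 0" if "s \<in> ?S" for s
      using that dbs by (auto simp: T_def T0_def)
    have sbU: "smooth_on ?S (\<lambda>s. f (z0, b s))" if "smooth_on U f" for f :: "real \<times> real \<Rightarrow> real"
      by (rule smooth_on_compose[OF that S(1) open_U])
        (use SD D(3) b in \<open>auto intro!: smooth_on_Pair smooth_on_const S(1) smooth_on_subset[OF b(1)]\<close>)
    have dX: "((\<lambda>s. f (z0, b s)) has_real_derivative partial2 f (z0, b s)) (at s)"
      if "smooth_on U f" "s \<in> ?S" for f s
      using has_real_derivative_along_partial[OF open_U that(1), of "\<lambda>s. z0" 0 s b 1] db SD(1)[OF that(2)] D(3) by auto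
    have "(fop (\<lambda>s. 1 / partial2 \<rho> (z0, b s)) (\<lambda>s. ?F (?X s, ?Y s)) ^^ n) ?Y 0
        = e + c * fact n * (1 / partial2 \<rho> (z0, b 0) * deriv ?Y 0) + l * fact n * ?Y 0"
    proof -
      have "\<rho> p = ?X 0" by (simp add: b' p_def)
      moreover have "(fop (\<lambda>s. 1 / partial2 \<rho> (z0, b s)) (\<lambda>s. gauge_F n (?X 0) c l (?X s, ?Y s)) ^^ n) ?Y 0
        = e + c * fact n * (1 / partial2 \<rho> (z0, b 0) * deriv ?Y 0) + l * fact n * ?Y 0"
        unfolding e_def
      proof (rule fop_iter_gauge_F_base[OF S(1) _ _ _ _ S(2) n])
        show "smooth_on ?S (\<lambda>s. 1 / partial2 \<rho> (z0, b s))"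
          by (rule smooth_on_divide[OF S(1) smooth_on_const[OF S(1)] sbU[OF smooth_on_partial2[OF open_U smooth_\<rho>]]])
            (rule SD(2))
        show "1 / partial2 \<rho> (z0, b s) * deriv ?X s = 1" if "s \<in> ?S" for s
          using DERIV_imp_deriv[OF dX[OF smooth_\<rho> that]] SD(2)[OF that] by simp
        show "(?X s, ?Y s) \<in> gauge_V n (?X 0) c l" if "s \<in> ?S" for s
          using SD(1)[OF that] D(4) by (auto simp: b' p_def)
      qed (use sbU smooth_\<rho> smooth_\<psi> in auto)
      ultimately show ?thesis by simp
    qed
    moreover have "(fop (\<lambda>s. 1 / partial2 \<rho> (z0, b s)) (\<lambda>s. ?F (?X s, ?Y s)) ^^ n) ?Y 0 = 0"
      using z by (simp add: dbs)
    moreover have "deriv ?Y 0 = partial2 \<psi> p"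
      using DERIV_imp_deriv[OF dX[OF smooth_\<psi> S(2)]] by (simp add: b' p_def)
    moreover have "(z0, b 0) = p" by (simp add: b' p_def)
    ultimately have "e + c * fact n * (partial2 \<psi> p / partial2 \<rho> p) + l * fact n * \<psi> p = 0" by simp
    with l(2) show ?thesis by blast
  qed
  \<comment> \<open>The coefficient \<open>l\<close> depends on \<open>c\<close>, but cancels between the two equations for the same \<open>c\<close>.\<close>
  from lim[of 0] have "e = (fop (\<lambda>t. 1 / deriv (\<lambda>t. \<rho> (t, w t)) t) (\<lambda>t. 0) ^^ n) (\<lambda>t. \<psi> (t, w t)) z0" by auto
  moreover have "m1 = m2" if "e1 + 1 * fact n * m1 + l1 = 0 \<and> e2 + 1 * fact n * m2 + l1 = 0" "e2 = e1"
    for e1 e2 m1 m2 l1 :: real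
  proof -
    have "e1 + fact n * m1 + l1 = e1 + fact n * m2 + l1" using that by simp
    then show ?thesis by simp
  qed
  ultimately have "deriv (\<lambda>t. \<psi> (t, w t)) z0 / deriv (\<lambda>t. \<rho> (t, w t)) z0 = partial2 \<psi> p / partial2 \<rho> p"
    using lim[of 1] by blast
  then have "(partial1 \<psi> p + partial2 \<psi> p * \<alpha>) * partial2 \<rho> p = partial2 \<psi> p * (partial1 \<rho> p + partial2 \<rho> p * \<alpha>)"
    using X'0 r2 unfolding X' Y' by (simp add: field_simps)
  then show False using jacobian[OF p(1)] by (simp add: algebra_simps)
qed

lemma partial2_\<rho>: "p \<in> U \<Longrightarrow> partial2 \<rho> p = 0"
proof (rule ccontr)
  assume p: "p \<in> U" "partial2 \<rho> p \<noteq> 0"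
  let ?N = "U \<inter> partial2 \<rho> -` (- {0})"
  have N: "open ?N"
    by (rule continuous_open_preimage[OF smooth_on_continuous[OF smooth_on_partial2[OF open_U smooth_\<rho>]] open_U]) auto
  obtain q where "q \<in> ?N" "snd q \<noteq> 0" "\<psi> q \<noteq> 0"
    by (rule ex_generic_point[OF N]) (use p in auto)
  then show False using partial2_\<rho>_generic[of q] by auto
qed

end

section \<open>Agreement of jets\<close>

definition same_jet :: "nat \<Rightarrow> real \<Rightarrow> (real \<Rightarrow> real) \<Rightarrow> (real \<Rightarrow> real) \<Rightarrow> bool" where
  "same_jet m t f g \<longleftrightarrow> (\<forall>i\<le>m. (deriv ^^ i) f t = (deriv ^^ i) g t)"

lemma same_jet_0: "same_jet 0 t f g \<longleftrightarrow> f t = g t"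
  by (simp add: same_jet_def)

lemma same_jet_Suc: "same_jet (Suc m) t f g \<longleftrightarrow> f t = g t \<and> same_jet m t (deriv f) (deriv g)"
proof -
  have "(\<forall>i\<le>Suc m. P i) \<longleftrightarrow> P 0 \<and> (\<forall>i\<le>m. P (Suc i))" for P
    by (metis Suc_le_mono le0 not0_implies_Suc)
  then show ?thesis by (simp add: same_jet_def deriv_iter_Suc_right del: funpow.simps(2))
qed

lemma same_jet_mono: "same_jet m t f g \<Longrightarrow> k \<le> m \<Longrightarrow> same_jet k t f g"
  by (simp add: same_jet_def)

lemma same_jet_deriv_iter: "same_jet (m + k) t f g \<Longrightarrow> same_jet m t ((deriv ^^ k) f) ((deriv ^^ k) g)"
  by (auto simp: same_jet_def simp flip: funpow_add[THEN fun_cong, unfolded o_def])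

lemma deriv_iter_cong:
  fixes f g :: "real \<Rightarrow> real"
  shows "open S \<Longrightarrow> t \<in> S \<Longrightarrow> (\<And>s. s \<in> S \<Longrightarrow> f s = g s) \<Longrightarrow> (deriv ^^ k) f t = (deriv ^^ k) g t"
  unfolding deriv_iter_eq_fop by (rule fop_iter_cong) auto

lemma same_jet_cong:
  "open S \<Longrightarrow> t \<in> S \<Longrightarrow> (\<And>s. s \<in> S \<Longrightarrow> f s = f' s) \<Longrightarrow> (\<And>s. s \<in> S \<Longrightarrow> g s = g' s) \<Longrightarrow>
    same_jet m t f g \<longleftrightarrow> same_jet m t f' g'"
  unfolding same_jet_def using deriv_iter_cong[of S t f f'] deriv_iter_cong[of S t g g'] by simp

context
  fixes S :: "real set" and t :: real
  assumes S: "open S" and t: "t \<in> S"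
begin

lemma same_jet_linear:
  assumes "smooth_on S f" "smooth_on S f'" "smooth_on S g" "smooth_on S g'"
    "same_jet m t f f'" "same_jet m t g g'"
  shows "same_jet m t (\<lambda>s. a * f s + b * g s) (\<lambda>s. a * f' s + b * g' s)"
  unfolding same_jet_def
  using assms(5,6) deriv_iter_linear[OF S assms(1,3) t] deriv_iter_linear[OF S assms(2,4) t]
  by (simp add: same_jet_def)

lemma same_jet_add:
  assumes "smooth_on S f" "smooth_on S f'" "smooth_on S g" "smooth_on S g'"
    "same_jet m t f f'" "same_jet m t g g'"
  shows "same_jet m t (\<lambda>s. f s + g s) (\<lambda>s. f' s + g' s)"
  using same_jet_linear[OF assms, of 1 1] by simp

lemma deriv_mult_on:
  fixes f g :: "real \<Rightarrow> real"
  assumes "smooth_on S f" "smooth_on S g" "s \<in> S"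
  shows "deriv (\<lambda>s. f s * g s) s = deriv f s * g s + f s * deriv g s"
  by (rule DERIV_imp_deriv)
    (auto intro!: derivative_eq_intros smooth_on_deriv_has_derivative[OF assms(1,3)]
      smooth_on_deriv_has_derivative[OF assms(2,3)])

lemma same_jet_mult:
  assumes "smooth_on S f" "smooth_on S f'" "smooth_on S g" "smooth_on S g'"
    "same_jet m t f f'" "same_jet m t g g'"
  shows "same_jet m t (\<lambda>s. f s * g s) (\<lambda>s. f' s * g' s)"
  using assms
proof (induction m arbitrary: f f' g g')
  case 0
  then show ?case by (simp add: same_jet_0)
next
  case (Suc m)
  note sm = Suc.prems(1-4)
  note sd = sm[THEN smooth_on_deriv[OF S]]
  have j: "f t = f' t" "same_jet m t (deriv f) (deriv f')" "g t = g' t" "same_jet m t (deriv g) (deriv g')"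
    using Suc.prems by (auto simp: same_jet_Suc)
  have jm: "same_jet m t f f'" "same_jet m t g g'" using Suc.prems by (auto intro: same_jet_mono)
  have "same_jet m t (\<lambda>s. deriv f s * g s + f s * deriv g s) (\<lambda>s. deriv f' s * g' s + f' s * deriv g' s)"
    by (intro same_jet_add smooth_on_mult S sm sd Suc.IH jm j)
  then have "same_jet m t (deriv (\<lambda>s. f s * g s)) (deriv (\<lambda>s. f' s * g' s))"
    by (subst same_jet_cong[OF S t deriv_mult_on deriv_mult_on]) (use sm in auto)
  then show ?case using j by (simp add: same_jet_Suc)
qed

text \<open>
  By induction on the order, since the derivative of \<open>G (s, w(s))\<close> is built from functions of the same
  form and from \<open>w'\<close>.
\<close>

lemma same_jet_compose:
  assumes D: "open D" "\<And>s. s \<in> S \<Longrightarrow> (s, w s) \<in> D" "\<And>s. s \<in> S \<Longrightarrow> (s, w' s) \<in> D"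
    and w: "smooth_on S w" "smooth_on S w'"
  shows "smooth_on D G \<Longrightarrow> same_jet m t w w' \<Longrightarrow> same_jet m t (\<lambda>s. G (s, w s)) (\<lambda>s. G (s, w' s))"
proof (induction m arbitrary: G)
  case 0
  then show ?case by (simp add: same_jet_0)
next
  case (Suc m)
  have sm: "smooth_on S (\<lambda>s. H (s, w s))" "smooth_on S (\<lambda>s. H (s, w' s))" if "smooth_on D H" for H :: "real \<times> real \<Rightarrow> real"
    by (rule smooth_on_compose[OF that S D(1)]; auto intro!: smooth_on_Pair smooth_on_ident S w D)+
  note p1 = smooth_on_partial1[OF D(1) Suc.prems(1)] and p2 = smooth_on_partial2[OF D(1) Suc.prems(1)]
  have d: "deriv (\<lambda>s. G (s, v s)) s = partial1 G (s, v s) + partial2 G (s, v s) * deriv v s"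
    if "s \<in> S" "smooth_on S v" "(s, v s) \<in> D" for s v
    using has_real_derivative_along_partial[OF D(1) Suc.prems(1) DERIV_ident
        smooth_on_deriv_has_derivative[OF that(2,1)] that(3)]
    by (simp add: DERIV_imp_deriv mult.commute)
  have j: "w t = w' t" "same_jet m t (deriv w) (deriv w')" "same_jet m t w w'"
    using Suc.prems(2) same_jet_mono[OF Suc.prems(2), of m] by (auto simp: same_jet_Suc)
  have "same_jet m t (\<lambda>s. partial1 G (s, w s) + partial2 G (s, w s) * deriv w s)
      (\<lambda>s. partial1 G (s, w' s) + partial2 G (s, w' s) * deriv w' s)"
    by (intro same_jet_add same_jet_mult smooth_on_mult S sm p1 p2 smooth_on_deriv w Suc.IH j)
  then have "same_jet m t (deriv (\<lambda>s. G (s, w s))) (deriv (\<lambda>s. G (s, w' s)))"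
    by (subst same_jet_cong[OF S t d d]) (use w D in auto)
  then show ?case using j by (simp add: same_jet_Suc)
qed

end

section \<open>Equivalence transformations are affine on vertical lines\<close>

text \<open>
  For \<open>n = 2\<close> the choice \<open>c = 0\<close> already gives the claim. For \<open>n \<ge> 3\<close> the coefficient of \<open>s\<^sup>n\<close> in
  \<open>f (w\<^sub>0 + s + c s\<^sup>n\<^sup>-\<^sup>1)\<close> is \<open>f\<^sup>(\<^sup>n\<^sup>) (w\<^sub>0)/n! + c f'' (w\<^sub>0)\<close>, and its values for \<open>c = 0\<close> and \<open>c = 1\<close> are
  compared.
\<close>

lemma second_deriv_eq_0_of_probes:
  fixes f :: "real \<Rightarrow> real"
  assumes J: "open J" "w0 \<in> J" and f: "smooth_on J f" and n: "n \<ge> 2"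
    and z: "\<And>c. (deriv ^^ n) (\<lambda>s. f (w0 + (s + c * s ^ (n - 1)))) 0 = 0"
  shows "deriv (deriv f) w0 = 0"
proof -
  define \<phi> where "\<phi> c s = w0 + (s + c * s ^ (n - 1))" for c s :: real
  define S where "S c = \<phi> c -` J" for c
  have sm: "smooth_on UNIV (\<phi> c)" for c unfolding \<phi>_def[abs_def] by (intro smooth_on_intros) auto
  have S: "open (S c)" "0 \<in> S c" for c
    unfolding S_def using open_vimage[OF J(1) smooth_on_continuous[OF sm]] J(2) n
    by (auto simp: \<phi>_def power_0_left)
  have \<phi>0: "\<phi> c 0 = w0" for c using n by (simp add: \<phi>_def power_0_left)
  have sg: "smooth_on (S c) (\<lambda>s. g (\<phi> c s))" if "smooth_on J g" for g :: "real \<Rightarrow> real" and c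
    by (rule smooth_on_compose[OF that S(1) J(1) smooth_on_subset[OF sm]]) (auto simp: S_def)
  have step: "(deriv ^^ Suc k) (\<lambda>s. g (\<phi> c s)) 0 = (deriv ^^ k) (\<lambda>s. deriv g (\<phi> c s)) 0
      + c * (real n - 1) * (if n - 2 \<le> k then fact k / fact (k - (n - 2)) * (deriv ^^ (k - (n - 2))) (\<lambda>s. deriv g (\<phi> c s)) 0 else 0)"
    if g: "smooth_on J g" for g k c
  proof -
    have sd: "smooth_on (S c) (\<lambda>s. deriv g (\<phi> c s))" by (rule sg[OF smooth_on_deriv[OF J(1) g]])
    have n1: "real n - 1 = real (n - 1)" using n by simp
    have "deriv (\<lambda>s. g (\<phi> c s)) s = 1 * deriv g (\<phi> c s) + c * (real n - 1) * ((s - 0) ^ (n - 2) * deriv g (\<phi> c s))"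
      if "s \<in> S c" for s
    proof -
      have "(\<phi> c has_real_derivative 1 + c * (real (n - 1) * s ^ (n - 2))) (at s)"
        unfolding \<phi>_def[abs_def] by (auto intro!: derivative_eq_intros simp: numeral_2_eq_2)
      moreover have "(g has_real_derivative deriv g (\<phi> c s)) (at (\<phi> c s))"
        by (rule smooth_on_deriv_has_derivative[OF g]) (use that in \<open>simp add: S_def\<close>)
      ultimately have "((\<lambda>s. g (\<phi> c s)) has_real_derivative
          deriv g (\<phi> c s) * (1 + c * (real (n - 1) * s ^ (n - 2)))) (at s)"
        by (intro DERIV_chain2)
      then show ?thesis unfolding n1 by (simp add: DERIV_imp_deriv algebra_simps)
    qed
    then have "(deriv ^^ k) (deriv (\<lambda>s. g (\<phi> c s))) 0
        = (deriv ^^ k) (\<lambda>s. 1 * deriv g (\<phi> c s) + c * (real n - 1) * ((s - 0) ^ (n - 2) * deriv g (\<phi> c s))) 0"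
      by (rule deriv_iter_cong[OF S])
    also have "\<dots> = (deriv ^^ k) (\<lambda>s. deriv g (\<phi> c s)) 0
        + c * (real n - 1) * (deriv ^^ k) (\<lambda>s. (s - 0) ^ (n - 2) * deriv g (\<phi> c s)) 0"
      by (subst deriv_iter_linear[OF S(1) sd _ S(2)]) ((intro smooth_on_intros S(1) sd), simp only: mult_1)
    finally show ?thesis
      unfolding deriv_iter_Suc_right deriv_iter_power_mult[OF S(1) sd S(2)] .
  qed
  obtain m where m: "n = Suc (Suc m)" using n by (metis add_2_eq_Suc le_Suc_ex)
  note f' = smooth_on_deriv[OF J(1) f] and f'' = smooth_on_deriv[OF J(1) smooth_on_deriv[OF J(1) f]]
  let ?f2 = "deriv (deriv f) w0"
  show ?thesis
  proof (cases m)
    case 0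
    then have "(deriv ^^ Suc (Suc 0)) (\<lambda>s. f (\<phi> 0 s)) 0 = ?f2"
      unfolding step[OF f] step[OF f'] by (simp add: \<phi>0)
    then show ?thesis using z[of 0] m 0 by (simp add: \<phi>_def)
  next
    case (Suc m')
    have d1: "(deriv ^^ Suc 0) (\<lambda>s. deriv f (\<phi> c s)) 0 = ?f2" for c
      unfolding step[OF f'] using Suc by (simp add: \<phi>0 m)
    have "(deriv ^^ n) (\<lambda>s. f (\<phi> c s)) 0 = (deriv ^^ m) (\<lambda>s. deriv (deriv f) (\<phi> c s)) 0
       + c * (real n - 1) * (fact m * ?f2) + c * (real n - 1) * (fact (Suc m) * ?f2)" for c
      using step[OF f, of "Suc m" c] step[OF f', of m c] d1[of c]
      by (simp add: m \<phi>0 Suc_diff_le del: funpow.simps fact_Suc)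
    then have e: "(deriv ^^ m) (\<lambda>s. deriv (deriv f) (\<phi> c s)) 0
       + c * (real n - 1) * (fact m * ?f2) + c * (real n - 1) * (fact (Suc m) * ?f2) = 0" for c
      using z[of c] by (simp add: \<phi>_def)
    have "same_jet m 0 (\<phi> 1) (\<phi> 0)"
      unfolding same_jet_def
    proof (intro allI impI)
      fix i assume i: "i \<le> m"
      have "\<phi> 1 = (\<lambda>s. 1 * \<phi> 0 s + 1 * ((s - 0) ^ (n - 1) * 1))" by (auto simp: \<phi>_def)
      then have "(deriv ^^ i) (\<phi> 1) 0 = 1 * (deriv ^^ i) (\<phi> 0) 0 + 1 * (deriv ^^ i) (\<lambda>s. (s - 0) ^ (n - 1) * 1) (0::real)"
        using deriv_iter_linear[OF open_UNIV sm, of "\<lambda>s. (s - 0) ^ (n - 1) * 1" 0 i 1 0 1]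
        by (simp add: smooth_on_intros)
      then show "(deriv ^^ i) (\<phi> 1) 0 = (deriv ^^ i) (\<phi> 0) 0"
        using deriv_iter_power_mult[OF open_UNIV smooth_on_const[OF open_UNIV], of 0 i "n - 1" 1] i m by simp
    qed
    then have "same_jet m 0 (\<lambda>s. (\<lambda>p. deriv (deriv f) (snd p)) (s, \<phi> 1 s)) (\<lambda>s. (\<lambda>p. deriv (deriv f) (snd p)) (s, \<phi> 0 s))"
    proof (intro same_jet_compose[where S = "S 0 \<inter> S 1" and D = "snd -` J"])
      show "open (snd -` J :: (real \<times> real) set)" by (intro open_vimage J continuous_intros)
      then show "smooth_on (snd -` J) (\<lambda>p::real\<times>real. deriv (deriv f) (snd p))"
        by (intro smooth_on_compose[OF f'' _ J(1)] smooth_on_snd smooth_on_ident) auto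
    qed (use S smooth_on_subset[OF sm] in \<open>auto simp: S_def\<close>)
    then have "(deriv ^^ m) (\<lambda>s. deriv (deriv f) (\<phi> 1 s)) 0 = (deriv ^^ m) (\<lambda>s. deriv (deriv f) (\<phi> 0 s)) 0"
      by (simp add: same_jet_def)
    then have "(real n - 1) * (fact m + fact (Suc m)) * ?f2 = 0"
      using e[of 0] e[of 1] by (simp add: algebra_simps del: fact_Suc)
    moreover have "real n - 1 > 0" "(fact m + fact (Suc m) :: real) > 0"
      using n by (simp_all add: add_pos_pos del: fact_Suc)
    ultimately show ?thesis by (metis less_irrefl mult_eq_0_iff)
  qed
qed

lemma const_of_partial2_eq_0:
  assumes U: "open U" "convex U" and f: "smooth_on U f" "\<And>p. p \<in> U \<Longrightarrow> partial2 f p = 0"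
    and zw: "(z, w) \<in> U" "(z, w') \<in> U"
  shows "f (z, w) = f (z, w')"
proof -
  let ?J = "{t. (z, t) \<in> U}"
  have conv: "convex ?J"
  proof (rule convexI)
    fix x y u v :: real assume "x \<in> ?J" "y \<in> ?J" "0 \<le> u" "0 \<le> v" "u + v = 1"
    moreover from this have "u *\<^sub>R (z, x) + v *\<^sub>R (z, y) = (z, u *\<^sub>R x + v *\<^sub>R y)"
      by (simp flip: distrib_right)
    ultimately show "u *\<^sub>R x + v *\<^sub>R y \<in> ?J" using convexD[OF U(2), of "(z, x)" "(z, y)" u v] by simp
  qed
  have "((\<lambda>t. f (z, t)) has_real_derivative 0) (at t within ?J)" if "t \<in> ?J" for t
    using has_real_derivative_along_partial[OF U(1) f(1), of "\<lambda>t. z" 0 t "\<lambda>t. t" 1] that f(2)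
    by (auto intro: has_field_derivative_at_within)
  from has_field_derivative_zero_constant[OF conv this] show ?thesis using zw by auto
qed

context equiv_transf
begin

lemma partial1_\<rho>_nonzero: "p \<in> U \<Longrightarrow> partial1 \<rho> p \<noteq> 0"
  and partial2_\<psi>_nonzero: "p \<in> U \<Longrightarrow> partial2 \<psi> p \<noteq> 0"
  using jacobian[of p] partial2_\<rho>[of p] by auto

lemma partial1_\<rho>_const: "(z, w) \<in> U \<Longrightarrow> (z, w') \<in> U \<Longrightarrow> partial1 \<rho> (z, w) = partial1 \<rho> (z, w')"
proof -
  assume w: "(z, w) \<in> U" "(z, w') \<in> U"
  have "open ((\<lambda>t. (t, w)) -` U \<inter> (\<lambda>t. (t, w')) -` U)"
    by (intro open_Int open_vimage open_U continuous_intros)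
  then have "deriv (\<lambda>t. \<rho> (t, w)) z = deriv (\<lambda>t. \<rho> (t, w')) z"
    by (rule deriv_cong_on_open)
      (use w const_of_partial2_eq_0[OF open_U conv smooth_\<rho> partial2_\<rho>] in auto)
  then show ?thesis by (simp add: partial1_def)
qed

text \<open>
  Now \<open>dx/ds = \<epsilon> \<rho>\<^sub>z\<close> along the steep curves, and the limit of the rescaled equation is the vanishing of
  the \<open>n\<close>-th derivative of \<open>\<psi>(z\<^sub>0, b(s))\<close> at \<open>s = 0\<close>, for every \<open>b\<close> through \<open>w\<^sub>0\<close> whose own \<open>n\<close>-th
  derivative vanishes there.
\<close>

lemma partial22_\<psi>_generic:
  assumes p: "p \<in> U" "snd p \<noteq> 0" "\<psi> p \<noteq> 0"
  shows "partial2 (partial2 \<psi>) p = 0"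
proof -
  obtain z0 w0 where p_def: "p = (z0, w0)" by (cases p)
  have pU: "(z0, w0) \<in> U" using p p_def by simp
  have c0: "((\<lambda>t. w0) has_real_derivative 0) (at z0)" by simp
  have "deriv (\<lambda>t. \<rho> (t, w0)) z0 = partial1 \<rho> p"
    using deriv_along[OF smooth_\<rho> c0 pU] by (simp add: p_def)
  then have X': "deriv (\<lambda>t. \<rho> (t, w0)) z0 \<noteq> 0" using partial1_\<rho>_nonzero[OF p(1)] by simp
  have \<psi>0: "\<psi> (z0, w0) \<noteq> 0" using p p_def by simp
  obtain l where l: "solvable_at n U \<rho> \<psi> (gauge_F n (\<rho> p) 0 l) p"
    by (rule solvable_gauge[OF smooth_on_const[OF open_UNIV] pU X' \<psi>0, of 0, folded p_def])
  let ?V = "gauge_V n (\<rho> p) 0 l" and ?F = "gauge_F n (\<rho> p) 0 l"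
  have pV: "(\<rho> p, \<psi> p) \<in> ?V" using gauge_poly_base[OF n] by (simp add: gauge_V_def)
  obtain D Q where D: "open D" "p \<in> D" "D \<subseteq> U" "(\<lambda>q. (\<rho> q, \<psi> q)) ` D \<subseteq> ?V" "parameter_function n D \<rho> \<psi> ?F Q"
    by (rule ex_parameter_function[OF open_gauge_V smooth_gauge_F p(1) pV p(2) l])
  have "(deriv ^^ n) (\<lambda>s. \<psi> (z0, w0 + (s + c * s ^ (n - 1)))) 0 = 0" for c
  proof -
    define b where "b s = w0 + (s + c * s ^ (n - 1))" for s
    have sb: "smooth_on UNIV b" unfolding b_def[abs_def] by (intro smooth_on_intros) auto
    have b: "(deriv ^^ n) b 0 = 0" using deriv_iter_probe[OF n, of w0 c] by (simp add: b_def[abs_def])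
    have b0: "b 0 = w0" using n by (simp add: b_def power_0_left)
    let ?Z = "\<lambda>x::real\<times>real\<times>real. z0 + fst x * snd (snd x)"
    let ?W = "\<lambda>x::real\<times>real\<times>real. b (snd (snd x)) + fst (snd x) * snd (snd x) ^ n"
    define T where "T = (\<lambda>x. (?Z x, ?W x)) -` D"
    have "continuous_on UNIV (\<lambda>x. (?Z x, ?W x))"
      unfolding b_def by (intro continuous_intros)
    then have T: "open T" unfolding T_def by (rule open_vimage[OF D(1)])
    have sm: "smooth_on T (\<lambda>x. x)" by (rule smooth_on_ident[OF T])
    have s: "smooth_on T (\<lambda>x. snd (snd x))" "smooth_on T (\<lambda>x. fst x)" "smooth_on T (\<lambda>x. fst (snd x))"
      by (intro smooth_on_snd smooth_on_fst sm T)+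
    have sp: "smooth_on T (\<lambda>x. partial1 \<rho> (?Z x, ?W x))"
      by (rule smooth_on_compose[OF smooth_on_subset[OF smooth_on_partial1[OF open_U smooth_\<rho>] D(3)] T D(1)], unfold b_def,
          intro smooth_on_Pair smooth_on_add smooth_on_mult smooth_on_power smooth_on_const T s)
        (simp add: T_def b_def)
    have TU: "(?Z x, ?W x) \<in> U" if "x \<in> T" for x using that D(3) by (auto simp: T_def)
    have sA: "smooth_on T (\<lambda>x. 1 / partial1 \<rho> (?Z x, ?W x))"
      by (rule smooth_on_divide[OF T smooth_on_const[OF T] sp]) (rule partial1_\<rho>_nonzero[OF TU])
    have T0: "(0, 0, 0) \<in> T" using D(2) by (simp add: T_def b0 p_def)
    have z: "(fop (\<lambda>s. 1 / partial1 \<rho> (?Z (0, 0, s), ?W (0, 0, s))) (\<lambda>s. 0 ^ 1 * ?F (\<rho> (z0, b s), \<psi> (z0, b s))) ^^ n)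
        (\<lambda>s. \<psi> (z0, b s)) 0 = 0"
      by (rule steep_limit[OF _ open_gauge_V smooth_gauge_F D(1,3,4,5) sb b T T0 _ sA])
        (use n partial1_\<rho>_nonzero[OF TU] partial2_\<rho>[OF TU] in \<open>auto simp: T_def\<close>)
    let ?S = "{s. (0, 0, s) \<in> T}"
    have S: "open ?S" "0 \<in> ?S" using open_line[OF T] T0 by auto
    have SU: "(z0, b s) \<in> U" if "s \<in> ?S" for s using TU[of "(0, 0, s)"] that by simp
    let ?c = "1 / partial1 \<rho> p"
    have s\<psi>: "smooth_on ?S (\<lambda>s. \<psi> (z0, b s))"
      by (rule smooth_on_compose[OF smooth_\<psi> S(1) open_U])
        (use SU in \<open>auto intro!: smooth_on_Pair smooth_on_const S(1) smooth_on_subset[OF sb]\<close>)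
    have "?c ^ n * (deriv ^^ n) (\<lambda>s. \<psi> (z0, b s)) 0 = (fop (\<lambda>s. ?c * 1) (\<lambda>s. ?c * 0) ^^ n) (\<lambda>s. \<psi> (z0, b s)) 0"
      unfolding deriv_iter_eq_fop
      by (rule fop_iter_scale[OF S(1) _ _ s\<psi> S(2), symmetric]) (intro smooth_on_const S(1))+
    also have "\<dots> = (fop (\<lambda>s. 1 / partial1 \<rho> (?Z (0, 0, s), ?W (0, 0, s))) (\<lambda>s. 0 ^ 1 * ?F (\<rho> (z0, b s), \<psi> (z0, b s))) ^^ n)
        (\<lambda>s. \<psi> (z0, b s)) 0"
      by (rule fop_iter_cong[OF S(1) _ _ _ S(2)]) (use SU partial1_\<rho>_const[OF _ pU] in \<open>auto simp: p_def\<close>)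
    also note z
    finally show ?thesis using partial1_\<rho>_nonzero[OF p(1)] by (simp add: b_def)
  qed
  moreover have "open {t. (z0, t) \<in> U}"
    using open_vimage[OF open_U, of "\<lambda>t. (z0, t)"] by (simp add: vimage_def continuous_intros)
  moreover from this have "smooth_on {t. (z0, t) \<in> U} (\<lambda>t. \<psi> (z0, t))"
    by (intro smooth_on_compose[OF smooth_\<psi> _ open_U] smooth_on_Pair smooth_on_const smooth_on_ident) auto
  ultimately have "deriv (deriv (\<lambda>t. \<psi> (z0, t))) w0 = 0"
    using second_deriv_eq_0_of_probes[of "{t. (z0, t) \<in> U}" w0 "\<lambda>t. \<psi> (z0, t)" n] pU n by simp
  then show ?thesis by (simp add: partial2_def p_def)
qed

lemma partial22_\<psi>: "p \<in> U \<Longrightarrow> partial2 (partial2 \<psi>) p = 0"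
proof (rule ccontr)
  assume p: "p \<in> U" "partial2 (partial2 \<psi>) p \<noteq> 0"
  let ?N = "U \<inter> partial2 (partial2 \<psi>) -` (- {0})"
  have N: "open ?N"
    by (rule continuous_open_preimage[OF smooth_on_continuous[OF smooth_on_partial2[OF open_U
            smooth_on_partial2[OF open_U smooth_\<psi>]]] open_U]) auto
  obtain q where "q \<in> ?N" "snd q \<noteq> 0" "\<psi> q \<noteq> 0"
    by (rule ex_generic_point[OF N]) (use p in auto)
  then show False using partial22_\<psi>_generic[of q] by auto
qed

lemma open_K: "open (fst ` U)"
  by (rule open_image_fst[OF open_U])

lemma ex_function_of_base:
  assumes f: "smooth_on U f" "\<And>p. p \<in> U \<Longrightarrow> partial2 f p = 0"
  obtains g where "smooth_on (fst ` U) g" "\<And>z w. (z, w) \<in> U \<Longrightarrow> f (z, w) = g z"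
proof
  define g where "g z = f (z, SOME w. (z, w) \<in> U)" for z
  show eq: "f (z, w) = g z" if "(z, w) \<in> U" for z w
    unfolding g_def
    by (rule const_of_partial2_eq_0[OF open_U conv f that someI[where P = "\<lambda>w. (z, w) \<in> U", OF that]])
  show "smooth_on (fst ` U) g"
  proof (rule smooth_on_locally[OF open_K])
    fix z assume "z \<in> fst ` U"
    then obtain w where w: "(z, w) \<in> U" by force
    let ?T = "(\<lambda>t. (t, w)) -` U"
    have T: "open ?T" by (intro open_vimage open_U continuous_intros)
    have "smooth_on ?T (\<lambda>t. f (t, w))"
      by (rule smooth_on_compose[OF f(1) T open_U]) (auto intro!: smooth_on_Pair smooth_on_ident smooth_on_const T)
    then have "smooth_on ?T g" using smooth_on_cong[OF T, of "\<lambda>t. f (t, w)" g] eq by auto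
    then show "\<exists>T. open T \<and> z \<in> T \<and> smooth_on T g" using T w by (intro exI[of _ ?T]) auto
  qed
qed

lemma ex_affine_form:
  obtains \<rho>0 R T where "smooth_on (fst ` U) \<rho>0" "smooth_on (fst ` U) R" "smooth_on (fst ` U) T"
    "\<And>z w. (z, w) \<in> U \<Longrightarrow> \<rho> (z, w) = \<rho>0 z" "\<And>z w. (z, w) \<in> U \<Longrightarrow> \<psi> (z, w) = R z * w + T z"
    "\<And>z. z \<in> fst ` U \<Longrightarrow> R z \<noteq> 0" "\<And>z. z \<in> fst ` U \<Longrightarrow> deriv \<rho>0 z \<noteq> 0"
proof -
  obtain \<rho>0 where \<rho>0: "smooth_on (fst ` U) \<rho>0" "\<And>z w. (z, w) \<in> U \<Longrightarrow> \<rho> (z, w) = \<rho>0 z"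
    using ex_function_of_base[OF smooth_\<rho> partial2_\<rho>] by blast
  note s2 = smooth_on_partial2[OF open_U smooth_\<psi>]
  obtain R where R: "smooth_on (fst ` U) R" "\<And>z w. (z, w) \<in> U \<Longrightarrow> partial2 \<psi> (z, w) = R z"
    using ex_function_of_base[OF s2 partial22_\<psi>] by blast
  have sT: "smooth_on U (\<lambda>p. \<psi> p - partial2 \<psi> p * snd p)"
    by (intro smooth_on_diff smooth_on_mult smooth_on_snd smooth_on_ident open_U s2 smooth_\<psi>)
  have "partial2 (\<lambda>p. \<psi> p - partial2 \<psi> p * snd p) p = 0" if "p \<in> U" for p
  proof -
    have "((\<lambda>t. f (fst p, t)) has_real_derivative partial2 f p) (at (snd p))" if "smooth_on U f" for f
      using has_real_derivative_along_partial[OF open_U that, of "\<lambda>t. fst p" 0 "snd p" "\<lambda>t. t" 1] \<open>p \<in> U\<close> by auto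
    from this[OF smooth_\<psi>] this[OF s2] show ?thesis
      unfolding partial2_def[of "\<lambda>p. \<psi> p - partial2 \<psi> p * snd p"]
      using partial22_\<psi>[OF \<open>p \<in> U\<close>] by (intro DERIV_imp_deriv) (auto intro!: derivative_eq_intros)
  qed
  from ex_function_of_base[OF sT this]
  obtain T where T: "smooth_on (fst ` U) T" "\<And>z w. (z, w) \<in> U \<Longrightarrow> \<psi> (z, w) - partial2 \<psi> (z, w) * snd (z, w) = T z"
    by blast
  show ?thesis
  proof (rule that[OF \<rho>0(1) R(1) T(1) \<rho>0(2)])
    show "\<psi> (z, w) = R z * w + T z" if "(z, w) \<in> U" for z w
      using T(2)[OF that] R(2)[OF that] by simp
    show "R z \<noteq> 0" if "z \<in> fst ` U" for z using that R(2) partial2_\<psi>_nonzero by force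
    show "deriv \<rho>0 z \<noteq> 0" if "z \<in> fst ` U" for z
    proof -
      from that obtain w where w: "(z, w) \<in> U" by force
      have "open ((\<lambda>t. (t, w)) -` U)" by (intro open_vimage open_U continuous_intros)
      then have "deriv (\<lambda>t. \<rho> (t, w)) z = deriv \<rho>0 z"
        by (rule deriv_cong_on_open) (use w \<rho>0(2) in auto)
      then show ?thesis using partial1_\<rho>_nonzero[OF w] by (simp add: partial1_def)
    qed
  qed
qed

end

section \<open>Determination of the parameter function from linear equations\<close>

subsection \<open>The two highest coefficients of the iterated operators\<close>

lemma Omega_iter_Suc: "Omega_iter (Suc k) Q w s = deriv (Omega_iter k Q w) s + Q (s, w s) * Omega_iter k Q w s"
  by (simp add: Omega_iter_def Omega_def)

text \<open>
  The coefficient of \<open>w\<^sup>(\<^sup>k\<^sup>-\<^sup>1\<^sup>)\<close> in \<open>\<Omega>\<^sub>Q\<^sup>k[w]\<close> for \<open>k \<ge> 2\<close>: the term \<open>w Q\<^sub>w\<close> arises from differentiating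
  \<open>Q(z, w) w\<close> as often as possible.
\<close>

definition subleading :: "(real \<times> real \<Rightarrow> real) \<Rightarrow> nat \<Rightarrow> real \<times> real \<Rightarrow> real" where
  "subleading Q k p = of_nat k * Q p + snd p * partial2 Q p"

definition lower_terms :: "(real \<times> real \<Rightarrow> real) \<Rightarrow> nat \<Rightarrow> (real \<Rightarrow> real) \<Rightarrow> real \<Rightarrow> real" where
  "lower_terms Q k w = (\<lambda>s. Omega_iter k Q w s - (deriv ^^ k) w s - subleading Q k (s, w s) * (deriv ^^ (k - 1)) w s)"

context
  fixes S :: "real set" and D :: "(real \<times> real) set" and Q :: "real \<times> real \<Rightarrow> real"
  assumes S: "open S" and D: "open D" and Q: "smooth_on D Q"
begin

lemma smooth_on_subleading: "smooth_on D (subleading Q k)"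
  unfolding subleading_def[abs_def]
  by (intro smooth_on_add smooth_on_mult smooth_on_const smooth_on_snd smooth_on_ident D Q smooth_on_partial2[OF D Q])

context
  fixes w :: "real \<Rightarrow> real"
  assumes w: "smooth_on S w" "\<And>s. s \<in> S \<Longrightarrow> (s, w s) \<in> D"
begin

lemma smooth_on_graph: "smooth_on D G \<Longrightarrow> smooth_on S (\<lambda>s. G (s, w s) :: real)"
  by (rule smooth_on_compose[OF _ S D]) (auto intro!: smooth_on_Pair smooth_on_ident S w)

lemma smooth_on_Omega_iter: "smooth_on S (Omega_iter k Q w)"
  unfolding Omega_iter_eq_fop by (intro smooth_on_fop_iter S smooth_on_const smooth_on_graph Q w)

lemma smooth_on_lower_terms: "smooth_on S (lower_terms Q k w)"
  unfolding lower_terms_def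
  by (intro smooth_on_diff smooth_on_mult S smooth_on_Omega_iter smooth_on_deriv_iter w smooth_on_graph
      smooth_on_subleading)

lemma lower_terms_2:
  assumes s: "s \<in> S"
  shows "lower_terms Q 2 w s = (\<lambda>p. (partial1 Q p + Q p * Q p) * snd p) (s, w s)"
proof -
  have dQ: "((\<lambda>s. Q (s, w s)) has_real_derivative partial1 Q (s, w s) + partial2 Q (s, w s) * deriv w s) (at s)"
    using has_real_derivative_along_partial[OF D Q DERIV_ident smooth_on_deriv_has_derivative[OF w(1) s] w(2)[OF s]]
    by (simp add: mult.commute)
  have "deriv (Omega_iter 1 Q w) s = deriv (\<lambda>s. deriv w s + Q (s, w s) * w s) s"
    by (rule deriv_cong_on_open[OF S s]) (simp add: Omega_iter_def Omega_def)
  also have "\<dots> = deriv (deriv w) s + ((partial1 Q (s, w s) + partial2 Q (s, w s) * deriv w s) * w s + Q (s, w s) * deriv w s)"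
    by (rule DERIV_imp_deriv)
      (auto intro!: derivative_eq_intros dQ smooth_on_deriv_has_derivative[OF w(1) s]
        smooth_on_deriv_has_derivative[OF smooth_on_deriv[OF S w(1)] s])
  finally have "Omega_iter (Suc 1) Q w s = deriv (deriv w) s
      + ((partial1 Q (s, w s) + partial2 Q (s, w s) * deriv w s) * w s + Q (s, w s) * deriv w s)
      + Q (s, w s) * (deriv w s + Q (s, w s) * w s)"
    unfolding Omega_iter_Suc by (simp add: Omega_iter_def Omega_def)
  then show ?thesis
    by (simp add: lower_terms_def subleading_def numeral_2_eq_2 algebra_simps)
qed

lemma lower_terms_Suc:
  assumes s: "s \<in> S" and k: "k \<ge> 1"
  shows "lower_terms Q (Suc k) w s = (deriv (lower_terms Q k w) s + Q (s, w s) * lower_terms Q k w s)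
    + (deriv (\<lambda>s. subleading Q k (s, w s)) s + Q (s, w s) * subleading Q k (s, w s)) * (deriv ^^ (k - 1)) w s"
proof -
  have dw: "((deriv ^^ j) w has_real_derivative (deriv ^^ Suc j) w s) (at s)" for j
    using smooth_on_deriv_has_derivative[OF smooth_on_deriv_iter[OF S w(1)] s] by simp
  have k': "Suc (k - 1) = k" using k by simp
  have dL: "(lower_terms Q k w has_real_derivative deriv (lower_terms Q k w) s) (at s)"
    by (rule smooth_on_deriv_has_derivative[OF smooth_on_lower_terms s])
  have dS: "((\<lambda>s. subleading Q k (s, w s)) has_real_derivative deriv (\<lambda>s. subleading Q k (s, w s)) s) (at s)"
    by (rule smooth_on_deriv_has_derivative[OF smooth_on_graph[OF smooth_on_subleading] s])
  have "deriv (Omega_iter k Q w) s = deriv (\<lambda>s. lower_terms Q k w s + (deriv ^^ k) w s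
      + subleading Q k (s, w s) * (deriv ^^ (k - 1)) w s) s"
    by (rule arg_cong[where f = "\<lambda>f. deriv f s"]) (auto simp: lower_terms_def)
  also have "\<dots> = deriv (lower_terms Q k w) s + (deriv ^^ Suc k) w s
      + (deriv (\<lambda>s. subleading Q k (s, w s)) s * (deriv ^^ (k - 1)) w s + subleading Q k (s, w s) * (deriv ^^ k) w s)"
    using DERIV_imp_deriv[OF DERIV_add[OF DERIV_add[OF dL dw[of k]] DERIV_mult[OF dS dw[of "k - 1"]]]]
    unfolding k' by (simp add: mult.commute add.commute)
  finally have d: "deriv (Omega_iter k Q w) s = \<dots>" .
  have o: "Omega_iter k Q w s = lower_terms Q k w s + (deriv ^^ k) w s + subleading Q k (s, w s) * (deriv ^^ (k - 1)) w s"
    by (simp add: lower_terms_def)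
  show ?thesis
    unfolding lower_terms_def[of Q "Suc k"] Omega_iter_Suc d o
    by (simp add: subleading_def[of Q "Suc k"] subleading_def[of Q k] algebra_simps)
qed

end

text \<open>
  The \<open>n\<close>-th iterate has the form \<open>w\<^sup>(\<^sup>n\<^sup>) + (n Q + w Q\<^sub>w) w\<^sup>(\<^sup>n\<^sup>-\<^sup>1\<^sup>) + \<dots>\<close> with terms that depend only on
  the jet of order \<open>n - 2\<close>. The induction starts at order \<open>2\<close>, because for \<open>k = 1\<close> the remainder
  \<open>- w\<^sup>2 Q\<^sub>w\<close> is a function of \<open>(z, w)\<close> as well, but would have to agree to one order more.
\<close>

lemma same_jet_lower_terms:
  assumes w: "smooth_on S w" "\<And>s. s \<in> S \<Longrightarrow> (s, w s) \<in> D"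
    and w': "smooth_on S w'" "\<And>s. s \<in> S \<Longrightarrow> (s, w' s) \<in> D" and t: "t \<in> S"
  shows "same_jet (j + i) t w w' \<Longrightarrow> same_jet j t (lower_terms Q (i + 2) w) (lower_terms Q (i + 2) w')"
proof (induction i arbitrary: j)
  case 0
  have G: "smooth_on D (\<lambda>p. (partial1 Q p + Q p * Q p) * snd p)"
    by (intro smooth_on_add smooth_on_mult smooth_on_snd smooth_on_ident D Q smooth_on_partial1[OF D Q])
  have "same_jet j t (\<lambda>s. (\<lambda>p. (partial1 Q p + Q p * Q p) * snd p) (s, w s))
      (\<lambda>s. (\<lambda>p. (partial1 Q p + Q p * Q p) * snd p) (s, w' s))"
    by (rule same_jet_compose[OF S t D _ _ w(1) w'(1) G]) (use w w' 0 in auto)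
  then show ?case
    unfolding add_0
    by (subst same_jet_cong[OF S t lower_terms_2[OF w] lower_terms_2[OF w']])
next
  case (Suc i)
  let ?k = "i + 2"
  have sG: "smooth_on S (\<lambda>s. G (s, w s))" and sG': "smooth_on S (\<lambda>s. G (s, w' s))"
    if "smooth_on D G" for G :: "real \<times> real \<Rightarrow> real"
    using smooth_on_graph[OF w that] smooth_on_graph[OF w' that] by auto
  have sL: "smooth_on S (lower_terms Q ?k w)" and sL': "smooth_on S (lower_terms Q ?k w')"
    using smooth_on_lower_terms[OF w] smooth_on_lower_terms[OF w'] by auto
  have IH: "same_jet (Suc j) t (lower_terms Q ?k w) (lower_terms Q ?k w')"
    by (rule Suc.IH) (use Suc.prems in simp)
  have L: "same_jet j t (lower_terms Q ?k w) (lower_terms Q ?k w')"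
    and L': "same_jet j t (deriv (lower_terms Q ?k w)) (deriv (lower_terms Q ?k w'))"
    using same_jet_mono[OF IH, of j] IH by (auto simp: same_jet_Suc[of j])
  have c: "same_jet m t (\<lambda>s. G (s, w s)) (\<lambda>s. G (s, w' s))" if "smooth_on D G" "m \<le> j + Suc i" for G m
    by (rule same_jet_compose[OF S t D _ _ w(1) w'(1) that(1)]) (use w w' same_jet_mono[OF Suc.prems that(2)] in auto)
  note sub = smooth_on_subleading[of ?k]
  have "same_jet (Suc j) t (\<lambda>s. subleading Q ?k (s, w s)) (\<lambda>s. subleading Q ?k (s, w' s))"
    by (rule c[OF sub]) simp
  then have e': "same_jet j t (deriv (\<lambda>s. subleading Q ?k (s, w s))) (deriv (\<lambda>s. subleading Q ?k (s, w' s)))"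
    by (simp add: same_jet_Suc)
  have dw: "same_jet j t ((deriv ^^ (?k - 1)) w) ((deriv ^^ (?k - 1)) w')"
    by (rule same_jet_deriv_iter) (use Suc.prems in simp)
  have "same_jet j t (\<lambda>s. (deriv (lower_terms Q ?k w) s + Q (s, w s) * lower_terms Q ?k w s)
    + (deriv (\<lambda>s. subleading Q ?k (s, w s)) s + Q (s, w s) * subleading Q ?k (s, w s)) * (deriv ^^ (?k - 1)) w s)
    (\<lambda>s. (deriv (lower_terms Q ?k w') s + Q (s, w' s) * lower_terms Q ?k w' s)
    + (deriv (\<lambda>s. subleading Q ?k (s, w' s)) s + Q (s, w' s) * subleading Q ?k (s, w' s)) * (deriv ^^ (?k - 1)) w' s)"
    by (intro same_jet_add[OF S t] same_jet_mult[OF S t] smooth_on_add smooth_on_mult smooth_on_deriv smooth_on_deriv_iter S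
        sG[OF Q] sG'[OF Q] sG[OF sub] sG'[OF sub] sL sL' w w' L L' e' dw c[OF Q] c[OF sub]) simp_all
  then have "same_jet j t (lower_terms Q (Suc ?k) w) (lower_terms Q (Suc ?k) w')"
    by (subst same_jet_cong[OF S t lower_terms_Suc[OF w] lower_terms_Suc[OF w']]) auto
  then show ?case by simp
qed

end

lemma Omega_iter_probe:
  assumes D: "open D" "smooth_on D Q" "(z0, w0) \<in> D" and n: "n \<ge> 2"
  shows "Omega_iter n Q (\<lambda>z. w0 + ((z - z0) ^ (n - 1) * t + (z - z0) ^ n * \<tau>)) z0
    = fact n * \<tau> + subleading Q n (z0, w0) * (fact (n - 1) * t) + Omega_iter n Q (\<lambda>z. w0) z0"
proof -
  define w where "w z = w0 + ((z - z0) ^ (n - 1) * t + (z - z0) ^ n * \<tau>)" for z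
  have w0: "w z0 = w0" using n by (simp add: w_def power_0_left)
  have sw: "smooth_on UNIV w" unfolding w_def[abs_def] by (intro smooth_on_intros) auto
  define S where "S = (\<lambda>z. (z, w z)) -` D \<inter> (\<lambda>z. (z, w0)) -` D"
  have S: "open S" "z0 \<in> S"
    unfolding S_def using D w0
    by (auto intro!: open_Int open_vimage continuous_intros smooth_on_continuous[OF sw])
  have dw: "(deriv ^^ i) w z0 = (if i = 0 then w0 else 0) + ((if n - 1 \<le> i then fact i / fact (i - (n - 1)) * (if i = n - 1 then t else 0) else 0)
      + (if n \<le> i then fact i / fact (i - n) * (if i = n then \<tau> else 0) else 0))" for i
  proof -
    have eq: "w = (\<lambda>z. 1 * w0 + 1 * (1 * ((z - z0) ^ (n - 1) * t) + 1 * ((z - z0) ^ n * \<tau>)))" by (auto simp: w_def)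
    show ?thesis
      unfolding eq
      by (subst deriv_iter_linear[OF open_UNIV], (intro smooth_on_intros open_UNIV UNIV_I)+,
          subst deriv_iter_linear[OF open_UNIV], (intro smooth_on_intros open_UNIV UNIV_I)+,
          subst (1 2) deriv_iter_power_mult[OF open_UNIV], (intro smooth_on_intros open_UNIV UNIV_I)+)
        (auto simp: deriv_iter_const)
  qed
  have "same_jet (n - 2) z0 w (\<lambda>z. w0)"
    unfolding same_jet_def using n by (auto simp: dw deriv_iter_const)
  then have "same_jet 0 z0 (lower_terms Q ((n - 2) + 2) w) (lower_terms Q ((n - 2) + 2) (\<lambda>z. w0))"
    by (intro same_jet_lower_terms[OF S(1) D(1,2) _ _ _ _ S(2)])
      (auto simp: S_def intro!: smooth_on_subset[OF sw] smooth_on_const S(1)[unfolded S_def])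
  then have "lower_terms Q n w z0 = lower_terms Q n (\<lambda>z. w0) z0"
    unfolding same_jet_0 le_add_diff_inverse2[OF n] .
  moreover have "(n = n - Suc 0) = False" "(n \<le> n - Suc 0) = False" using n by auto
  ultimately show ?thesis
    using n unfolding w_def[symmetric] by (simp add: lower_terms_def dw deriv_iter_const w0 algebra_simps)
qed

text \<open>
  Each application of \<open>g d/dz\<close> lowers the power of \<open>z - z\<^sub>0\<close> by one; the value and the first derivative
  of the cofactor at \<open>z\<^sub>0\<close> satisfy recursions with these closed forms.
\<close>

lemma fop_iter_monomial:
  fixes f g :: "real \<Rightarrow> real"
  assumes S: "open S" "z0 \<in> S" and g: "smooth_on S g" and f: "smooth_on S f"
  shows "j + r = m \<Longrightarrow> \<exists>h. smooth_on S h \<and> (\<forall>t\<in>S. (fop g (\<lambda>t. 0) ^^ j) (\<lambda>s. (s - z0) ^ m * f s) t = (t - z0) ^ r * h t) \<and>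
    h z0 = fact m / fact r * (g z0 ^ j * f z0) \<and>
    deriv h z0 = fact (Suc m) / fact (Suc r) * (g z0 ^ j * deriv f z0)
      + fact m / fact (Suc r) * (real j * (2 * real m - real j + 1) / 2) * (g z0 ^ (j - 1) * deriv g z0 * f z0)"
proof (induction j arbitrary: r)
  case 0
  then show ?case using f by (intro exI[of _ f]) auto
next
  case (Suc j)
  then obtain h where h: "smooth_on S h"
    "\<And>t. t \<in> S \<Longrightarrow> (fop g (\<lambda>t. 0) ^^ j) (\<lambda>s. (s - z0) ^ m * f s) t = (t - z0) ^ Suc r * h t"
    "h z0 = fact m / fact (Suc r) * (g z0 ^ j * f z0)"
    "deriv h z0 = fact (Suc m) / fact (Suc (Suc r)) * (g z0 ^ j * deriv f z0)
      + fact m / fact (Suc (Suc r)) * (real j * (2 * real m - real j + 1) / 2) * (g z0 ^ (j - 1) * deriv g z0 * f z0)"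
    using Suc.IH[of "Suc r"] by auto
  define h' where "h' t = real (Suc r) * (g t * h t) + (t - z0) * (g t * deriv h t)" for t
  have sh': "smooth_on S h'"
    unfolding h'_def[abs_def] by (intro smooth_on_intros smooth_on_deriv S g h)
  have dh: "(h has_real_derivative deriv h t) (at t)" "(g has_real_derivative deriv g t) (at t)"
    "(deriv h has_real_derivative deriv (deriv h) t) (at t)" if "t \<in> S" for t
    by (rule smooth_on_deriv_has_derivative[OF _ that], intro smooth_on_deriv S g h)+
  have "(fop g (\<lambda>t. 0) ^^ Suc j) (\<lambda>s. (s - z0) ^ m * f s) t = (t - z0) ^ r * h' t" if t: "t \<in> S" for t
  proof -
    have "deriv ((fop g (\<lambda>t. 0) ^^ j) (\<lambda>s. (s - z0) ^ m * f s)) t = deriv (\<lambda>t. (t - z0) ^ Suc r * h t) t"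
      by (rule deriv_cong_on_open[OF S(1) t]) (rule h(2))
    also have "\<dots> = real (Suc r) * (t - z0) ^ r * h t + (t - z0) ^ Suc r * deriv h t"
      by (rule DERIV_imp_deriv) (rule derivative_eq_intros dh[OF t] refl | simp)+
    finally have "deriv ((fop g (\<lambda>t. 0) ^^ j) (\<lambda>s. (s - z0) ^ m * f s)) t
        = real (Suc r) * (t - z0) ^ r * h t + (t - z0) ^ Suc r * deriv h t" .
    then show ?thesis
      unfolding fop_iter_Suc h'_def by (simp only:) (simp add: algebra_simps)
  qed
  moreover have "h' z0 = fact m / fact r * (g z0 ^ Suc j * f z0)"
    by (simp add: h'_def h(3))
  moreover have "deriv h' z0 = fact (Suc m) / fact (Suc r) * (g z0 ^ Suc j * deriv f z0)
      + fact m / fact (Suc r) * (real (Suc j) * (2 * real m - real (Suc j) + 1) / 2) * (g z0 ^ (Suc j - 1) * deriv g z0 * f z0)"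
  proof -
    have "(h' has_real_derivative real (Suc r) * (deriv g z0 * h z0 + g z0 * deriv h z0)
        + (1 * (g z0 * deriv h z0) + (z0 - z0) * (deriv g z0 * deriv h z0 + g z0 * deriv (deriv h) z0))) (at z0)"
      unfolding h'_def[abs_def] using dh[OF S(2)]
      by (auto intro!: derivative_eq_intros simp: algebra_simps)
    then have d: "deriv h' z0 = real (Suc r) * (deriv g z0 * h z0) + real (Suc (Suc r)) * (g z0 * deriv h z0)"
      by (simp add: DERIV_imp_deriv algebra_simps)
    have fr: "real (Suc (Suc r)) / fact (Suc (Suc r)) = 1 / fact (Suc r)" by simp
    have m: "real m = real j + real r + 1" using Suc.prems by auto
    have e: "real j * g z0 ^ (j - 1) * g z0 = real j * g z0 ^ j" by (cases j) auto
    have "real (Suc (Suc r)) * (g z0 * deriv h z0) = (real (Suc (Suc r)) / fact (Suc (Suc r))) *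
        (fact (Suc m) * (g z0 ^ Suc j * deriv f z0)
          + fact m * ((2 * real m - real j + 1) / 2) * ((real j * g z0 ^ (j - 1) * g z0) * deriv g z0 * f z0))"
      unfolding h(4) by (simp add: field_simps del: fact_Suc)
    note hh = this[unfolded fr e]
    have h3: "real (Suc r) * (deriv g z0 * h z0) = fact m / fact (Suc r) * (real (Suc r) * (g z0 ^ j * deriv g z0 * f z0))"
      by (simp add: h(3))
    have "deriv h' z0 = fact m / fact (Suc r) * (real (Suc r) * (g z0 ^ j * deriv g z0 * f z0))
        + 1 / fact (Suc r) * (fact (Suc m) * (g z0 ^ Suc j * deriv f z0)
          + fact m * ((2 * real m - real j + 1) / 2) * (real j * g z0 ^ j * deriv g z0 * f z0))"
      by (rule trans[OF d arg_cong2[where f = "(+)", OF h3 hh]])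
    also have "\<dots> = fact (Suc m) / fact (Suc r) * (g z0 ^ Suc j * deriv f z0)
      + fact m / fact (Suc r) * (real (Suc r) + real j * (2 * real m - real j + 1) / 2) * (g z0 ^ j * deriv g z0 * f z0)"
    proof -
      have "b / F * (R * (p * q * s)) + 1 / F * (M * y + b * (c / 2) * (J * p * q * s))
          = M / F * y + b / F * (R + J * c / 2) * (p * q * s)" if "F \<noteq> 0"
        for b F R p q s M y c J :: real
        using that by (simp add: field_simps)
      then show ?thesis using fact_nonzero by blast
    qed
    finally have fin: "deriv h' z0 = fact (Suc m) / fact (Suc r) * (g z0 ^ Suc j * deriv f z0)
      + fact m / fact (Suc r) * (real (Suc r) + real j * (2 * real m - real j + 1) / 2) * (g z0 ^ j * deriv g z0 * f z0)" .
    have c: "real (Suc r) + real j * (2 * real m - real j + 1) / 2 = real (Suc j) * (2 * real m - real (Suc j) + 1) / 2"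
      unfolding m by (simp add: field_simps)
    show ?thesis unfolding fin c by (simp only: diff_Suc_1)
  qed
  ultimately show ?case using sh' by (intro exI[of _ h'] conjI ballI)
qed

text \<open>
  Up to the factors \<open>n!\<close> and \<open>(n - 1)!\<close>, these are the two highest coefficients of the linear operator
  \<open>w \<mapsto> (g d/dz)\<^sup>n (f w)\<close>.
\<close>

lemma fop_iter_probe:
  fixes f g :: "real \<Rightarrow> real"
  assumes S: "open S" "z0 \<in> S" and g: "smooth_on S g" and f: "smooth_on S f" and n: "n \<ge> 1"
  shows "(fop g (\<lambda>t. 0) ^^ n) (\<lambda>s. (s - z0) ^ n * f s) z0 = fact n * (g z0 ^ n * f z0)"
    "(fop g (\<lambda>t. 0) ^^ n) (\<lambda>s. (s - z0) ^ (n - 1) * f s) z0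
      = fact (n - 1) * (real n * g z0 ^ n * deriv f z0 + real n * (real n - 1) / 2 * g z0 ^ (n - 1) * deriv g z0 * f z0)"
proof -
  show "(fop g (\<lambda>t. 0) ^^ n) (\<lambda>s. (s - z0) ^ n * f s) z0 = fact n * (g z0 ^ n * f z0)"
    using fop_iter_monomial[OF S g f, of n 0 n] S(2) by auto
  obtain m where m: "n = Suc m" using n by (cases n) auto
  obtain h where h: "\<And>t. t \<in> S \<Longrightarrow> (fop g (\<lambda>t. 0) ^^ m) (\<lambda>s. (s - z0) ^ m * f s) t = h t"
    "deriv h z0 = fact (Suc m) * (g z0 ^ m * deriv f z0)
      + fact m * (real m * (real m + 1) / 2) * (g z0 ^ (m - 1) * deriv g z0 * f z0)"
    using fop_iter_monomial[OF S g f, of m 0 m] by auto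
  have e: "real m * g z0 ^ (m - 1) * g z0 = real m * g z0 ^ m" by (cases m) auto
  have "(fop g (\<lambda>t. 0) ^^ Suc m) (\<lambda>s. (s - z0) ^ m * f s) z0 = g z0 * deriv h z0"
    unfolding fop_iter_Suc using deriv_cong_on_open[OF S, of "(fop g (\<lambda>t. 0) ^^ m) (\<lambda>s. (s - z0) ^ m * f s)" h] h(1)
    by simp
  also have "\<dots> = fact m * (real (Suc m) * g z0 ^ Suc m * deriv f z0
      + (real m + 1) / 2 * (real m * g z0 ^ (m - 1) * g z0) * deriv g z0 * f z0)"
    unfolding h(2) by (simp add: algebra_simps)
  finally show "(fop g (\<lambda>t. 0) ^^ n) (\<lambda>s. (s - z0) ^ (n - 1) * f s) z0
      = fact (n - 1) * (real n * g z0 ^ n * deriv f z0 + real n * (real n - 1) / 2 * g z0 ^ (n - 1) * deriv g z0 * f z0)"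
    unfolding e m by (simp add: algebra_simps)
qed

subsection \<open>Comparison with a linear equation\<close>

text \<open>
  The leading coefficient in \<open>x\<close> arises from choosing the summand \<open>x h\<close> in each factor.
\<close>

lemma fop_iter_affine_coefficient:
  assumes I: "open I" "smooth_on I q" "smooth_on I h"
  shows "\<exists>c. (\<forall>i. smooth_on I (c i)) \<and> (\<forall>z\<in>I. c k z = h z ^ k) \<and>
    (\<forall>z\<in>I. \<forall>x. (fop (\<lambda>z. 1) (\<lambda>z. q z + x * h z) ^^ k) (\<lambda>z. 1) z = (\<Sum>i\<le>k. c i z * x ^ i))"
proof (induction k)
  case 0
  show ?case
    by (rule exI[of _ "\<lambda>i z. if i = 0 then 1 else 0"]) (auto intro: smooth_on_const I)
next
  case (Suc k)
  then obtain c where c: "\<And>i. smooth_on I (c i)" "\<And>z. z \<in> I \<Longrightarrow> c k z = h z ^ k"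
    "\<And>z x. z \<in> I \<Longrightarrow> (fop (\<lambda>z. 1) (\<lambda>z. q z + x * h z) ^^ k) (\<lambda>z. 1) z = (\<Sum>i\<le>k. c i z * x ^ i)" by blast
  define c' where "c' i z = (if i \<le> k then deriv (c i) z + q z * c i z else 0) + (if i = 0 then 0 else h z * c (i - 1) z)" for i z
  have "smooth_on I (c' i)" for i
    unfolding c'_def[abs_def] using c(1)
    by (cases "i \<le> k"; cases "i = 0") (auto intro!: smooth_on_intros smooth_on_deriv I)
  moreover have "c' (Suc k) z = h z ^ Suc k" if "z \<in> I" for z using c(2)[OF that] by (simp add: c'_def)
  moreover have "(fop (\<lambda>z. 1) (\<lambda>z. q z + x * h z) ^^ Suc k) (\<lambda>z. 1) z = (\<Sum>i\<le>Suc k. c' i z * x ^ i)"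
    if z: "z \<in> I" for z x
  proof -
    have "deriv ((fop (\<lambda>z. 1) (\<lambda>z. q z + x * h z) ^^ k) (\<lambda>z. 1)) z = deriv (\<lambda>z. \<Sum>i\<le>k. c i z * x ^ i) z"
      by (rule deriv_cong_on_open[OF I(1) z]) (rule c(3))
    also have "\<dots> = (\<Sum>i\<le>k. deriv (c i) z * x ^ i)"
      by (rule DERIV_imp_deriv, rule DERIV_sum, rule DERIV_cmult_right,
          rule smooth_on_deriv_has_derivative[OF c(1) z])
    finally have d: "deriv ((fop (\<lambda>z. 1) (\<lambda>z. q z + x * h z) ^^ k) (\<lambda>z. 1)) z = (\<Sum>i\<le>k. deriv (c i) z * x ^ i)" .
    have "(\<Sum>i\<le>Suc k. c' i z * x ^ i) = (\<Sum>i\<le>Suc k. (if i \<le> k then deriv (c i) z + q z * c i z else 0) * x ^ i)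
        + (\<Sum>i\<le>Suc k. (if i = 0 then 0 else h z * c (i - 1) z) * x ^ i)"
      unfolding sum.distrib[symmetric] by (rule sum.cong) (auto simp: c'_def algebra_simps)
    also have "(\<Sum>i\<le>Suc k. (if i = 0 then 0 else h z * c (i - 1) z) * x ^ i) = (\<Sum>i\<le>k. h z * c i z * x ^ Suc i)"
      by (subst sum.atMost_Suc_shift) simp
    also have "(\<Sum>i\<le>Suc k. (if i \<le> k then deriv (c i) z + q z * c i z else 0) * x ^ i)
        = (\<Sum>i\<le>k. (deriv (c i) z + q z * c i z) * x ^ i)" by simp
    finally show ?thesis
      unfolding fop_iter_Suc d c(3)[OF z]
      by (simp add: algebra_simps sum.distrib sum_distrib_left)
  qed
  ultimately show ?case by (intro exI[of _ c'] conjI allI ballI)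
qed

text \<open>
  Comparison of the coefficients of \<open>w\<^sup>(\<^sup>n\<^sup>-\<^sup>1\<^sup>)\<close> yields \<open>n Q + w Q\<^sub>w = n q(z)\<close>, hence \<open>Q = q + h w\<^sup>-\<^sup>n\<close>.
  For constant \<open>w\<close> the equation is a polynomial of degree \<open>n\<close> in \<open>w\<^sup>-\<^sup>n\<close> with leading coefficient \<open>h\<^sup>n\<close>,
  multiplied by \<open>w\<close>, and has to be affine in \<open>w\<close>. As \<open>n \<ge> 2\<close>, this forces \<open>h = 0\<close> and the absence of
  an inhomogeneous term.
\<close>

lemma linear_parameter_function:
  fixes g R T :: "real \<Rightarrow> real"
  assumes n: "n \<ge> 2" and I: "open I" and e: "e > 0" and J0: "0 \<notin> ball w1 e"
    and Q: "smooth_on (I \<times> ball w1 e) Q"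
    and sm: "smooth_on I g" "smooth_on I R" "smooth_on I T" and nz: "\<And>z. z \<in> I \<Longrightarrow> g z \<noteq> 0" "\<And>z. z \<in> I \<Longrightarrow> R z \<noteq> 0"
    and zero: "\<And>z0 w. z0 \<in> I \<Longrightarrow> smooth_on UNIV w \<Longrightarrow> w z0 \<in> ball w1 e \<Longrightarrow>
      (fop g (\<lambda>z. 0) ^^ n) (\<lambda>z. R z * w z + T z) z0 = 0 \<longleftrightarrow> Omega_iter n Q w z0 = 0"
    and z0: "z0 \<in> I"
  shows "(fop g (\<lambda>z. 0) ^^ n) T z0 = 0"
    and "w \<in> ball w1 e \<Longrightarrow> Q (z0, w) = deriv R z0 / R z0 + (real n - 1) / 2 * (deriv g z0 / g z0)"
proof -
  let ?J = "ball w1 e" let ?D = "I \<times> ball w1 e"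
  have D: "open ?D" by (intro open_Times I open_ball)
  define q where "q z = deriv R z / R z + (real n - 1) / 2 * (deriv g z / g z)" for z
  define a where "a = (fop g (\<lambda>z. 0) ^^ n) R"
  define N where "N = (fop g (\<lambda>z. 0) ^^ n) T"
  define v where "v z w = Omega_iter n Q (\<lambda>z. w) z" for z w
  have c0: "smooth_on I (\<lambda>z. 0::real)" by (rule smooth_on_const[OF I])
  have coeffs: "w * a z + N z = v z w * (g z ^ n * R z)" "subleading Q n (z, w) = of_nat n * q z"
    if z: "z \<in> I" and w: "w \<in> ?J" for z w
  proof -
    let ?P1 = "(fop g (\<lambda>z. 0) ^^ n) (\<lambda>s. (s - z) ^ (n - 1) * R s) z"
    let ?P2 = "(fop g (\<lambda>z. 0) ^^ n) (\<lambda>s. (s - z) ^ n * R s) z"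
    have P: "?P2 = fact n * (g z ^ n * R z)"
      "?P1 = fact (n - 1) * (real n * g z ^ n * deriv R z + real n * (real n - 1) / 2 * g z ^ (n - 1) * deriv g z * R z)"
      using fop_iter_probe[OF I z sm(1,2)] n by auto
    have iff: "w * a z + N z + t * ?P1 + \<tau> * ?P2 = 0 \<longleftrightarrow>
        fact n * \<tau> + subleading Q n (z, w) * (fact (n - 1) * t) + v z w = 0" for t \<tau>
    proof -
      let ?w = "\<lambda>s. w + ((s - z) ^ (n - 1) * t + (s - z) ^ n * \<tau>)"
      have "(\<lambda>s. R s * ?w s + T s) = (\<lambda>s. 1 * (w * R s + 1 * T s) + 1 * (t * ((s - z) ^ (n - 1) * R s) + \<tau> * ((s - z) ^ n * R s)))"
        by (auto simp: algebra_simps)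
      moreover have "(fop g (\<lambda>z. 0) ^^ n) (\<lambda>s. 1 * (w * R s + 1 * T s) + 1 * (t * ((s - z) ^ (n - 1) * R s) + \<tau> * ((s - z) ^ n * R s))) z
          = 1 * (w * a z + 1 * N z) + 1 * (t * ?P1 + \<tau> * ?P2)"
      proof -
        have s: "smooth_on I (\<lambda>s. w * R s + 1 * T s)" "smooth_on I (\<lambda>s. (s - z) ^ k * R s)"
          "smooth_on I (\<lambda>s. t * ((s - z) ^ (n - 1) * R s) + \<tau> * ((s - z) ^ n * R s))" for k
          by (intro smooth_on_add smooth_on_mult smooth_on_power smooth_on_diff smooth_on_const smooth_on_ident I sm)+
        show ?thesis
          unfolding fop_iter_linear[OF I sm(1) c0 s(1,3) z] fop_iter_linear[OF I sm(1) c0 sm(2,3) z]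
            fop_iter_linear[OF I sm(1) c0 s(2,2) z] a_def N_def ..
      qed
      ultimately have "(fop g (\<lambda>z. 0) ^^ n) (\<lambda>s. R s * ?w s + T s) z = w * a z + N z + t * ?P1 + \<tau> * ?P2"
        by simp
      moreover have "smooth_on UNIV ?w" by (intro smooth_on_intros open_UNIV)
      moreover have "?w z \<in> ?J" using w n by (simp add: power_0_left)
      moreover have "Omega_iter n Q ?w z = fact n * \<tau> + subleading Q n (z, w) * (fact (n - 1) * t) + v z w"
        unfolding v_def by (rule Omega_iter_probe[OF D Q _ n]) (use z w in auto)
      ultimately show ?thesis using zero[OF z, of ?w] by simp
    qed
    \<comment> \<open>Both equations are affine in \<open>t\<close> and \<open>\<tau>\<close> with the same zeros, hence proportional. The zeros
      with \<open>t = 0\<close> and with \<open>t = 1\<close> determine the ratios.\<close>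
    show 1: "w * a z + N z = v z w * (g z ^ n * R z)"
    proof -
      have "fact n * (- v z w / fact n) + subleading Q n (z, w) * (fact (n - 1) * 0) + v z w = 0" by simp
      from this[folded iff] show ?thesis unfolding P by simp
    qed
    define \<sigma> where "\<sigma> = subleading Q n (z, w) * fact (n - 1)"
    have "fact n * (- (\<sigma> + v z w) / fact n) + subleading Q n (z, w) * (fact (n - 1) * 1) + v z w = 0"
      by (simp add: \<sigma>_def)
    from this[folded iff] have "w * a z + N z + 1 * ?P1 + - (\<sigma> + v z w) / fact n * ?P2 = 0" .
    then have "v z w * (g z ^ n * R z) + ?P1 = (\<sigma> + v z w) * (g z ^ n * R z)"
    proof -
      have "- y / F * (F * x) = - (y * x)" if "F \<noteq> 0" for x y F :: real using that by simp
      then have x: "- (\<sigma> + v z w) / fact n * (fact n * x) = - ((\<sigma> + v z w) * x)" for x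
        using fact_nonzero by blast
      from \<open>w * a z + N z + 1 * ?P1 + - (\<sigma> + v z w) / fact n * ?P2 = 0\<close>[unfolded 1 P(1) x mult_1]
      show ?thesis by linarith
    qed
    then have "?P1 = \<sigma> * (g z ^ n * R z)" by (simp add: algebra_simps)
    then have "real n * g z ^ n * deriv R z + real n * (real n - 1) / 2 * g z ^ (n - 1) * deriv g z * R z
        = subleading Q n (z, w) * (g z ^ n * R z)"
      unfolding P \<sigma>_def by simp
    moreover have "g z ^ n = g z ^ (n - 1) * g z" using n by (simp add: power_eq_if)
    ultimately have "g z ^ (n - 1) * (real n * g z * deriv R z + real n * (real n - 1) / 2 * deriv g z * R z)
        = g z ^ (n - 1) * (subleading Q n (z, w) * (g z * R z))"
      by (simp add: algebra_simps)
    then have "real n * g z * deriv R z + real n * (real n - 1) / 2 * deriv g z * R z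
        = subleading Q n (z, w) * (g z * R z)"
      using nz(1)[OF z] by simp
    then have "subleading Q n (z, w) = (real n * g z * deriv R z + real n * (real n - 1) / 2 * deriv g z * R z) / (g z * R z)"
      using nz z by simp
    also have "\<dots> = real n * q z"
      using nz z unfolding q_def by (simp add: field_simps)
    finally show "subleading Q n (z, w) = of_nat n * q z" .
  qed
  define h where "h z = w1 ^ n * (Q (z, w1) - q z)" for z
  have w1: "w1 \<in> ?J" using e by simp
  have wn0: "w \<noteq> 0" if "w \<in> ?J" for w using that J0 by auto
  have Qh: "Q (z, w) = q z + (1 / w) ^ n * h z" if z: "z \<in> I" and w: "w \<in> ?J" for z w
  proof -
    have "((\<lambda>w. w ^ n * (Q (z, w) - q z)) has_real_derivative 0) (at w within ?J)" if w: "w \<in> ?J" for w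
    proof -
      have "((\<lambda>w. Q (z, w)) has_real_derivative partial2 Q (z, w)) (at w)"
        using has_real_derivative_along_partial[OF D Q, of "\<lambda>t. z" 0 w "\<lambda>t. t" 1] z w by auto
      then have "((\<lambda>w. w ^ n * (Q (z, w) - q z)) has_real_derivative
          real n * w ^ (n - 1) * (Q (z, w) - q z) + w ^ n * partial2 Q (z, w)) (at w)"
        by (auto intro!: derivative_eq_intros)
      moreover have "real n * w ^ (n - 1) * (Q (z, w) - q z) + w ^ n * partial2 Q (z, w)
          = w ^ (n - 1) * (subleading Q n (z, w) - real n * q z)"
        using n by (simp add: subleading_def algebra_simps power_eq_if)
      ultimately show ?thesis using coeffs(2)[OF z w] by (simp add: has_field_derivative_at_within)
    qed
    from has_field_derivative_zero_constant[OF convex_ball this]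
    have "w ^ n * (Q (z, w) - q z) = h z" using w w1 unfolding h_def by auto
    then show ?thesis using wn0[OF w] by (simp add: field_simps)
  qed
  have sq: "smooth_on I q" unfolding q_def[abs_def]
    using nz by (intro smooth_on_add smooth_on_mult smooth_on_divide smooth_on_const smooth_on_deriv I sm) auto
  have sh: "smooth_on I h" unfolding h_def[abs_def]
    by (intro smooth_on_mult smooth_on_diff smooth_on_const I sq smooth_on_compose[OF Q I D]
        smooth_on_Pair smooth_on_ident) (use w1 in auto)
  obtain c where c: "\<And>z. z \<in> I \<Longrightarrow> c n z = h z ^ n"
    "\<And>z x. z \<in> I \<Longrightarrow> (fop (\<lambda>z. 1) (\<lambda>z. q z + x * h z) ^^ n) (\<lambda>z. 1) z = (\<Sum>i\<le>n. c i z * x ^ i)"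
    using fop_iter_affine_coefficient[OF I sq sh, of n] by blast
  define G where "G z = g z ^ n * R z" for z
  define p where "p z = smult (G z) (\<Sum>i\<le>n. monom (c i z) (n * i)) - [:a z, N z:]" for z
  have p0: "p z = 0" if z: "z \<in> I" for z
  proof -
    have "poly (p z) (1 / w) = 0" if w: "w \<in> ?J" for w
    proof -
      let ?x = "(1 / w) ^ n"
      have s1: "smooth_on I (\<lambda>z. 1::real)" by (rule smooth_on_const[OF I])
      have sB: "smooth_on I (\<lambda>z. q z + ?x * h z)" by (intro smooth_on_add smooth_on_mult smooth_on_const I sq sh)
      have "v z w = (fop (\<lambda>z. 1) (\<lambda>z. q z + ?x * h z) ^^ n) (\<lambda>z. w * 1 + 0 * 1) z"
        unfolding v_def Omega_iter_eq_fop by (rule fop_iter_cong[OF I _ _ _ z]) (use Qh w in auto)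
      also have "\<dots> = w * (\<Sum>i\<le>n. c i z * ?x ^ i)"
        unfolding fop_iter_linear[OF I s1 sB s1 s1 z] c(2)[OF z] by simp
      finally have "w * a z + N z = G z * w * (\<Sum>i\<le>n. c i z * ?x ^ i)"
        using coeffs(1)[OF z w] by (simp add: G_def)
      then have "a z + N z / w = G z * (\<Sum>i\<le>n. c i z * ?x ^ i)" using wn0[OF w] by (simp add: field_simps)
      then show ?thesis by (simp add: p_def poly_sum poly_monom power_mult)
    qed
    then have "(\<lambda>w. 1 / w) ` ?J \<subseteq> {x. poly (p z) x = 0}" by auto
    moreover have "infinite ?J" using e by (simp add: ball_eq_greaterThanLessThan infinite_Ioo)
    then have "infinite ((\<lambda>w. 1 / w) ` ?J)" by (subst finite_image_iff) (auto simp: inj_on_def)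
    ultimately show "p z = 0" using poly_roots_finite[of "p z"] finite_subset by blast
  qed
  have cm: "coeff (\<Sum>i\<le>n. monom (c i z) (n * i)) m = (\<Sum>i\<le>n. if n * i = m then c i z else 0)" for z m
    by (simp add: coeff_sum)
  have G0: "G z \<noteq> 0" if "z \<in> I" for z using nz that by (simp add: G_def)
  have "coeff (p z0) 1 = - N z0"
  proof -
    have "(\<Sum>i\<le>n. if n * i = 1 then c i z0 else 0) = 0" using n by (intro sum.neutral) auto
    then show ?thesis by (simp add: p_def cm)
  qed
  then show "(fop g (\<lambda>z. 0) ^^ n) T z0 = 0" using p0[OF z0] by (simp add: N_def)
  have "coeff (p z0) (n * n) = G z0 * c n z0"
  proof -
    have "(\<Sum>i\<le>n. if n * i = n * n then c i z0 else 0) = c n z0" using n by (simp add: sum.delta)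
    moreover have "2 \<le> n * n" using n mult_le_mono[of 2 n 1 n] by simp
    then obtain k where "n * n = Suc (Suc k)" by (metis add_2_eq_Suc le_Suc_ex)
    then have "coeff [:a z0, N z0:] (n * n) = 0" by simp
    ultimately show ?thesis by (simp add: p_def cm)
  qed
  then have "h z0 ^ n = 0" using p0[OF z0] G0[OF z0] c(1)[OF z0] by simp
  then have "h z0 = 0" by simp
  then show "w \<in> ?J \<Longrightarrow> Q (z0, w) = deriv R z0 / R z0 + (real n - 1) / 2 * (deriv g z0 / g z0)"
    using Qh[OF z0] by (simp add: q_def)
qed

section \<open>A characterisation of projective maps of an interval\<close>

text \<open>
  Dividing the relations for two base points \<open>a\<close> and \<open>b\<close> eliminates \<open>f\<close>: the \<open>m\<close>-th power of the
  quotient of the two difference quotients of \<open>\<rho>\<close> is constant. Both difference quotients have the sign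
  of \<open>\<rho>'\<close>, so their quotient is positive and itself constant, and this equation can be solved for
  \<open>\<rho>(z)\<close>.
\<close>

lemma projective_of_power_quotients:
  fixes \<rho> f :: "real \<Rightarrow> real"
  assumes K: "open K" "is_interval K" "K \<noteq> {}" and \<rho>: "smooth_on K \<rho>" "\<And>z. z \<in> K \<Longrightarrow> deriv \<rho> z \<noteq> 0"
    and m: "m \<ge> 1" and f: "\<And>z. z \<in> K \<Longrightarrow> f z \<noteq> 0"
    and C: "\<And>a. a \<in> K \<Longrightarrow> \<exists>C. \<forall>z\<in>K. f z * (\<rho> z - \<rho> a) ^ m = C * (z - a) ^ m"
  shows "\<exists>k1 k2 k3 k4. (k4 = 0 \<or> k4 = 1) \<and> k2 * k3 - k1 * k4 \<noteq> 0 \<and>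
    (\<forall>z\<in>K. k4 * z + k3 \<noteq> 0 \<and> \<rho> z = (k2 * z + k1) / (k4 * z + k3))"
proof -
  have d: "(\<rho> has_real_derivative deriv \<rho> z) (at z)" if "z \<in> K" for z
    by (rule smooth_on_deriv_has_derivative[OF \<rho>(1) that])
  have inj: "inj_on \<rho> K" by (rule inj_on_deriv_nonzero[OF K(2) d \<rho>(2)])
  have "connected (deriv \<rho> ` K)"
    using K(2) by (intro connected_continuous_image smooth_on_continuous smooth_on_deriv K(1) \<rho>)
      (simp add: is_interval_connected_1)
  then have "deriv \<rho> u * deriv \<rho> v > 0" if "u \<in> K" "v \<in> K" for u v
    using connectedD_interval[of "deriv \<rho> ` K" "deriv \<rho> u" "deriv \<rho> v" 0]
      connectedD_interval[of "deriv \<rho> ` K" "deriv \<rho> v" "deriv \<rho> u" 0] that \<rho>(2)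
    by (smt (verit) imageE imageI mult_neg_neg mult_pos_pos)
  moreover have mvt: "\<exists>u\<in>K. \<rho> z - \<rho> a = (z - a) * deriv \<rho> u" if az: "a \<in> K" "z \<in> K" "a < z" for a z
  proof -
    have "t \<in> K" if "a \<le> t" "t \<le> z" for t using mem_is_interval_1_I[OF K(2) az(1,2) that] .
    then show ?thesis using MVT2[OF az(3), of \<rho> "deriv \<rho>"] d by (metis less_imp_le)
  qed
  then have mvt': "\<exists>u\<in>K. \<rho> z - \<rho> a = (z - a) * deriv \<rho> u" if "a \<in> K" "z \<in> K" "a \<noteq> z" for a z
    using mvt[of a z] mvt[of z a] that by (metis linorder_neqE_linordered_idom minus_diff_eq minus_mult_left)
  ultimately have pos: "(\<rho> z - \<rho> a) / (z - a) * ((\<rho> z - \<rho> b) / (z - b)) > 0"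
    if "a \<in> K" "b \<in> K" "z \<in> K" "z \<noteq> a" "z \<noteq> b" for a b z
  proof -
    obtain u v where "u \<in> K" "v \<in> K" "\<rho> z - \<rho> a = (z - a) * deriv \<rho> u" "\<rho> z - \<rho> b = (z - b) * deriv \<rho> v"
      using mvt'[of a z] mvt'[of b z] \<open>a \<in> K\<close> \<open>b \<in> K\<close> \<open>z \<in> K\<close> \<open>z \<noteq> a\<close> \<open>z \<noteq> b\<close> by metis
    then show ?thesis using \<open>\<And>u v. u \<in> K \<Longrightarrow> v \<in> K \<Longrightarrow> deriv \<rho> u * deriv \<rho> v > 0\<close> that by simp
  qed
  obtain a e where a: "a \<in> K" "e > 0" "ball a e \<subseteq> K"
    using K(1,3) open_contains_ball by blast
  define b where "b = a + e / 3"
  define c where "c = a + e / 2"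
  have bc: "b \<in> K" "c \<in> K" "a \<noteq> b" "c \<noteq> a" "c \<noteq> b"
    using a by (auto simp: b_def c_def dist_real_def subset_iff)
  obtain Ca where Ca: "\<And>z. z \<in> K \<Longrightarrow> f z * (\<rho> z - \<rho> a) ^ m = Ca * (z - a) ^ m" using C[OF a(1)] by blast
  obtain Cb where Cb: "\<And>z. z \<in> K \<Longrightarrow> f z * (\<rho> z - \<rho> b) ^ m = Cb * (z - b) ^ m" using C[OF bc(1)] by blast
  define X where "X z = ((\<rho> z - \<rho> a) / (z - a)) / ((\<rho> z - \<rho> b) / (z - b))" for z
  have Xpos: "X z > 0" if "z \<in> K" "z \<noteq> a" "z \<noteq> b" for z
  proof -
    have "0 < x / y" if "0 < x * y" for x y :: real
      using that by (simp add: zero_less_divide_iff zero_less_mult_iff)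
    from this[OF pos[OF a(1) bc(1) that]] show ?thesis by (simp only: X_def)
  qed
  have Xm: "X z ^ m = Ca / Cb" if z: "z \<in> K" "z \<noteq> a" "z \<noteq> b" for z
  proof -
    have nz: "\<rho> z - \<rho> a \<noteq> 0" "\<rho> z - \<rho> b \<noteq> 0" "z - a \<noteq> 0" "z - b \<noteq> 0"
      using inj z a(1) bc(1) by (auto simp: inj_on_def)
    have e: "((\<rho> z - \<rho> a) / (z - a)) ^ m = Ca / f z" "((\<rho> z - \<rho> b) / (z - b)) ^ m = Cb / f z"
      using Ca[OF z(1)] Cb[OF z(1)] nz f[OF z(1)] by (simp_all add: power_divide field_simps)
    show ?thesis
      unfolding X_def power_divide[of "(\<rho> z - \<rho> a) / (z - a)" "(\<rho> z - \<rho> b) / (z - b)"] e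
      using f[OF z(1)] by simp
  qed
  define k where "k = X c"
  have k: "k > 0" using Xpos bc by (simp add: k_def)
  have cross: "(\<rho> z - \<rho> a) * (z - b) = k * (\<rho> z - \<rho> b) * (z - a)" if z: "z \<in> K" for z
  proof (cases "z = a \<or> z = b")
    case False
    then have "X z ^ m = k ^ m" using Xm[OF z] Xm[OF bc(2)] bc by (simp add: k_def)
    then have "X z = k"
      by (rule power_eq_imp_eq_base) (use Xpos[OF z] False k m in auto)
    have \<rho>zb: "\<rho> z - \<rho> b \<noteq> 0" using inj z bc(1) False by (auto simp: inj_on_def)
    have gen: "p * t = k * r * s" if "(p / s) / (r / t) = k" "r \<noteq> 0" "s \<noteq> 0" "t \<noteq> 0" for p r s t :: real
      using that by (auto simp: field_simps)
    show ?thesis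
      by (rule gen[OF \<open>X z = k\<close>[unfolded X_def] \<rho>zb]) (use False in auto)
  qed auto
  have \<rho>ab: "\<rho> a \<noteq> \<rho> b" using inj a(1) bc by (auto simp: inj_on_def)
  define l4 l3 l2 l1 where "l4 = 1 - k" and "l3 = k * a - b" and "l2 = \<rho> a - k * \<rho> b" and "l1 = k * \<rho> b * a - \<rho> a * b"
  have frac: "\<rho> z * (l4 * z + l3) = l2 * z + l1" if "z \<in> K" for z
    using cross[OF that] by (simp add: l4_def l3_def l2_def l1_def algebra_simps)
  have den: "l4 * z + l3 \<noteq> 0" if z: "z \<in> K" for z
  proof
    assume 0: "l4 * z + l3 = 0"
    then have 1: "z - b = k * (z - a)" by (simp add: l4_def l3_def algebra_simps)
    have "l2 * z + l1 = 0" using frac[OF z] 0 by simp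
    then have "\<rho> a * (z - b) = \<rho> b * (k * (z - a))"
      by (simp add: l2_def l1_def algebra_simps)
    then have "z = b" unfolding 1[symmetric] using \<rho>ab by simp
    then show False using 1 k bc by simp
  qed
  have det: "l2 * l3 - l1 * l4 = k * (\<rho> a - \<rho> b) * (a - b)"
    by (simp add: l4_def l3_def l2_def l1_def algebra_simps)
  then have det0: "l2 * l3 - l1 * l4 \<noteq> 0" using k \<rho>ab bc by simp
  show ?thesis
  proof (cases "l4 = 0")
    case True
    then show ?thesis using det0 den frac
      by (intro exI[of _ l1] exI[of _ l2] exI[of _ l3] exI[of _ l4]) (auto simp: field_simps)
  next
    case False
    have den': "z + l3 / l4 = (l4 * z + l3) / l4" for z using False by (simp add: field_simps)
    have "(l2 / l4) * (l3 / l4) - (l1 / l4) * 1 = (l2 * l3 - l1 * l4) / (l4 * l4)" using False by (simp add: field_simps)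
    then have "(l2 / l4) * (l3 / l4) - (l1 / l4) * 1 \<noteq> 0" using det0 False by simp
    moreover have "\<rho> z = (l2 / l4 * z + l1 / l4) / (1 * z + l3 / l4)" "1 * z + l3 / l4 \<noteq> 0" if "z \<in> K" for z
    proof -
      have "l2 / l4 * z + l1 / l4 = (l2 * z + l1) / l4" by (simp add: add_divide_distrib)
      then show "\<rho> z = (l2 / l4 * z + l1 / l4) / (1 * z + l3 / l4)"
        using frac[OF that, symmetric] den[OF that] False by (simp add: den')
      show "1 * z + l3 / l4 \<noteq> 0" using den[OF that] False by (simp add: den')
    qed
    ultimately show ?thesis
      by (intro exI[of _ "l1 / l4"] exI[of _ "l2 / l4"] exI[of _ "l3 / l4"] exI[of _ 1]) auto
  qed
qed

section \<open>Equivalence transformations of equations of order at least two\<close>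

lemma fop_iter_zero_of_const:
  assumes "open S" "t \<in> S" "\<And>s. s \<in> S \<Longrightarrow> u s = c" "k \<ge> 1"
  shows "(fop g (\<lambda>t. 0) ^^ k) u t = 0"
proof -
  have z: "(fop g (\<lambda>t. 0) ^^ j) (\<lambda>t. 0) = (\<lambda>t. 0)" for j
    by (induction j) (auto simp: fop_def)
  obtain j where j: "k = Suc j" using assms(4) by (cases k) auto
  have "(fop g (\<lambda>t. 0) ^^ k) u t = (fop g (\<lambda>t. 0) ^^ k) (\<lambda>t. c) t"
    by (rule fop_iter_cong[OF assms(1) _ _ _ assms(2)]) (use assms(3) in auto)
  also have "\<dots> = (fop g (\<lambda>t. 0) ^^ j) (fop g (\<lambda>t. 0) (\<lambda>t. c)) t"
    unfolding j by (simp only: funpow_Suc_right o_apply)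
  also have "fop g (\<lambda>t. 0) (\<lambda>t. c) = (\<lambda>t. 0)" by (auto simp: fop_def)
  finally show ?thesis by (simp add: z)
qed

lemma fop_iter_coordinate_power_eq_0:
  assumes S: "open S" and x: "smooth_on S x" "\<And>t. t \<in> S \<Longrightarrow> g t * deriv x t = 1" and t: "t \<in> S"
  shows "m < k \<Longrightarrow> (fop g (\<lambda>t. 0) ^^ k) (\<lambda>t. c * x t ^ m) t = 0"
proof (induction k arbitrary: m c)
  case (Suc k)
  have "(fop g (\<lambda>t. 0) ^^ Suc k) (\<lambda>t. c * x t ^ m) t = (fop g (\<lambda>t. 0) ^^ k) (fop g (\<lambda>t. 0) (\<lambda>t. c * x t ^ m)) t"
    by (simp only: funpow_Suc_right o_apply)
  also have "\<dots> = (fop g (\<lambda>t. 0) ^^ k) (\<lambda>t. (c * real m) * x t ^ (m - 1)) t"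
  proof (rule fop_iter_cong[OF S _ _ _ t])
    fix s assume s: "s \<in> S"
    have "((\<lambda>t. c * x t ^ m) has_real_derivative c * (real m * x s ^ (m - 1) * deriv x s)) (at s)"
      by (auto intro!: derivative_eq_intros smooth_on_deriv_has_derivative[OF x(1) s])
    then have "fop g (\<lambda>t. 0) (\<lambda>t. c * x t ^ m) s = (c * real m * x s ^ (m - 1)) * (g s * deriv x s)"
      by (simp add: fop_def DERIV_imp_deriv)
    then show "fop g (\<lambda>t. 0) (\<lambda>t. c * x t ^ m) s = (c * real m) * x s ^ (m - 1)" using x(2)[OF s] by simp
  qed auto
  also have "\<dots> = 0"
  proof (cases m)
    case 0
    show ?thesis
    proof (cases k)
      case (Suc k')
      then show ?thesis using fop_iter_zero_of_const[OF S t, of _ 0 k g] 0 by simp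
    qed (simp add: 0)
  next
    case (Suc m')
    then show ?thesis using Suc.prems by (intro Suc.IH) simp
  qed
  finally show ?case .
qed simp

lemma fop_iter_vanishing:
  assumes S: "open S" and A: "smooth_on S A" and B: "smooth_on S B" and x: "smooth_on S x" and u: "smooth_on S u"
    and a: "a \<in> S" "x a = 0" and k: "k < m"
  shows "(fop A B ^^ k) (\<lambda>t. x t ^ m * u t) a = 0"
proof -
  have "k \<le> m \<Longrightarrow> \<exists>h. smooth_on S h \<and> (\<forall>t\<in>S. (fop A B ^^ k) (\<lambda>t. x t ^ m * u t) t = x t ^ (m - k) * h t)"
  proof (induction k)
    case 0
    then show ?case using u by (intro exI[of _ u]) auto
  next
    case (Suc k)
    then obtain h where h: "smooth_on S h"
      "\<And>t. t \<in> S \<Longrightarrow> (fop A B ^^ k) (\<lambda>t. x t ^ m * u t) t = x t ^ (m - k) * h t" by auto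
    define j where "j = m - Suc k"
    have j: "m - k = Suc j" using Suc.prems by (simp add: j_def)
    define h' where "h' t = A t * (real (Suc j) * deriv x t * h t + x t * deriv h t) + B t * (x t * h t)" for t
    have "smooth_on S h'"
      unfolding h'_def[abs_def] by (intro smooth_on_add smooth_on_mult smooth_on_const smooth_on_deriv S A B x h)
    moreover have "(fop A B ^^ Suc k) (\<lambda>t. x t ^ m * u t) t = x t ^ j * h' t" if t: "t \<in> S" for t
    proof -
      have "deriv ((fop A B ^^ k) (\<lambda>t. x t ^ m * u t)) t = deriv (\<lambda>t. x t ^ Suc j * h t) t"
        by (rule deriv_cong_on_open[OF S t]) (simp only: h(2) j)
      also have "\<dots> = real (Suc j) * x t ^ j * deriv x t * h t + x t ^ Suc j * deriv h t"
        by (rule DERIV_imp_deriv)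
          (rule derivative_eq_intros smooth_on_deriv_has_derivative[OF x t] smooth_on_deriv_has_derivative[OF h(1) t] refl | simp)+
      finally have "deriv ((fop A B ^^ k) (\<lambda>t. x t ^ m * u t)) t
        = real (Suc j) * x t ^ j * deriv x t * h t + x t ^ Suc j * deriv h t" .
      then show ?thesis
        unfolding fop_iter_Suc h(2)[OF t] j by (simp only: h'_def) (simp add: algebra_simps)
    qed
    ultimately show ?case unfolding j_def by blast
  qed
  then obtain h where "(fop A B ^^ k) (\<lambda>t. x t ^ m * u t) a = x a ^ (m - k) * h a" using k a by auto
  then show ?thesis using a k by (simp add: power_0_left)
qed

lemma deriv_iter_exponential_gauge:
  assumes S: "open S" and q: "smooth_on S q" and u: "smooth_on S u"
    and E: "\<And>t. t \<in> S \<Longrightarrow> (E has_real_derivative E t * q t) (at t)" and t: "t \<in> S"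
  shows "(deriv ^^ k) (\<lambda>t. E t * u t) t = E t * (fop (\<lambda>t. 1) q ^^ k) u t"
  using t
proof (induction k arbitrary: t)
  case (Suc k)
  let ?v = "(fop (\<lambda>t. 1) q ^^ k) u"
  have "deriv ((deriv ^^ k) (\<lambda>t. E t * u t)) t = deriv (\<lambda>t. E t * ?v t) t"
    using Suc by (intro deriv_cong_on_open[OF S]) auto
  also have "\<dots> = E t * q t * ?v t + E t * deriv ?v t"
    by (rule DERIV_imp_deriv)
      (auto intro!: derivative_eq_intros E Suc.prems
        fop_iter_has_derivative[OF S smooth_on_const[OF S] q u Suc.prems])
  finally show ?case unfolding fop_iter_Suc by (simp add: algebra_simps)
qed simp

lemma monomial_of_deriv_iter:
  fixes \<phi> :: "real \<Rightarrow> real"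
  assumes K: "is_interval K" "a \<in> K"
  shows "(\<And>k z. z \<in> K \<Longrightarrow> ((deriv ^^ k) \<phi> has_real_derivative (deriv ^^ Suc k) \<phi> z) (at z)) \<Longrightarrow>
    (\<And>z. z \<in> K \<Longrightarrow> (deriv ^^ Suc m) \<phi> z = 0) \<Longrightarrow> (\<And>k. k < m \<Longrightarrow> (deriv ^^ k) \<phi> a = 0) \<Longrightarrow>
    \<exists>C. \<forall>z\<in>K. \<phi> z = C * (z - a) ^ m"
proof (induction m arbitrary: \<phi>)
  case 0
  have "(\<phi> has_real_derivative 0) (at z within K)" if "z \<in> K" for z
    using 0(1)[OF that, of 0] 0(2)[OF that] by (simp add: has_field_derivative_at_within)
  from has_field_derivative_zero_constant[OF _ this] show ?case
    using K(1) by (simp add: is_interval_convex_1)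
next
  case (Suc m)
  obtain C where C: "\<And>z. z \<in> K \<Longrightarrow> deriv \<phi> z = C * (z - a) ^ m"
  proof -
    have "\<exists>C. \<forall>z\<in>K. deriv \<phi> z = C * (z - a) ^ m"
    proof (rule Suc.IH)
      show "((deriv ^^ k) (deriv \<phi>) has_real_derivative (deriv ^^ Suc k) (deriv \<phi>) z) (at z)" if "z \<in> K" for k z
        using Suc.prems(1)[OF that, of "Suc k"] unfolding deriv_iter_Suc_right .
      show "(deriv ^^ Suc m) (deriv \<phi>) z = 0" if "z \<in> K" for z
        using Suc.prems(2)[OF that] unfolding deriv_iter_Suc_right .
      show "(deriv ^^ k) (deriv \<phi>) a = 0" if "k < m" for k
        using Suc.prems(3)[of "Suc k"] that unfolding deriv_iter_Suc_right by simp
    qed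
    then show ?thesis using that by blast
  qed
  have "((\<lambda>z. \<phi> z - C / real (Suc m) * (z - a) ^ Suc m) has_real_derivative 0) (at z within K)" if "z \<in> K" for z
  proof -
    have "(\<phi> has_real_derivative C * (z - a) ^ m) (at z)" using Suc.prems(1)[OF that, of 0] C[OF that] by simp
    moreover have "((\<lambda>z. C / real (Suc m) * (z - a) ^ Suc m) has_real_derivative C * (z - a) ^ m) (at z)"
    proof -
      have "((\<lambda>z. (z - a) ^ Suc m) has_real_derivative real (Suc m) * (z - a) ^ m) (at z)"
        by (rule derivative_eq_intros refl | simp)+
      from DERIV_cmult[OF this, of "C / real (Suc m)"] show ?thesis by (simp del: of_nat_Suc)
    qed
    ultimately have "((\<lambda>z. \<phi> z - C / real (Suc m) * (z - a) ^ Suc m) has_real_derivative C * (z - a) ^ m - C * (z - a) ^ m) (at z)"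
      by (rule DERIV_diff)
    then show ?thesis by (simp add: has_field_derivative_at_within)
  qed
  from has_field_derivative_zero_constant[OF _ this]
  obtain c where c: "\<And>z. z \<in> K \<Longrightarrow> \<phi> z - C / real (Suc m) * (z - a) ^ Suc m = c"
    using K(1) is_interval_convex_1 by blast
  have "c = 0" using c[OF K(2)] Suc.prems(3)[of 0] by simp
  then show ?case using c by (intro exI[of _ "C / real (Suc m)"]) auto
qed

text \<open>
  The intermediate form \<open>\<rho> = \<rho>\<^sub>0(z)\<close>, \<open>\<psi> = R(z) w + T(z)\<close>, from which the vanishing of \<open>T\<close> and the
  projectivity of \<open>\<rho>\<^sub>0\<close> are derived.
\<close>

locale affine_equiv = equiv_transf +
  fixes \<rho>0 R T :: "real \<Rightarrow> real"
  assumes sm0: "smooth_on (fst ` U) \<rho>0" and smR: "smooth_on (fst ` U) R" and smT: "smooth_on (fst ` U) T"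
    and \<rho>_eq: "\<And>z w. (z, w) \<in> U \<Longrightarrow> \<rho> (z, w) = \<rho>0 z" and \<psi>_eq: "\<And>z w. (z, w) \<in> U \<Longrightarrow> \<psi> (z, w) = R z * w + T z"
    and R0: "\<And>z. z \<in> fst ` U \<Longrightarrow> R z \<noteq> 0" and \<rho>0': "\<And>z. z \<in> fst ` U \<Longrightarrow> deriv \<rho>0 z \<noteq> 0"
begin

abbreviation "K \<equiv> fst ` U"
abbreviation "r x0 l z \<equiv> gauge_poly n x0 0 l (\<rho>0 z)"

definition "g z = 1 / deriv \<rho>0 z"

lemma smg: "smooth_on K g"
  unfolding g_def[abs_def]
  by (rule smooth_on_divide[OF open_K smooth_on_const[OF open_K] smooth_on_deriv[OF open_K sm0] \<rho>0'])

lemma g0: "z \<in> K \<Longrightarrow> g z \<noteq> 0" and g_\<rho>0: "z \<in> K \<Longrightarrow> g z * deriv \<rho>0 z = 1"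
  using \<rho>0' by (auto simp: g_def)

lemma smr: "smooth_on K (r x0 l)"
  by (rule smooth_on_compose[OF smooth_gauge_poly[OF open_UNIV] open_K open_UNIV sm0]) auto

lemma pullback_affine:
  assumes S: "open S" "S \<subseteq> K" and w: "smooth_on S w" "\<And>z. z \<in> S \<Longrightarrow> (z, w z) \<in> U"
    and r: "\<And>z. z \<in> S \<Longrightarrow> r x0 l z \<noteq> 0" and z: "z \<in> S"
  shows "r x0 l z * pullback n (gauge_F n x0 0 l) \<rho> \<psi> w z
    = (fop g (\<lambda>z. 0) ^^ n) (\<lambda>z. r x0 l z * (R z * w z + T z)) z"
proof -
  have d: "deriv (\<lambda>t. \<rho> (t, w t)) t = deriv \<rho>0 t" if "t \<in> S" for t
    by (rule deriv_cong_on_open[OF S(1) that]) (use w \<rho>_eq in auto)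
  have "pullback n (gauge_F n x0 0 l) \<rho> \<psi> w z
      = (fop g (\<lambda>t. gauge_F n x0 0 l (\<rho>0 t, \<psi> (t, w t))) ^^ n) (\<lambda>t. R t * w t + T t) z"
    unfolding pullback_def
    by (rule fop_iter_cong[OF S(1) _ _ _ z]) (use d \<rho>_eq \<psi>_eq w(2) in \<open>auto simp: g_def\<close>)
  moreover have "(fop g (\<lambda>z. 0) ^^ n) (\<lambda>z. r x0 l z * (R z * w z + T z)) z
      = r x0 l z * (fop g (\<lambda>t. gauge_F n x0 0 l (\<rho>0 t, \<psi> (t, w t))) ^^ n) (\<lambda>t. R t * w t + T t) z"
    by (rule fop_iter_gauge_F[OF S(1) smooth_on_subset[OF smg S(2)] smooth_on_subset[OF sm0 S(2)] _ _ z])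
      (use g_\<rho>0[OF subsetD[OF S(2)]] r S in \<open>auto simp: gauge_V_def intro!: smooth_on_add smooth_on_mult w smooth_on_subset[OF smR S(2)] smooth_on_subset[OF smT S(2)]\<close>)
  ultimately show ?thesis by simp
qed

lemma deriv_\<rho>_along:
  assumes "open S" "smooth_on S w" "z \<in> S" "(z, w z) \<in> U"
  shows "deriv (\<lambda>t. \<rho> (t, w t)) z = deriv \<rho>0 z"
proof -
  have "continuous_on S (\<lambda>z. (z, w z))" by (intro continuous_intros smooth_on_continuous assms)
  then have "open (S \<inter> (\<lambda>z. (z, w z)) -` U)" by (rule continuous_open_preimage) (use assms open_U in auto)
  then show ?thesis by (rule deriv_cong_on_open) (use assms \<rho>_eq in auto)
qed

text \<open>
  The test equation with parameter function \<open>r'/r\<close> is solved by \<open>y = y\<^sub>0/r\<close>, and the curve through the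
  given point is obtained by solving \<open>R w + T = y\<close> for \<open>w\<close>. Therefore a parameter function \<open>Q\<close> exists
  near that point, and both equations have the same zeros for all curves in a small box.
\<close>

lemma ex_local_linear_equation:
  assumes p: "(z1, w1) \<in> U" "w1 \<noteq> 0"
  obtains I e Q where "open I" "z1 \<in> I" "I \<subseteq> K" "e > 0" "0 \<notin> ball w1 e" "smooth_on (I \<times> ball w1 e) Q"
    "\<And>z. z \<in> I \<Longrightarrow> r (\<rho>0 z1) l z \<noteq> 0"
    "\<And>z0 S w. z0 \<in> I \<Longrightarrow> open S \<Longrightarrow> z0 \<in> S \<Longrightarrow> smooth_on S w \<Longrightarrow> w z0 \<in> ball w1 e \<Longrightarrow>
      (fop g (\<lambda>z. 0) ^^ n) (\<lambda>z. r (\<rho>0 z1) l z * (R z * w z + T z)) z0 = 0 \<longleftrightarrow> Omega_iter n Q w z0 = 0"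
proof -
  let ?x0 = "\<rho>0 z1"
  let ?r = "r ?x0 l" and ?F = "gauge_F n ?x0 0 l" and ?V = "gauge_V n ?x0 0 l"
  have z1: "z1 \<in> K" using p by force
  have r1: "?r z1 = 1" by (rule gauge_poly_base[OF n])
  have pV: "(\<rho> (z1, w1), \<psi> (z1, w1)) \<in> ?V" using r1 \<rho>_eq[OF p(1)] by (simp add: gauge_V_def)
  have "solvable_at n U \<rho> \<psi> ?F (z1, w1)"
  proof -
    define y0 where "y0 = \<psi> (z1, w1)"
    define w where "w z = (y0 / ?r z - T z) / R z" for z
    define S0 where "S0 = K \<inter> ?r -` (- {0})"
    have S0: "open S0" unfolding S0_def
      by (rule continuous_open_preimage[OF smooth_on_continuous[OF smr] open_K]) auto
    have S0K: "S0 \<subseteq> K" by (auto simp: S0_def)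
    have sw: "smooth_on S0 w" unfolding w_def[abs_def]
      by (intro smooth_on_divide smooth_on_diff smooth_on_const S0 smooth_on_subset[OF smr S0K]
          smooth_on_subset[OF smR S0K] smooth_on_subset[OF smT S0K]) (use R0 in \<open>auto simp: S0_def\<close>)
    have w1: "w z1 = w1" using R0[OF z1] r1 \<psi>_eq[OF p(1)] by (simp add: w_def y0_def)
    define S where "S = S0 \<inter> (\<lambda>z. (z, w z)) -` U"
    have "continuous_on S0 (\<lambda>z. (z, w z))" by (intro continuous_intros smooth_on_continuous sw)
    then have S: "open S" unfolding S_def by (rule continuous_open_preimage) (use S0 open_U in auto)
    have z1S: "z1 \<in> S" using z1 r1 w1 p by (simp add: S_def S0_def)
    have SS0: "S \<subseteq> S0" by (auto simp: S_def)
    have sw': "smooth_on S w" by (rule smooth_on_subset[OF sw SS0])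
    have "?r z1 * pullback n ?F \<rho> \<psi> w z1 = (fop g (\<lambda>z. 0) ^^ n) (\<lambda>z. ?r z * (R z * w z + T z)) z1"
      by (rule pullback_affine[OF S _ sw' _ _ z1S]) (auto simp: S_def S0_def)
    also have "\<dots> = 0"
      by (rule fop_iter_zero_of_const[OF S z1S, of _ y0]) (use R0 n in \<open>auto simp: S_def S0_def w_def\<close>)
    finally have pb: "pullback n ?F \<rho> \<psi> w z1 = 0" using r1 by simp
    have "deriv (\<lambda>t. \<rho> (t, w t)) z1 \<noteq> 0"
      using deriv_\<rho>_along[OF S sw' z1S] \<rho>0'[OF z1] w1 p by simp
    then show ?thesis
      using solvable_atI[OF open_gauge_V smooth_gauge_F _ S sw' z1S _ _ pb] pV p unfolding w1 by blast
  qed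
  from ex_parameter_function[OF open_gauge_V smooth_gauge_F p(1) pV _ this] p(2)
  obtain D Q where D: "open D" "(z1, w1) \<in> D" "D \<subseteq> U" "(\<lambda>q. (\<rho> q, \<psi> q)) ` D \<subseteq> ?V" "parameter_function n D \<rho> \<psi> ?F Q"
    by auto
  obtain A B where AB: "open A" "open B" "z1 \<in> A" "w1 \<in> B" "A \<times> B \<subseteq> D"
    using open_prod_elim[OF D(1,2)] by (metis mem_Sigma_iff)
  have "open (B \<inter> - {0})" using AB by (intro open_Int) auto
  moreover have "w1 \<in> B \<inter> - {0}" using AB p by simp
  ultimately obtain e where e: "e > 0" "ball w1 e \<subseteq> B \<inter> - {0}"
    unfolding open_contains_ball by blast
  have box: "A \<times> ball w1 e \<subseteq> D" using AB e by auto
  have DV: "?r z \<noteq> 0" if "(z, w) \<in> D" for z w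
  proof -
    have "(\<rho> (z, w), \<psi> (z, w)) \<in> ?V" using D(4) that by auto
    then show ?thesis using that D(3) \<rho>_eq[of z w] by (auto simp: gauge_V_def)
  qed
  have w1b: "w1 \<in> ball w1 e" using e by simp
  show ?thesis
  proof (rule that[OF AB(1,3) _ e(1)])
    show "A \<subseteq> K"
    proof
      fix z assume "z \<in> A"
      then have "(z, w1) \<in> U" using box w1b D(3) by blast
      then show "z \<in> K" by force
    qed
    show "0 \<notin> ball w1 e" using e by auto
    show "smooth_on (A \<times> ball w1 e) Q"
      using D(5) smooth_on_subset[OF _ box] by (auto simp: parameter_function_def)
    show "?r z \<noteq> 0" if "z \<in> A" for z using DV[of z w1] box w1b that by blast
    show "(fop g (\<lambda>z. 0) ^^ n) (\<lambda>z. ?r z * (R z * w z + T z)) z0 = 0 \<longleftrightarrow> Omega_iter n Q w z0 = 0"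
      if z0: "z0 \<in> A" "open S" "z0 \<in> S" "smooth_on S w" "w z0 \<in> ball w1 e" for z0 S w
    proof -
      have zD: "(z0, w z0) \<in> D" using box z0 by blast
      then have zU: "(z0, w z0) \<in> U" using D by auto
      have "deriv (\<lambda>t. \<rho> (t, w t)) z0 = deriv \<rho>0 z0" by (rule deriv_\<rho>_along[OF z0(2,4,3) zU])
      then have X': "deriv (\<lambda>t. \<rho> (t, w t)) z0 \<noteq> 0" using \<rho>0' zU by force
      have "pullback n ?F \<rho> \<psi> w z0 = 0 \<longleftrightarrow> Omega_iter n Q w z0 = 0"
        by (rule parameter_function_zero_iff[OF D(5) _ D(1,3) open_gauge_V smooth_gauge_F D(4) z0(2,4,3) zD X'])
          (use n in simp)
      moreover define S' where "S' = S \<inter> (\<lambda>z. (z, w z)) -` D"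
      have "continuous_on S (\<lambda>z. (z, w z))" by (intro continuous_intros smooth_on_continuous z0)
      then have S': "open S'" unfolding S'_def by (rule continuous_open_preimage) (use z0 D in auto)
      have "?r z0 * pullback n ?F \<rho> \<psi> w z0 = (fop g (\<lambda>z. 0) ^^ n) (\<lambda>z. ?r z * (R z * w z + T z)) z0"
      proof (rule pullback_affine[OF S'])
        show "S' \<subseteq> K"
        proof
          fix z assume "z \<in> S'"
          then have "(z, w z) \<in> U" using D(3) by (auto simp: S'_def)
          then show "z \<in> K" by force
        qed
        show "smooth_on S' w" by (rule smooth_on_subset[OF z0(4)]) (auto simp: S'_def)
        show "(z, w z) \<in> U" if "z \<in> S'" for z using that D(3) by (auto simp: S'_def)
        show "?r z \<noteq> 0" if "z \<in> S'" for z by (rule DV[of z "w z"]) (use that in \<open>auto simp: S'_def\<close>)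
        show "z0 \<in> S'" using z0 zD by (simp add: S'_def)
      qed
      moreover have "?r z0 \<noteq> 0" by (rule DV[OF zD])
      ultimately show ?thesis by (metis mult_eq_0_iff)
    qed
  qed
qed

lemma ex_nonzero_in_section:
  assumes "z \<in> K" obtains w where "(z, w) \<in> U" "w \<noteq> 0"
proof -
  from assms obtain w where w: "(z, w) \<in> U" by force
  have "open ((\<lambda>t. (z, t)) -` U)" by (intro open_vimage open_U continuous_intros)
  moreover have "w \<in> (\<lambda>t. (z, t)) -` U" using w by simp
  ultimately obtain e where e: "e > 0" "ball w e \<subseteq> (\<lambda>t. (z, t)) -` U"
    unfolding open_contains_ball by blast
  have "w + e / 2 \<in> ball w e" using e(1) by (simp add: dist_real_def)
  then have "(z, w + e / 2) \<in> U" using e(2) by auto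
  then show ?thesis using that[of w] that[of "w + e / 2"] w e(1) by (cases "w = 0") auto
qed

lemma local_conclusion:
  assumes p: "(z1, w1) \<in> U" "w1 \<noteq> 0"
  shows "(fop g (\<lambda>z. 0) ^^ n) (\<lambda>z. r (\<rho>0 z1) l z * T z) z1 = 0"
proof -
  obtain I e Q where I: "open I" "z1 \<in> I" "I \<subseteq> K" "e > 0" "0 \<notin> ball w1 e" "smooth_on (I \<times> ball w1 e) Q"
    and r: "\<And>z. z \<in> I \<Longrightarrow> r (\<rho>0 z1) l z \<noteq> 0"
    and zero: "\<And>z0 S w. z0 \<in> I \<Longrightarrow> open S \<Longrightarrow> z0 \<in> S \<Longrightarrow> smooth_on S w \<Longrightarrow> w z0 \<in> ball w1 e \<Longrightarrow>
      (fop g (\<lambda>z. 0) ^^ n) (\<lambda>z. r (\<rho>0 z1) l z * (R z * w z + T z)) z0 = 0 \<longleftrightarrow> Omega_iter n Q w z0 = 0"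
    by (rule ex_local_linear_equation[OF p, of l]) (rule that)
  note sm = smooth_on_subset[OF _ I(3)]
  show ?thesis
  proof (rule linear_parameter_function(1)[OF n I(1,4,5,6), where g = g and R = "\<lambda>z. r (\<rho>0 z1) l z * R z"])
    show "(fop g (\<lambda>z. 0) ^^ n) (\<lambda>z. r (\<rho>0 z1) l z * R z * w z + r (\<rho>0 z1) l z * T z) z0 = 0 \<longleftrightarrow> Omega_iter n Q w z0 = 0"
      if "z0 \<in> I" "smooth_on UNIV w" "w z0 \<in> ball w1 e" for z0 w
      using zero[OF that(1) open_UNIV UNIV_I that(2,3)] by (simp add: distrib_left mult.assoc)
  qed (use I g0 R0 r sm[OF smg] sm[OF smr] sm[OF smR] sm[OF smT] in \<open>auto intro!: smooth_on_mult\<close>)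
qed

text \<open>
  By comparison with linear equations, \<open>r T\<close> has a vanishing \<open>n\<close>-th derivative with respect to \<open>x\<close> at
  \<open>z\<^sub>1\<close>, for \<open>r = 1\<close> as well as for \<open>r = 1 + (x - x\<^sub>1)\<^sup>n\<close>. The difference of the two statements is
  \<open>n! T(z\<^sub>1) = 0\<close>.
\<close>

lemma T_eq_0:
  assumes z: "z1 \<in> K" shows "T z1 = 0"
proof -
  obtain w1 where p: "(z1, w1) \<in> U" "w1 \<noteq> 0" using ex_nonzero_in_section[OF z] by blast
  let ?x = "\<lambda>z. \<rho>0 z - \<rho>0 z1"
  have sx: "smooth_on K ?x" by (intro smooth_on_diff smooth_on_const open_K sm0)
  have dx: "g t * deriv ?x t = 1" if t: "t \<in> K" for t
  proof -
    have "(?x has_real_derivative deriv \<rho>0 t) (at t)"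
      by (auto intro!: derivative_eq_intros smooth_on_deriv_has_derivative[OF sm0 t])
    then show ?thesis using g_\<rho>0[OF t] by (simp add: DERIV_imp_deriv)
  qed
  have c0: "smooth_on K (\<lambda>z. 0 :: real)" by (rule smooth_on_const[OF open_K])
  have "(\<lambda>z. r (\<rho>0 z1) 1 z * T z) = (\<lambda>z. 1 * T z + 1 * (?x z ^ n * T z))"
    by (auto simp: gauge_poly_def algebra_simps)
  moreover have "smooth_on K (\<lambda>z. ?x z ^ n * T z)" by (intro smooth_on_mult smooth_on_power open_K sx smT)
  from fop_iter_linear[OF open_K smg c0 smT this z, of n 1 1]
  have "(fop g (\<lambda>z. 0) ^^ n) (\<lambda>z. 1 * T z + 1 * (?x z ^ n * T z)) z1
      = (fop g (\<lambda>z. 0) ^^ n) T z1 + fact n * T z1"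
    using fop_iter_coordinate_power[OF open_K smg c0 smT sx dx z, of n n] by simp
  moreover have "(\<lambda>z. r (\<rho>0 z1) 0 z * T z) = T" by (auto simp: gauge_poly_def)
  ultimately show ?thesis using local_conclusion[OF p, of 0] local_conclusion[OF p, of 1] by simp
qed

text \<open>
  The parameter function that corresponds to \<open>F = 0\<close>.
\<close>

definition "q z = deriv R z / R z + (real n - 1) / 2 * (deriv g z / g z)"

lemma smq: "smooth_on K q"
  unfolding q_def[abs_def] using R0 g0
  by (intro smooth_on_add smooth_on_mult smooth_on_divide smooth_on_const smooth_on_deriv open_K smR smg) auto

text \<open>
  Polynomials in \<open>x\<close> of degree less than \<open>n\<close> solve \<open>y\<^sup>(\<^sup>n\<^sup>) = 0\<close>, so the corresponding functions \<open>w = y/R\<close>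
  solve the transformed equation, which is linear. The polynomial \<open>(x - \<rho>\<^sub>0(a))\<^sup>n\<^sup>-\<^sup>1\<close> is added to a
  constant with a small factor, in order that the curve lies in the box where \<open>Q = q\<close> is known.
\<close>

lemma fop_q_power:
  assumes a: "a \<in> K" and z: "z1 \<in> K"
  shows "(fop (\<lambda>z. 1) q ^^ n) (\<lambda>z. (\<rho>0 z - \<rho>0 a) ^ (n - 1) / R z) z1 = 0"
proof -
  obtain w1 where p: "(z1, w1) \<in> U" "w1 \<noteq> 0" using ex_nonzero_in_section[OF z] by blast
  obtain I e Q where I: "open I" "z1 \<in> I" "I \<subseteq> K" "e > 0" "0 \<notin> ball w1 e" "smooth_on (I \<times> ball w1 e) Q"
    and zero': "\<And>z0 S w. z0 \<in> I \<Longrightarrow> open S \<Longrightarrow> z0 \<in> S \<Longrightarrow> smooth_on S w \<Longrightarrow> w z0 \<in> ball w1 e \<Longrightarrow>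
      (fop g (\<lambda>z. 0) ^^ n) (\<lambda>z. r (\<rho>0 z1) 0 z * (R z * w z + T z)) z0 = 0 \<longleftrightarrow> Omega_iter n Q w z0 = 0"
    by (rule ex_local_linear_equation[OF p, of 0]) (rule that)
  have r1: "r (\<rho>0 z1) 0 z = 1" for z by (simp add: gauge_poly_def)
  have zero: "(fop g (\<lambda>z. 0) ^^ n) (\<lambda>z. R z * w z + T z) z0 = 0 \<longleftrightarrow> Omega_iter n Q w z0 = 0"
    if "z0 \<in> I" "open S" "z0 \<in> S" "smooth_on S w" "w z0 \<in> ball w1 e" for z0 S w
    using zero'[OF that] by (simp add: r1)
  note sm = smooth_on_subset[OF _ I(3)]
  have Q: "Q (z, w) = q z" if "z \<in> I" "w \<in> ball w1 e" for z w
    unfolding q_def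
    by (rule linear_parameter_function(2)[OF n I(1,4,5,6) sm[OF smg] sm[OF smR] sm[OF smT] _ _ _ that])
      (use g0[OF subsetD[OF I(3)]] R0[OF subsetD[OF I(3)]] zero[OF _ open_UNIV UNIV_I] in auto)
  let ?x = "\<lambda>z. \<rho>0 z - \<rho>0 a"
  have sx: "smooth_on K ?x" by (intro smooth_on_diff smooth_on_const open_K sm0)
  have dx: "g t * deriv ?x t = 1" if t: "t \<in> K" for t
  proof -
    have "(?x has_real_derivative deriv \<rho>0 t) (at t)"
      by (auto intro!: derivative_eq_intros smooth_on_deriv_has_derivative[OF sm0 t])
    then show ?thesis using g_\<rho>0[OF t] by (simp add: DERIV_imp_deriv)
  qed
  define u where "u z = w1 * R z1 / R z" for z
  define v where "v z = ?x z ^ (n - 1) / R z" for z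
  have su: "smooth_on K u" and sv: "smooth_on K v"
    unfolding u_def[abs_def] v_def[abs_def]
    using R0 by (intro smooth_on_divide smooth_on_const smooth_on_power open_K smR sx; simp)+
  have c0: "smooth_on K (\<lambda>z. 0 :: real)" and c1: "smooth_on K (\<lambda>z. 1 :: real)" by (rule smooth_on_const[OF open_K])+
  have key: "(fop (\<lambda>z. 1) q ^^ n) (\<lambda>z. 1 * u z + \<eta> * v z) z1 = 0" if \<eta>: "1 * u z1 + \<eta> * v z1 \<in> ball w1 e" for \<eta>
  proof -
    let ?w = "\<lambda>z. 1 * u z + \<eta> * v z"
    have sw: "smooth_on K ?w" by (intro smooth_on_add smooth_on_mult smooth_on_const open_K su sv)
    have "(fop g (\<lambda>z. 0) ^^ n) (\<lambda>z. R z * ?w z + T z) z1 = (fop g (\<lambda>z. 0) ^^ n) (\<lambda>z. 1 * (w1 * R z1) + 1 * (\<eta> * ?x z ^ (n - 1))) z1"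
      by (rule fop_iter_cong[OF open_K _ _ _ z]) (use R0 T_eq_0 in \<open>auto simp: u_def v_def field_simps\<close>)
    also have "\<dots> = 1 * (fop g (\<lambda>z. 0) ^^ n) (\<lambda>z. w1 * R z1) z1 + 1 * (fop g (\<lambda>z. 0) ^^ n) (\<lambda>z. \<eta> * ?x z ^ (n - 1)) z1"
      by (rule fop_iter_linear[OF open_K smg c0 _ _ z])
        (intro smooth_on_mult smooth_on_power smooth_on_const open_K sx)+
    also have "\<dots> = 0"
      using fop_iter_zero_of_const[OF open_K z, of "\<lambda>z. w1 * R z1" "w1 * R z1" n g] n
        fop_iter_coordinate_power_eq_0[OF open_K sx dx z, of "n - 1" n \<eta>] by simp
    finally have "Omega_iter n Q ?w z1 = 0" using zero[OF I(2) open_K z sw \<eta>] by simp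
    moreover have "Omega_iter n Q ?w z1 = (fop (\<lambda>z. 1) q ^^ n) ?w z1"
      unfolding Omega_iter_eq_fop
    proof (rule fop_iter_cong)
      have "continuous_on K ?w" by (rule smooth_on_continuous[OF sw])
      then have "open (K \<inter> ?w -` ball w1 e)" by (rule continuous_open_preimage) (use open_K in auto)
      then show "open (I \<inter> (K \<inter> ?w -` ball w1 e))" using I(1) by (rule open_Int[rotated])
      show "z1 \<in> I \<inter> (K \<inter> ?w -` ball w1 e)" using I(2) z \<eta> by simp
    qed (use Q in auto)
    ultimately show ?thesis by simp
  qed
  have u1: "u z1 = w1" using R0[OF z] by (simp add: u_def)
  define \<eta> where "\<eta> = e / (2 * (1 + \<bar>v z1\<bar>))"
  have \<eta>0: "\<eta> > 0" using I(4) by (simp add: \<eta>_def)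
  have "\<bar>\<eta> * v z1\<bar> < e"
  proof -
    have "\<bar>\<eta> * v z1\<bar> \<le> \<eta> * (1 + \<bar>v z1\<bar>)" using \<eta>0 by (simp add: abs_mult)
    also have "\<dots> = e / 2" by (simp add: \<eta>_def field_simps add_nonneg_eq_0_iff)
    finally show ?thesis using I(4) by simp
  qed
  then have b: "1 * u z1 + \<eta> * v z1 \<in> ball w1 e" "1 * u z1 + 0 * v z1 \<in> ball w1 e"
    using I(4) by (auto simp: u1 dist_real_def)
  have lin: "(fop (\<lambda>z. 1) q ^^ n) (\<lambda>z. 1 * u z + c * v z) z1
      = 1 * (fop (\<lambda>z. 1) q ^^ n) u z1 + c * (fop (\<lambda>z. 1) q ^^ n) v z1" for c
    by (rule fop_iter_linear[OF open_K c1 smq su sv z])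
  have "(fop (\<lambda>z. 1) q ^^ n) v z1 = 0"
    using key[OF b(1)] key[OF b(2)] lin[of \<eta>] lin[of 0] \<eta>0 by simp
  then show ?thesis by (simp add: v_def[abs_def])
qed

lemma is_interval_K: "is_interval K"
  using convex_linear_image[OF linear_fst conv] by (simp add: is_interval_convex_1)

text \<open>
  The gauge \<open>E = R f\<close> with \<open>E' = q E\<close> turns \<open>(d/dz + q)\<^sup>n\<close> into \<open>d\<^sup>n/dz\<^sup>n\<close>. Thus \<open>f (\<rho>\<^sub>0 - \<rho>\<^sub>0(a))\<^sup>n\<^sup>-\<^sup>1\<close> is
  a polynomial in \<open>z\<close> of degree less than \<open>n\<close>; as it vanishes to order \<open>n - 1\<close> at \<open>a\<close>, it is a multiple
  of \<open>(z - a)\<^sup>n\<^sup>-\<^sup>1\<close>.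
\<close>

lemma ex_projective_form:
  assumes "U \<noteq> {}"
  shows "\<exists>k1 k2 k3 k4. projective_form U \<rho> \<psi> k1 k2 k3 k4 R"
proof -
  \<comment> \<open>This is \<open>\<bar>g\<bar>\<close> to the power \<open>(n - 1)/2\<close>, in a form that is differentiable for either sign of \<open>g\<close>.\<close>
  define f where "f z = exp ((real n - 1) / 4 * ln ((g z)\<^sup>2))" for z
  have fR: "((\<lambda>z. R z * f z) has_real_derivative R z * f z * q z) (at z)" if z: "z \<in> K" for z
  proof -
    have "((\<lambda>z. R z * f z) has_real_derivative
        deriv R z * f z + R z * (f z * ((real n - 1) / 4 * (2 * g z * deriv g z / (g z)\<^sup>2)))) (at z)"
      unfolding f_def using g0[OF z]
      by (auto intro!: derivative_eq_intros smooth_on_deriv_has_derivative[OF smR z] smooth_on_deriv_has_derivative[OF smg z])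
    moreover have "deriv R z * f z + R z * (f z * ((real n - 1) / 4 * (2 * g z * deriv g z / (g z)\<^sup>2))) = R z * f z * q z"
      using g0[OF z] R0[OF z] by (simp add: q_def field_simps power2_eq_square)
    ultimately show ?thesis by simp
  qed
  have "\<exists>C. \<forall>z\<in>K. f z * (\<rho>0 z - \<rho>0 a) ^ (n - 1) = C * (z - a) ^ (n - 1)" if a: "a \<in> K" for a
  proof -
    let ?v = "\<lambda>z. (\<rho>0 z - \<rho>0 a) ^ (n - 1) / R z"
    let ?\<phi> = "\<lambda>z. (R z * f z) * ?v z"
    have sv: "smooth_on K ?v"
      using R0 by (intro smooth_on_divide smooth_on_power smooth_on_diff smooth_on_const open_K smR sm0) auto
    have E: "(deriv ^^ k) ?\<phi> z = (R z * f z) * (fop (\<lambda>z. 1) q ^^ k) ?v z" if "z \<in> K" for k z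
      by (rule deriv_iter_exponential_gauge[OF open_K smq sv fR that])
    have c1: "smooth_on K (\<lambda>z. 1 :: real)" by (rule smooth_on_const[OF open_K])
    have "\<exists>C. \<forall>z\<in>K. ?\<phi> z = C * (z - a) ^ (n - 1)"
    proof (rule monomial_of_deriv_iter[OF is_interval_K a])
      show "((deriv ^^ k) ?\<phi> has_real_derivative (deriv ^^ Suc k) ?\<phi> z) (at z)" if z: "z \<in> K" for k z
      proof -
        let ?u = "\<lambda>z. (R z * f z) * (fop (\<lambda>t. 1) q ^^ k) ?v z"
        have "\<exists>d. (?u has_real_derivative d) (at z)"
          using DERIV_mult[OF fR[OF z] fop_iter_has_derivative[OF open_K c1 smq sv z]] by blast
        then obtain d where "(?u has_real_derivative d) (at z)" by blast
        then have "((deriv ^^ k) ?\<phi> has_real_derivative d) (at z)"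
          using has_field_derivative_transform_within_open[OF _ open_K z, of ?u d "(deriv ^^ k) ?\<phi>"] E by simp
        then show ?thesis by (simp add: DERIV_imp_deriv)
      qed
      show "(deriv ^^ Suc (n - 1)) ?\<phi> z = 0" if z: "z \<in> K" for z
      proof -
        have "Suc (n - 1) = n" using n by simp
        then show ?thesis using E[OF z, where k = n] fop_q_power[OF a z] by simp
      qed
      show "(deriv ^^ k) ?\<phi> a = 0" if k: "k < n - 1" for k
      proof -
        let ?x = "\<lambda>z. \<rho>0 z - \<rho>0 a"
        have "smooth_on K ?x" by (intro smooth_on_diff smooth_on_const open_K sm0)
        moreover have "smooth_on K (\<lambda>z. 1 / R z)"
          using R0 by (intro smooth_on_divide smooth_on_const open_K smR) auto
        ultimately have "(fop (\<lambda>z. 1) q ^^ k) (\<lambda>z. ?x z ^ (n - 1) * (1 / R z)) a = 0"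
          using fop_iter_vanishing[OF open_K c1 smq, of ?x "\<lambda>z. 1 / R z" a k "n - 1"] a k by simp
        then show ?thesis using E[OF a, where k = k] by simp
      qed
    qed
    then show ?thesis using R0 by auto
  qed
  moreover have "K \<noteq> {}" "n - 1 \<ge> 1" using assms n by auto
  moreover have "f z \<noteq> 0" for z by (simp add: f_def)
  ultimately have "\<exists>k1 k2 k3 k4. (k4 = 0 \<or> k4 = 1) \<and> k2 * k3 - k1 * k4 \<noteq> 0 \<and>
      (\<forall>z\<in>K. k4 * z + k3 \<noteq> 0 \<and> \<rho>0 z = (k2 * z + k1) / (k4 * z + k3))"
    by (intro projective_of_power_quotients[OF open_K is_interval_K _ sm0 \<rho>0', where f = f and m = "n - 1"])
  then obtain k1 k2 k3 k4 where k: "k4 = 0 \<or> k4 = 1" "k2 * k3 - k1 * k4 \<noteq> 0"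
    "\<And>z. z \<in> K \<Longrightarrow> k4 * z + k3 \<noteq> 0 \<and> \<rho>0 z = (k2 * z + k1) / (k4 * z + k3)"
    by blast
  have "k4 * z + k3 \<noteq> 0 \<and> R z \<noteq> 0 \<and> \<rho> (z, w) = (k2 * z + k1) / (k4 * z + k3) \<and> \<psi> (z, w) = R z * w"
    if "(z, w) \<in> U" for z w
  proof -
    have "z \<in> K" using that by force
    then show ?thesis using k(3) R0 T_eq_0 \<rho>_eq[OF that] \<psi>_eq[OF that] by auto
  qed
  then show ?thesis using k smR unfolding projective_form_def by blast
qed

end

lemma projective_form_of_equivalence_transformation:
  assumes "open U" "convex U" "n \<ge> 2" and eq: "equivalence_transformation n U \<rho> \<psi>"
  shows "\<exists>k1 k2 k3 k4 R. projective_form U \<rho> \<psi> k1 k2 k3 k4 R"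
proof (cases "U = {}")
  case True
  have "projective_form {} \<rho> \<psi> 0 1 1 0 (\<lambda>z. 0)"
    by (simp add: projective_form_def smooth_on_const)
  then show ?thesis using True by blast
next
  case False
  have "point_transformation U \<rho> \<psi>" using eq by (simp add: equivalence_transformation_def)
  then interpret equiv_transf U \<rho> \<psi> n
    using assms by unfold_locales (auto simp: point_transformation_def)
  obtain \<rho>0 R T where "affine_equiv U \<rho> \<psi> n \<rho>0 R T"
  proof (rule ex_affine_form)
    fix \<rho>0 R T
    assume "smooth_on (fst ` U) \<rho>0" "smooth_on (fst ` U) R" "smooth_on (fst ` U) T"
      "\<And>z w. (z, w) \<in> U \<Longrightarrow> \<rho> (z, w) = \<rho>0 z" "\<And>z w. (z, w) \<in> U \<Longrightarrow> \<psi> (z, w) = R z * w + T z"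
      "\<And>z. z \<in> fst ` U \<Longrightarrow> R z \<noteq> 0" "\<And>z. z \<in> fst ` U \<Longrightarrow> deriv \<rho>0 z \<noteq> 0"
    then have "affine_equiv U \<rho> \<psi> n \<rho>0 R T" by unfold_locales
    then show ?thesis using that by blast
  qed
  then show ?thesis using affine_equiv.ex_projective_form[of U \<rho> \<psi> n \<rho>0 R T] False by blast
qed

theorem theorem2:
  fixes U :: "(real \<times> real) set"
  assumes "open U" and "convex U"
  shows
    "(\<forall>\<rho> \<psi>.
        (equivalence_transformation 1 U \<rho> \<psi> \<longleftrightarrow> point_transformation U \<rho> \<psi>) \<and>
        (point_transformation U \<rho> \<psi> \<longrightarrow>
          (\<forall>V F. open V \<and> smooth_on V F \<longrightarrow>
            (let D = {p \<in> U. (\<rho> p, \<psi> p) \<in> V \<and>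
                       snd p * (F (\<rho> p, \<psi> p) * \<psi> p * partial2 \<rho> p + partial2 \<psi> p) \<noteq> 0};
                 Q1 = (\<lambda>p. (F (\<rho> p, \<psi> p) * \<psi> p * partial1 \<rho> p + partial1 \<psi> p) /
                       (snd p * (F (\<rho> p, \<psi> p) * \<psi> p * partial2 \<rho> p + partial2 \<psi> p)))
             in parameter_function 1 D \<rho> \<psi> F Q1 \<and>
                (\<forall>D' Q. open D' \<and> D' \<subseteq> D \<and> parameter_function 1 D' \<rho> \<psi> F Q \<longrightarrow>
                   (\<forall>p\<in>D'. Q p = Q1 p))))))
     \<and>
     (\<forall>n\<ge>2. \<forall>\<rho> \<psi>.
        (equivalence_transformation n U \<rho> \<psi> \<longleftrightarrow>
           (\<exists>k1 k2 k3 k4 R. projective_form U \<rho> \<psi> k1 k2 k3 k4 R)) \<and>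
        (\<forall>k1 k2 k3 k4 R. projective_form U \<rho> \<psi> k1 k2 k3 k4 R \<longrightarrow>
          (\<forall>V F. open V \<and> smooth_on V F \<longrightarrow>
            parameter_function n {p \<in> U. (\<rho> p, \<psi> p) \<in> V} \<rho> \<psi> F
              (\<lambda>(z, w). F (\<rho> (z, w), R z * w) * partial1 \<rho> (z, w) + deriv R z / R z
                 - ((real n - 1) / 2) * (partial1 (partial1 \<rho>) (z, w) / partial1 \<rho> (z, w))))))"
proof (intro conjI allI impI)
  fix \<rho> \<psi> :: "real \<times> real \<Rightarrow> real"
  have transf: "point_transf U \<rho> \<psi>" if "point_transformation U \<rho> \<psi>"
    using that assms(1) by unfold_locales (auto simp: point_transformation_def)
  show "equivalence_transformation 1 U \<rho> \<psi> \<longleftrightarrow> point_transformation U \<rho> \<psi>"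
  proof
    assume "equivalence_transformation 1 U \<rho> \<psi>"
    then show "point_transformation U \<rho> \<psi>" unfolding equivalence_transformation_def by (rule conjunct1)
  next
    assume pt: "point_transformation U \<rho> \<psi>"
    show "equivalence_transformation 1 U \<rho> \<psi>"
      by (rule point_transf.equivalence_transformation_1[OF transf[OF pt] pt])
  qed
  fix V :: "(real \<times> real) set" and F :: "real \<times> real \<Rightarrow> real"
  assume pt: "point_transformation U \<rho> \<psi>" and VF: "open V \<and> smooth_on V F"
  interpret point_transf U \<rho> \<psi> by (rule transf[OF pt])
  show "let D = {p \<in> U. (\<rho> p, \<psi> p) \<in> V \<and>
                       snd p * (F (\<rho> p, \<psi> p) * \<psi> p * partial2 \<rho> p + partial2 \<psi> p) \<noteq> 0};
                 Q1 = (\<lambda>p. (F (\<rho> p, \<psi> p) * \<psi> p * partial1 \<rho> p + partial1 \<psi> p) /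
                       (snd p * (F (\<rho> p, \<psi> p) * \<psi> p * partial2 \<rho> p + partial2 \<psi> p)))
             in parameter_function 1 D \<rho> \<psi> F Q1 \<and>
                (\<forall>D' Q. open D' \<and> D' \<subseteq> D \<and> parameter_function 1 D' \<rho> \<psi> F Q \<longrightarrow>
                   (\<forall>p\<in>D'. Q p = Q1 p))"
    unfolding Let_def
    unfolding Q1_denominator_def[symmetric] Q1_numerator_def[symmetric] Q1_domain_def[symmetric]
    using parameter_function_Q1[of V F] Q1_unique[of V F] VF by blast
next
  fix n :: nat and \<rho> \<psi> :: "real \<times> real \<Rightarrow> real"
  assume n: "2 \<le> n"
  have proj: "projective U \<rho> \<psi> k1 k2 k3 k4 R" if "projective_form U \<rho> \<psi> k1 k2 k3 k4 R" for k1 k2 k3 k4 R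
    using that assms(1) by unfold_locales
  show "equivalence_transformation n U \<rho> \<psi> \<longleftrightarrow> (\<exists>k1 k2 k3 k4 R. projective_form U \<rho> \<psi> k1 k2 k3 k4 R)"
  proof
    assume "equivalence_transformation n U \<rho> \<psi>"
    then show "\<exists>k1 k2 k3 k4 R. projective_form U \<rho> \<psi> k1 k2 k3 k4 R"
      by (rule projective_form_of_equivalence_transformation[OF assms n])
  next
    assume "\<exists>k1 k2 k3 k4 R. projective_form U \<rho> \<psi> k1 k2 k3 k4 R"
    then obtain k1 k2 k3 k4 R where "projective_form U \<rho> \<psi> k1 k2 k3 k4 R" by blast
    from projective.equivalence_transformation[OF proj[OF this], of n]
    show "equivalence_transformation n U \<rho> \<psi>" using n by simp
  qed
  fix k1 k2 k3 k4 :: real and R :: "real \<Rightarrow> real"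
    and V :: "(real \<times> real) set" and F :: "real \<times> real \<Rightarrow> real"
  assume pf: "projective_form U \<rho> \<psi> k1 k2 k3 k4 R" and VF: "open V \<and> smooth_on V F"
  interpret projective U \<rho> \<psi> k1 k2 k3 k4 R by (rule proj[OF pf])
  show "parameter_function n {p \<in> U. (\<rho> p, \<psi> p) \<in> V} \<rho> \<psi> F
              (\<lambda>(z, w). F (\<rho> (z, w), R z * w) * partial1 \<rho> (z, w) + deriv R z / R z
                 - ((real n - 1) / 2) * (partial1 (partial1 \<rho>) (z, w) / partial1 \<rho> (z, w)))"
    using parameter_function_projective[of V F n] VF n unfolding Qn_def by simp
qed

end
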